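(* Let $(G,\leq)$ be an ordered group and let $S$ be a finite subset of $G$ with $|S|\geq 4$ such that $\langle S\rangle$ is non-abelian. If $|S^2|=3|S|-2$, then one of the following holds: (i) $S=\{a,ac,\dots,ac^i,b,bc,\dots,bc^j\}$ for some $a,b,c\in G$ and integers $i,j\geq 0$, where $[a,c]=[b,c]=1$, $c>1$ and either $ab=bac$ or $ba=abc$; (ii) $S=\{x,xc,xc^2,\dots,xc^{k-1}\}$ for some $x,c\in G$, where $k=|S|$, $c>1$ and either $c^x=c^2$ or $(c^2)^x=c$; (iii) $|S|=4$ and, for some elements $x,c$ (and $y$) of $G$, the structure of $S$ is of one of the following types: (a) either $S=\{x,xc,xc^x,xc^{x^2}\}$ or $S=\{x^{-1},x^{-1}c,x^{-1}c^x,x^{-1}c^{x^2}\}$, with $c>1$ and $c^{x^2}=cc^x=c^xc$; (b) $S=\{1,c,c^2,x\}$, where either $c^x=c^2$ or $(c^2)^x=c$; (c) $S=\{x,xc,xc^2,y\}$, where $[c,x]=1$ and either $[x,y]=c=(c^2)^y$ or $[y,x]=c^2=c^y$; (d) $S=\{x,xc,xc^2,y\}$, where $[c,x]=[x,y]=1$ and either $c^y=c^2$ or $(c^2)^y=c$. Moreover, if either (i) or (ii) or case (b) of (iii) holds, then $|S^2|=3|S|-2$.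
   Context: Groups are written multiplicatively with identity $1$. An ordered group $(G,\leq)$ is a group $G$ with a total order $\leq$ on the set $G$ such that $a\leq b$ implies $xay\leq xby$ for all $a,b,x,y\in G$. For a subset $S$ of $G$, $S^2=\{x_1x_2\mid x_1,x_2\in S\}$ and $\langle S\rangle$ is the subgroup generated by $S$. Notation: $[a,b]=a^{-1}b^{-1}ab$ and $a^b=b^{-1}ab$. *)

theory Defs
  imports "HOL-Algebra.Algebra"
begin

text \<open>The order is a relation on the carrier; \<open>a < b\<close> is written \<open>(a, b) \<in> R - Id\<close>.\<close>

locale ordered_group = group G for G (structure) +
  fixes R :: "'a rel"
  assumes linear_order: "linear_order_on (carrier G) R"
    and mult_mono:
      "\<lbrakk>(a, b) \<in> R; x \<in> carrier G; y \<in> carrier G\<rbrakk> \<Longrightarrow> (x \<otimes> a \<otimes> y, x \<otimes> b \<otimes> y) \<in> R"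

context
  fixes G :: "('a, 'b) monoid_scheme" (structure)
begin

definition commutator :: "'a \<Rightarrow> 'a \<Rightarrow> 'a"
  where "commutator a b = inv a \<otimes> inv b \<otimes> a \<otimes> b"

definition conjugate :: "'a \<Rightarrow> 'a \<Rightarrow> 'a"
  where "conjugate a b = inv b \<otimes> a \<otimes> b"

definition two_progressions :: "'a rel \<Rightarrow> 'a set \<Rightarrow> bool"
  where "two_progressions R S \<longleftrightarrow>
    (\<exists>a \<in> carrier G. \<exists>b \<in> carrier G. \<exists>c \<in> carrier G. \<exists>(i::nat) j::nat.
      S = {a \<otimes> c [^] m | m. m \<le> i} \<union> {b \<otimes> c [^] m | m. m \<le> j} \<and>
      commutator a c = \<one> \<and> commutator b c = \<one> \<and> (\<one>, c) \<in> R - Id \<and>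
      (a \<otimes> b = b \<otimes> a \<otimes> c \<or> b \<otimes> a = a \<otimes> b \<otimes> c))"

definition one_progression :: "'a rel \<Rightarrow> 'a set \<Rightarrow> bool"
  where "one_progression R S \<longleftrightarrow>
    (\<exists>x \<in> carrier G. \<exists>c \<in> carrier G.
      S = {x \<otimes> c [^] m | m. m < card S} \<and> (\<one>, c) \<in> R - Id \<and>
      (conjugate c x = c [^] (2::nat) \<or> conjugate (c [^] (2::nat)) x = c))"

definition fibonacci_quadruple :: "'a rel \<Rightarrow> 'a set \<Rightarrow> bool"
  where "fibonacci_quadruple R S \<longleftrightarrow>
    (\<exists>x \<in> carrier G. \<exists>c \<in> carrier G.
      (S = {x, x \<otimes> c, x \<otimes> conjugate c x, x \<otimes> conjugate c (x [^] (2::nat))} \<or>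
       S = {inv x, inv x \<otimes> c, inv x \<otimes> conjugate c x, inv x \<otimes> conjugate c (x [^] (2::nat))}) \<and>
      (\<one>, c) \<in> R - Id \<and>
      conjugate c (x [^] (2::nat)) = c \<otimes> conjugate c x \<and> c \<otimes> conjugate c x = conjugate c x \<otimes> c)"

definition unit_quadruple :: "'a set \<Rightarrow> bool"
  where "unit_quadruple S \<longleftrightarrow>
    (\<exists>x \<in> carrier G. \<exists>c \<in> carrier G.
      S = {\<one>, c, c [^] (2::nat), x} \<and>
      (conjugate c x = c [^] (2::nat) \<or> conjugate (c [^] (2::nat)) x = c))"

definition noncommuting_quadruple :: "'a set \<Rightarrow> bool"
  where "noncommuting_quadruple S \<longleftrightarrow>
    (\<exists>x \<in> carrier G. \<exists>c \<in> carrier G. \<exists>y \<in> carrier G.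
      S = {x, x \<otimes> c, x \<otimes> c [^] (2::nat), y} \<and> commutator c x = \<one> \<and>
      (commutator x y = c \<and> c = conjugate (c [^] (2::nat)) y \<or>
       commutator y x = c [^] (2::nat) \<and> c [^] (2::nat) = conjugate c y))"

definition commuting_quadruple :: "'a set \<Rightarrow> bool"
  where "commuting_quadruple S \<longleftrightarrow>
    (\<exists>x \<in> carrier G. \<exists>c \<in> carrier G. \<exists>y \<in> carrier G.
      S = {x, x \<otimes> c, x \<otimes> c [^] (2::nat), y} \<and> commutator c x = \<one> \<and> commutator x y = \<one> \<and>
      (conjugate c y = c [^] (2::nat) \<or> conjugate (c [^] (2::nat)) y = c))"

end

end

theory Submission
  imports Defs
begin
text \<open>
  List the elements of \<open>S\<close> in increasing order, \<open>x\<^sub>0 < \<dots> < x\<^sub>n\<^sub>-\<^sub>1\<close>. If \<open>S\<close> does not commute, the removal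
  of its maximum destroys at least three products (\<open>card_square_remove_greatest\<close>). Hence
  \<open>|S\<^sup>2| \<ge> 3|S| - 2\<close>, and in the case of equality (\<open>tight\<close>) every segment of the list that does not
  commute attains equality too, and as long as no commuting set is left each step destroys exactly three
  products. The same holds for the minimum, by reversing the order. So the problem becomes local: it
  is about segments of three and four consecutive elements.

  One local principle carries the global structure (\<open>commute_propagates_up\<close>): if the two largest
  elements of a tight set without its maximum commute, and this smaller set does not, then the
  maximum commutes with both of them.

  If \<open>S\<close> without its maximum or minimum \<open>y\<close> is a commuting set \<open>T\<close>, then \<open>S\<^sup>2\<close> is the disjoint union
  of \<open>T\<^sup>2\<close>, \<open>yT \<union> Ty\<close> and \<open>{y\<^sup>2}\<close>. Equality forces \<open>T\<close> to be a progression that is almost invariant under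
  conjugation by \<open>y\<close>. This gives a pair of progressions, or, for \<open>|T| = 3\<close>, one of the quadruples with
  parameter \<open>y\<close> (\<open>commuting_plus_one\<close>; the quadruple containing \<open>1\<close> is the case \<open>x = 1\<close> of the commuting
  one).

  Otherwise consider which consecutive elements commute. If none do, \<open>S\<^sup>2\<close> consists of the products
  \<open>x\<^sub>i\<^sup>2\<close>, \<open>x\<^sub>i x\<^sub>i\<^sub>+\<^sub>1\<close>, \<open>x\<^sub>i\<^sub>+\<^sub>1 x\<^sub>i\<close>, so each product \<open>x\<^sub>i x\<^sub>i\<^sub>+\<^sub>2\<close> and \<open>x\<^sub>i\<^sub>+\<^sub>2 x\<^sub>i\<close> equals one of these; the resulting
  equations leave the single progressions and the Fibonacci quadruples (\<open>noncommuting_chain\<close>). If all do, there is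
  a contradiction (\<open>all_consecutive_commuting\<close>). If both kinds of neighbours occur, the principle above leaves a single
  non-commuting step between two commuting blocks (\<open>two_commuting_blocks\<close>), once a commuting step
  next to two non-commuting ones is excluded (\<open>no_commuting_then_noncommuting\<close>).

  Conversely, the lower bound is general, so for the three families it suffices to bound
  \<open>|S\<^sup>2|\<close> from above.
\<close>

section \<open>Strict order, commutation and unique square roots\<close>

context group
begin

lemma cancel_inv [simp]:
  assumes "a \<in> carrier G" "b \<in> carrier G"
  shows "inv a \<otimes> (a \<otimes> b) = b" and "a \<otimes> (inv a \<otimes> b) = b"
  using assms by (simp_all flip: m_assoc)

definition commute :: "'a \<Rightarrow> 'a \<Rightarrow> bool" (infix "\<bowtie>" 50)
  where "a \<bowtie> b \<longleftrightarrow> a \<otimes> b = b \<otimes> a"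

definition commuting_set :: "'a set \<Rightarrow> bool"
  where "commuting_set T \<longleftrightarrow> (\<forall>a\<in>T. \<forall>b\<in>T. a \<bowtie> b)"

lemma commute_refl [simp]: "a \<bowtie> a"
  by (simp add: commute_def)

lemma commute_sym: "a \<bowtie> b \<longleftrightarrow> b \<bowtie> a"
  by (auto simp: commute_def)

lemma commute_mult:
  assumes "a \<bowtie> b" "a \<bowtie> c" and [simp]: "a \<in> carrier G" "b \<in> carrier G" "c \<in> carrier G"
  shows "a \<bowtie> b \<otimes> c"
proof -
  have "a \<otimes> (b \<otimes> c) = b \<otimes> a \<otimes> c"
    using assms(1) by (simp add: commute_def flip: m_assoc)
  also have "\<dots> = b \<otimes> c \<otimes> a"
    using assms(2) by (simp add: commute_def m_assoc)
  finally show ?thesis by (simp add: commute_def)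
qed

lemma commute_inv:
  assumes "a \<bowtie> b" and [simp]: "a \<in> carrier G" "b \<in> carrier G"
  shows "a \<bowtie> inv b"
proof -
  have "inv b \<otimes> (a \<otimes> b) \<otimes> inv b = inv b \<otimes> (b \<otimes> a) \<otimes> inv b"
    using assms(1) by (simp add: commute_def)
  moreover have "inv b \<otimes> (a \<otimes> b) \<otimes> inv b = inv b \<otimes> a"
    by (simp add: m_assoc)
  moreover have "inv b \<otimes> (b \<otimes> a) \<otimes> inv b = a \<otimes> inv b"
    by (simp flip: m_assoc)
  ultimately show ?thesis by (simp add: commute_def)
qed

lemma commute_left_factor:
  assumes "a \<bowtie> b \<otimes> c" "a \<bowtie> c" and [simp]: "a \<in> carrier G" "b \<in> carrier G" "c \<in> carrier G"
  shows "a \<bowtie> b"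
proof -
  have "a \<bowtie> b \<otimes> c \<otimes> inv c"
    by (rule commute_mult) (use assms in \<open>auto intro: commute_inv\<close>)
  then show ?thesis by (simp add: m_assoc)
qed

lemma commute_right_factor:
  assumes "a \<bowtie> b \<otimes> c" "a \<bowtie> b" and [simp]: "a \<in> carrier G" "b \<in> carrier G" "c \<in> carrier G"
  shows "a \<bowtie> c"
proof -
  have "a \<bowtie> inv b \<otimes> (b \<otimes> c)"
    by (rule commute_mult) (use assms in \<open>auto intro: commute_inv\<close>)
  then show ?thesis by (simp flip: m_assoc)
qed

lemma commuting_set_subset: "commuting_set T \<Longrightarrow> U \<subseteq> T \<Longrightarrow> commuting_set U"
  by (auto simp: commuting_set_def)

text \<open>
  The centralizer of a set is a subgroup, so commuting generators already make the whole
  generated group commutative: the hypothesis on \<open>\<langle>S\<rangle>\<close> is a statement about pairs in \<open>S\<close>.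
\<close>

lemma comm_group_generated_by_commuting_set:
  assumes "S \<subseteq> carrier G" "commuting_set S"
  shows "comm_group (subgroup_generated G S)"
proof -
  have carr: "generate G S \<subseteq> carrier G"
    using assms(1) by (rule generate_incl)
  have centralizes: "a \<bowtie> g" if "g \<in> generate G S" "a \<in> carrier G" "\<forall>s\<in>S. a \<bowtie> s" for a g
    using that(1)
  proof induction
    case one
    then show ?case using that(2) by (simp add: commute_def)
  next
    case (incl h)
    then show ?case using that(3) by blast
  next
    case (inv h)
    then show ?case using that assms(1) by (auto intro: commute_inv)
  next
    case (eng h1 h2)
    then show ?case using carr that(2) by (auto intro: commute_mult)
  qed
  have "s \<bowtie> g" if "s \<in> S" "g \<in> generate G S" for s g
    using that assms by (intro centralizes) (auto simp: commuting_set_def)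
  then have "g \<bowtie> h" if "g \<in> generate G S" "h \<in> generate G S" for g h
    using that carr by (intro centralizes) (auto simp: commute_sym)
  moreover have "S \<inter> carrier G = S" using assms(1) by blast
  ultimately show ?thesis
    by (intro group.group_comm_groupI group_subgroup_generated)
      (auto simp: carrier_subgroup_generated commute_def Int_commute)
qed

end

context ordered_group
begin

definition lt :: "'a \<Rightarrow> 'a \<Rightarrow> bool" (infix "\<^bold><" 50)
  where "a \<^bold>< b \<longleftrightarrow> (a, b) \<in> R - Id"

definition le :: "'a \<Rightarrow> 'a \<Rightarrow> bool" (infix "\<^bold>\<le>" 50)
  where "a \<^bold>\<le> b \<longleftrightarrow> a = b \<or> a \<^bold>< b"

lemma R_facts: "R \<subseteq> carrier G \<times> carrier G" "trans R" "antisym R" "total_on (carrier G) R"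
  using linear_order
  by (auto simp: linear_order_on_def partial_order_on_def preorder_on_def refl_on_def)

lemma lt_carrier: "a \<^bold>< b \<Longrightarrow> a \<in> carrier G \<and> b \<in> carrier G"
  using R_facts(1) by (auto simp: lt_def)

sublocale ord: order "(\<^bold>\<le>)" "(\<^bold><)"
proof
  show "a \<^bold>< b \<longleftrightarrow> a \<^bold>\<le> b \<and> \<not> b \<^bold>\<le> a" for a b
    using R_facts(3) by (auto simp: lt_def le_def dest: antisymD)
  show "a \<^bold>\<le> a" for a
    by (simp add: le_def)
  show "a \<^bold>\<le> c" if "a \<^bold>\<le> b" "b \<^bold>\<le> c" for a b c
    using that R_facts(2) by (auto simp: lt_def le_def dest: transD)
  show "a = b" if "a \<^bold>\<le> b" "b \<^bold>\<le> a" for a b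
    using that R_facts(3) by (auto simp: lt_def le_def dest: antisymD)
qed

lemma trichotomy:
  assumes "a \<in> carrier G" "b \<in> carrier G"
  shows "a \<^bold>< b \<or> a = b \<or> b \<^bold>< a"
  using R_facts(4) assms by (auto simp: lt_def total_on_def)

lemma mult_left_mono:
  assumes "a \<^bold>< b" "x \<in> carrier G"
  shows "x \<otimes> a \<^bold>< x \<otimes> b"
proof -
  have [simp]: "a \<in> carrier G" "b \<in> carrier G"
    using lt_carrier assms(1) by auto
  have "(x \<otimes> a \<otimes> \<one>, x \<otimes> b \<otimes> \<one>) \<in> R"
    using assms by (intro mult_mono) (auto simp: lt_def)
  then show ?thesis using assms by (auto simp: lt_def)
qed

lemma mult_right_mono:
  assumes "a \<^bold>< b" "x \<in> carrier G"
  shows "a \<otimes> x \<^bold>< b \<otimes> x"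
proof -
  have [simp]: "a \<in> carrier G" "b \<in> carrier G"
    using lt_carrier assms(1) by auto
  have "(\<one> \<otimes> a \<otimes> x, \<one> \<otimes> b \<otimes> x) \<in> R"
    using assms by (intro mult_mono) (auto simp: lt_def)
  then show ?thesis using assms by (auto simp: lt_def)
qed

lemma mult_left_mono_le: "a \<^bold>\<le> b \<Longrightarrow> x \<in> carrier G \<Longrightarrow> x \<otimes> a \<^bold>\<le> x \<otimes> b"
  by (auto simp: le_def mult_left_mono)

lemma mult_right_mono_le: "a \<^bold>\<le> b \<Longrightarrow> x \<in> carrier G \<Longrightarrow> a \<otimes> x \<^bold>\<le> b \<otimes> x"
  by (auto simp: le_def mult_right_mono)

lemma mult_strict_mono:
  assumes "a \<^bold>< b" "c \<^bold>< d"
  shows "a \<otimes> c \<^bold>< b \<otimes> d"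
  using mult_right_mono[OF assms(1)] mult_left_mono[OF assms(2)] assms
  by (blast dest: lt_carrier intro: ord.less_trans)

lemma mult_mono_le:
  assumes "a \<^bold>\<le> b" "c \<^bold>\<le> d" "a \<in> carrier G" "d \<in> carrier G"
  shows "a \<otimes> c \<^bold>\<le> b \<otimes> d"
  using mult_left_mono_le[OF assms(2,3)] mult_right_mono_le[OF assms(1,4)] by order

lemma mult_left_mono_iff:
  assumes "a \<in> carrier G" "b \<in> carrier G" "x \<in> carrier G"
  shows "x \<otimes> a \<^bold>< x \<otimes> b \<longleftrightarrow> a \<^bold>< b"
  using assms trichotomy[of a b] mult_left_mono[of a b x] mult_left_mono[of b a x]
  by (metis ord.less_asym ord.less_irrefl)

lemma mult_right_mono_iff:
  assumes "a \<in> carrier G" "b \<in> carrier G" "x \<in> carrier G"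
  shows "a \<otimes> x \<^bold>< b \<otimes> x \<longleftrightarrow> a \<^bold>< b"
  using assms trichotomy[of a b] mult_right_mono[of a b x] mult_right_mono[of b a x]
  by (metis ord.less_asym ord.less_irrefl)

text \<open>A square root is unique, since \<open>a < b\<close> forces \<open>a\<^sup>2 < b\<^sup>2\<close>.\<close>

lemma square_inject:
  assumes "a \<otimes> a = b \<otimes> b" "a \<in> carrier G" "b \<in> carrier G"
  shows "a = b"
  using assms trichotomy[of a b] mult_strict_mono[of a b a b] mult_strict_mono[of b a b a]
  by (metis ord.less_irrefl)

text \<open>Conjugating \<open>a\<close> by \<open>b\<close> gives a square root of \<open>a\<^sup>2\<close>, which can only be \<open>a\<close>.\<close>

lemma commute_square:
  assumes "b \<bowtie> a \<otimes> a" and [simp]: "a \<in> carrier G" "b \<in> carrier G"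
  shows "b \<bowtie> a"
proof -
  have "(inv b \<otimes> a \<otimes> b) \<otimes> (inv b \<otimes> a \<otimes> b) = inv b \<otimes> ((a \<otimes> a) \<otimes> b)"
    by (simp add: m_assoc)
  also have "\<dots> = inv b \<otimes> (b \<otimes> (a \<otimes> a))"
    using assms(1) by (simp only: commute_def)
  also have "\<dots> = a \<otimes> a"
    by simp
  finally have "inv b \<otimes> a \<otimes> b = a"
    by (rule square_inject) simp_all
  then have "b \<otimes> (inv b \<otimes> a \<otimes> b) = b \<otimes> a"
    by simp
  then show ?thesis
    by (simp add: commute_def m_assoc)
qed

text \<open>
  Reversing the order exchanges maxima and minima, and passing to the opposite group exchanges \<open>ab\<close> and
  \<open>ba\<close>. Neither changes \<open>S\<^sup>2\<close>. So the statements about the lower end of \<open>S\<close> follow from those about the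
  upper end, and most arguments that depend on a comparison of \<open>ab\<close> and \<open>ba\<close> need only one outcome.
\<close>

lemma ordered_group_converse: "ordered_group G (R\<inverse>)"
proof (intro ordered_group.intro ordered_group_axioms.intro)
  show "group G" by (rule group_axioms)
  show "linear_order_on (carrier G) (R\<inverse>)"
    using linear_order by simp
  show "(x \<otimes> a \<otimes> y, x \<otimes> b \<otimes> y) \<in> R\<inverse>"
    if "(a, b) \<in> R\<inverse>" "x \<in> carrier G" "y \<in> carrier G" for a b x y
    using that mult_mono by auto
qed

lemma lt_converse: "ordered_group.lt (R\<inverse>) a b \<longleftrightarrow> b \<^bold>< a"
  by (auto simp: ordered_group.lt_def[OF ordered_group_converse] lt_def)

end

definition opposite :: "('a, 'b) monoid_scheme \<Rightarrow> ('a, 'b) monoid_scheme"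
  where "opposite G = G\<lparr>mult := \<lambda>a b. b \<otimes>\<^bsub>G\<^esub> a\<rparr>"

lemma opposite_simps [simp]:
  "carrier (opposite G) = carrier G"
  "one (opposite G) = one G"
  "monoid.mult (opposite G) a b = monoid.mult G b a"
  by (simp_all add: opposite_def)

lemma set_mult_opposite: "S <#>\<^bsub>opposite G\<^esub> S = S <#>\<^bsub>G\<^esub> S"
  by (auto simp: set_mult_def)

context group
begin

lemma group_opposite: "group (opposite G)"
  by (rule groupI) (auto simp: m_assoc intro: r_inv_ex)

lemma inv_opposite: "a \<in> carrier G \<Longrightarrow> inv\<^bsub>opposite G\<^esub> a = inv a"
  by (rule group.inv_equality[OF group_opposite]) auto

lemma commute_opposite: "group.commute (opposite G) a b \<longleftrightarrow> a \<bowtie> b"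
  by (auto simp: group.commute_def[OF group_opposite] commute_def)

lemma commuting_set_opposite: "group.commuting_set (opposite G) T \<longleftrightarrow> commuting_set T"
  by (simp add: group.commuting_set_def[OF group_opposite] commuting_set_def commute_opposite)

end

context ordered_group
begin

lemma ordered_group_opposite: "ordered_group (opposite G) R"
proof (intro ordered_group.intro ordered_group_axioms.intro)
  show "group (opposite G)" by (rule group_opposite)
  show "linear_order_on (carrier (opposite G)) R"
    using linear_order by simp
  show "(x \<otimes>\<^bsub>opposite G\<^esub> a \<otimes>\<^bsub>opposite G\<^esub> y, x \<otimes>\<^bsub>opposite G\<^esub> b \<otimes>\<^bsub>opposite G\<^esub> y) \<in> R"
    if "(a, b) \<in> R" "x \<in> carrier (opposite G)" "y \<in> carrier (opposite G)" for a b x y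
    using that mult_mono[of a b y x] R_facts(1) by (auto simp: m_assoc)
qed

end

section \<open>Growth of the product set\<close>

context group
begin

lemma mem_set_mult: "z \<in> S <#> T \<longleftrightarrow> (\<exists>s\<in>S. \<exists>t\<in>T. z = s \<otimes> t)"
  by (auto simp: set_mult_def)

lemma finite_set_mult: "finite S \<Longrightarrow> finite T \<Longrightarrow> finite (S <#> T)"
  by (simp add: set_mult_def)

lemma set_mult_mono: "S \<subseteq> S' \<Longrightarrow> T \<subseteq> T' \<Longrightarrow> S <#> T \<subseteq> S' <#> T'"
  by (auto simp: set_mult_def)

definition translates :: "'a \<Rightarrow> 'a set \<Rightarrow> 'a set"
  where "translates y T = (\<otimes>) y ` T \<union> (\<lambda>t. t \<otimes> y) ` T"

lemma finite_translates: "finite T \<Longrightarrow> finite (translates y T)"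
  by (simp add: translates_def)

lemma card_left_translate:
  assumes "y \<in> carrier G" "T \<subseteq> carrier G"
  shows "card ((\<otimes>) y ` T) = card T" and "card ((\<lambda>t. t \<otimes> y) ` T) = card T"
  using assms by (auto intro!: card_image inj_onI simp: subset_iff)

end

context ordered_group
begin

text \<open>
  The three pieces are \<open>T\<^sup>2\<close>, \<open>yT \<union> Ty\<close> and \<open>{y\<^sup>2}\<close>. They are disjoint, because an element \<open>t\<^sub>0\<close> of \<open>T\<close> that does not
  commute with \<open>y\<close> commutes with everything in \<open>T\<^sup>2\<close>, but with nothing in the other two, and \<open>y\<^sup>2 \<in> yT \<union> Ty\<close>
  would give \<open>y \<in> T\<close>.
\<close>

lemma card_square_insert:
  assumes T: "T \<subseteq> carrier G" "finite T" "commuting_set T"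
    and y: "y \<in> carrier G" "\<not> commuting_set (insert y T)"
  shows "card (insert y T <#> insert y T) = card (T <#> T) + card (translates y T) + 1"
proof -
  obtain t0 where t0: "t0 \<in> T" "\<not> y \<bowtie> t0"
    using T(3) y(2) by (auto simp: commuting_set_def commute_sym)
  have carr: "t \<in> carrier G" if "t \<in> T" for t
    using that T(1) by blast
  have c: "t0 \<bowtie> t" if "t \<in> T" for t
    using that T(3) t0(1) by (auto simp: commuting_set_def)
  have c2: "t0 \<bowtie> s \<otimes> t" if "s \<in> T" "t \<in> T" for s t
    using that t0(1) c carr by (intro commute_mult) auto
  have ny: "\<not> t0 \<bowtie> y"
    using t0(2) by (simp add: commute_sym)
  have "y \<notin> T"
    using c ny by blast
  have yy: "\<not> t0 \<bowtie> y \<otimes> y"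
    using commute_square[of t0 y] ny t0(1) carr y(1) by blast
  have yt: "\<not> t0 \<bowtie> y \<otimes> t" "\<not> t0 \<bowtie> t \<otimes> y" if "t \<in> T" for t
    using that commute_left_factor[of t0 y t] commute_right_factor[of t0 t y] c ny t0(1) carr y(1)
    by blast+
  have d1: "(T <#> T) \<inter> translates y T = {}"
    using c2 yt unfolding mem_set_mult translates_def disjoint_iff by (metis UnE imageE mem_set_mult)
  have "y \<otimes> y \<notin> translates y T"
    using \<open>y \<notin> T\<close> carr y(1) by (auto simp: translates_def)
  moreover have "y \<otimes> y \<notin> T <#> T"
    using c2 yy by (auto simp: mem_set_mult)
  moreover have "insert y T <#> insert y T = insert (y \<otimes> y) ((T <#> T) \<union> translates y T)"
    by (auto simp: set_mult_def translates_def)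
  ultimately show ?thesis
    using d1 T(2) by (simp add: card_Un_disjoint finite_set_mult finite_translates)
qed

definition greatest_in :: "'a set \<Rightarrow> 'a \<Rightarrow> bool"
  where "greatest_in S m \<longleftrightarrow> m \<in> S \<and> (\<forall>s\<in>S. s \<^bold>\<le> m)"

lemma ex_greatest_in:
  assumes "finite S" "S \<noteq> {}" "S \<subseteq> carrier G"
  shows "\<exists>m. greatest_in S m"
  using assms
proof (induction S rule: finite_ne_induct)
  case (singleton x)
  then show ?case by (auto simp: greatest_in_def)
next
  case (insert x F)
  then obtain m where m: "greatest_in F m" by auto
  then have "m \<in> carrier G" "x \<in> carrier G"
    using insert.prems by (auto simp: greatest_in_def)
  then consider "x \<^bold>< m" | "x = m" | "m \<^bold>< x"
    using trichotomy[of x m] by blast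
  then show ?case
  proof cases
    case 1
    then show ?thesis using m by (intro exI[of _ m]) (auto simp: greatest_in_def)
  next
    case 2
    then show ?thesis using m by (intro exI[of _ m]) (auto simp: greatest_in_def)
  next
    case 3
    then have "s \<^bold>\<le> x" if "s \<in> F" for s
      using m that by (auto simp: greatest_in_def intro: ord.order_trans ord.less_imp_le)
    then show ?thesis by (intro exI[of _ x]) (auto simp: greatest_in_def)
  qed
qed

lemma greatest_in_lt: "greatest_in S m \<Longrightarrow> s \<in> S - {m} \<Longrightarrow> s \<^bold>< m"
  by (auto simp: greatest_in_def le_def)

lemma square_bound:
  assumes "T \<subseteq> carrier G" "greatest_in T b" "z \<in> T <#> T"
  shows "z \<^bold>\<le> b \<otimes> b"
  using assms by (auto simp: mem_set_mult greatest_in_def intro!: mult_mono_le)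

lemma new_products:
  assumes "S \<subseteq> carrier G" "greatest_in S m" "greatest_in (S - {m}) b"
  shows "m \<otimes> m \<notin> (S - {m}) <#> (S - {m})" "m \<otimes> b \<notin> (S - {m}) <#> (S - {m})"
    "b \<otimes> m \<notin> (S - {m}) <#> (S - {m})" "m \<otimes> b \<noteq> m \<otimes> m" "b \<otimes> m \<noteq> m \<otimes> m"
proof -
  have bm: "b \<^bold>< m"
    using assms by (intro greatest_in_lt[of S]) (auto simp: greatest_in_def)
  have "b \<otimes> b \<^bold>< m \<otimes> b" "b \<otimes> b \<^bold>< b \<otimes> m" "m \<otimes> b \<^bold>< m \<otimes> m" "b \<otimes> m \<^bold>< m \<otimes> m"
    using bm lt_carrier[OF bm] by (auto intro: mult_left_mono mult_right_mono)
  moreover have "z \<^bold>\<le> b \<otimes> b" if "z \<in> (S - {m}) <#> (S - {m})" for z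
    using square_bound[OF _ assms(3) that] assms(1) by blast
  ultimately show "m \<otimes> m \<notin> (S - {m}) <#> (S - {m})" "m \<otimes> b \<notin> (S - {m}) <#> (S - {m})"
    "b \<otimes> m \<notin> (S - {m}) <#> (S - {m})" "m \<otimes> b \<noteq> m \<otimes> m" "b \<otimes> m \<noteq> m \<otimes> m"
    by (metis ord.leD ord.less_trans ord.less_irrefl)+
qed

lemma card_square_remove_greatest_general:
  assumes "S \<subseteq> carrier G" "finite S" "greatest_in S m" "S - {m} \<noteq> {}"
  shows "card ((S - {m}) <#> (S - {m})) + 2 \<le> card (S <#> S)"
proof -
  obtain b where b: "greatest_in (S - {m}) b"
    using ex_greatest_in[of "S - {m}"] assms by auto
  let ?T = "S - {m}"
  have "card ((?T <#> ?T) \<union> {m \<otimes> m, m \<otimes> b}) = card (?T <#> ?T) + 2"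
    using new_products[OF assms(1,3) b] assms(2)
    by (subst card_Un_disjoint) (auto simp: finite_set_mult)
  moreover have "(?T <#> ?T) \<union> {m \<otimes> m, m \<otimes> b} \<subseteq> S <#> S"
    using assms(3) b set_mult_mono[of ?T S ?T S] by (auto simp: mem_set_mult greatest_in_def)
  ultimately show ?thesis
    using card_mono[OF finite_set_mult[OF assms(2,2)]] by metis
qed

text \<open>
  With \<open>m\<close> the maximum and \<open>b\<close> the next element, \<open>m\<^sup>2\<close> and \<open>mb\<close> exceed all products of elements below \<open>m\<close>,
  which are at most \<open>b\<^sup>2\<close>.
\<close>

lemma card_square_lower:
  assumes "T \<subseteq> carrier G" "finite T" "T \<noteq> {}"
  shows "2 * card T \<le> card (T <#> T) + 1"
  using assms
proof (induction "card T" arbitrary: T rule: less_induct)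
  case less
  obtain m where m: "greatest_in T m"
    using ex_greatest_in less.prems by blast
  have mT: "m \<in> T" using m by (simp add: greatest_in_def)
  show ?case
  proof (cases "T - {m} = {}")
    case True
    then have T: "T = {m}" using mT by blast
    have "{m} <#> {m} = {m \<otimes> m}"
      by (auto simp: mem_set_mult)
    then show ?thesis unfolding T by simp
  next
    case False
    have c: "card T = Suc (card (T - {m}))"
      using mT less.prems(2) by (rule card.remove[rotated])
    have "2 * card (T - {m}) \<le> card ((T - {m}) <#> (T - {m})) + 1"
      using c less.prems False by (intro less.hyps) auto
    then show ?thesis
      using card_square_remove_greatest_general[OF less.prems(1,2) m False] c by linarith
  qed
qed

text \<open>
  If \<open>yT = Ty\<close>, conjugation by \<open>y\<close> permutes the finite chain \<open>T\<close> monotonically and so fixes each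
  of its elements.
\<close>

lemma card_translates_lower:
  assumes T: "T \<subseteq> carrier G" "finite T" and y: "y \<in> carrier G" "t0 \<in> T" "\<not> y \<bowtie> t0"
  shows "card T + 1 \<le> card (translates y T)"
proof (rule ccontr)
  let ?L = "(\<otimes>) y ` T" and ?R = "(\<lambda>t. t \<otimes> y) ` T"
  assume "\<not> card T + 1 \<le> card (translates y T)"
  then have small: "card (?L \<union> ?R) \<le> card T"
    by (simp add: translates_def)
  have carr: "t \<in> carrier G" if "t \<in> T" for t
    using that T(1) by blast
  have "?L = ?L \<union> ?R" "?R = ?L \<union> ?R"
    using small card_left_translate[OF y(1) T(1)] T(2)
    by (intro card_seteq; simp)+
  then have eq: "?L = ?R" by simp
  define F where "F = {t \<in> T. \<not> y \<bowtie> t}"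
  have "finite F" "F \<noteq> {}" "F \<subseteq> carrier G"
    using T y by (auto simp: F_def)
  then obtain t where t: "greatest_in F t"
    using ex_greatest_in by blast
  then have tT: "t \<in> T" "\<not> y \<bowtie> t"
    by (auto simp: greatest_in_def F_def)
  have fixed: "y \<bowtie> s" if "s \<in> T" "t \<^bold>< s" for s
    using that t by (auto simp: greatest_in_def F_def dest: ord.leD)
  obtain s where s: "s \<in> T" "t \<otimes> y = y \<otimes> s"
    using eq tT(1) by blast
  obtain r where r: "r \<in> T" "y \<otimes> t = r \<otimes> y"
    using eq tT(1) by blast
  have "\<not> t \<^bold>< s"
  proof
    assume "t \<^bold>< s"
    then have "y \<otimes> s = s \<otimes> y"
      using fixed[of s] s(1) by (simp add: commute_def)
    then have "t = s"
      using s carr tT(1) y(1) by simp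
    then show False using \<open>t \<^bold>< s\<close> by simp
  qed
  moreover have "\<not> t \<^bold>< r"
  proof
    assume "t \<^bold>< r"
    then have "y \<otimes> t = y \<otimes> r"
      using fixed[of r] r by (simp add: commute_def)
    then have "t = r"
      using r(1) carr tT(1) y(1) by simp
    then show False using \<open>t \<^bold>< r\<close> by simp
  qed
  moreover have "s \<noteq> t"
    using s(2) tT(2) by (auto simp: commute_def)
  ultimately have "s \<^bold>< t" "r \<^bold>\<le> t"
    using trichotomy[of s t] trichotomy[of r t] carr s(1) r(1) tT(1) by (auto simp: le_def)
  then have "y \<otimes> s \<^bold>< y \<otimes> t" "r \<otimes> y \<^bold>\<le> t \<otimes> y"
    using y(1) by (auto intro: mult_left_mono mult_right_mono_le)
  then show False
    using s(2) r(2) by (metis ord.leD)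
qed

text \<open>
  Let \<open>a\<close> be the largest element of \<open>S\<close> that fails to commute with a larger one, so that the set \<open>U\<close>
  of the elements above \<open>a\<close> is commuting. If \<open>a\<close> is the second largest element \<open>b\<close>, then \<open>m\<^sup>2\<close>,
  \<open>mb\<close> and \<open>bm\<close> are new. Otherwise \<open>m\<^sup>2\<close> and \<open>mb\<close> are new, and so is one of \<open>ma\<close>, \<open>am\<close>: when
  \<open>ab \<le> ba\<close>, every old product with a factor \<open>\<le> a\<close> is at most \<open>ba < ma\<close>, and if \<open>ma\<close> were a product
  of elements of \<open>U\<close>, then \<open>a\<close> would commute with all of \<open>U\<close>.
\<close>

lemma card_square_remove_greatest:
  assumes S: "S \<subseteq> carrier G" "finite S" "\<not> commuting_set S" and m: "greatest_in S m"
  shows "card ((S - {m}) <#> (S - {m})) + 3 \<le> card (S <#> S)"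
proof -
  let ?T = "S - {m}"
  let ?new = "\<lambda>z. z \<in> (S <#> S) - (?T <#> ?T)"
  have carr: "s \<in> carrier G" if "s \<in> S" for s
    using that S(1) by blast
  have mS: "m \<in> S"
    using m by (simp add: greatest_in_def)
  define F where "F = {a \<in> S. \<exists>b\<in>S. a \<^bold>< b \<and> \<not> a \<bowtie> b}"
  obtain p q where "p \<in> S" "q \<in> S" "\<not> p \<bowtie> q"
    using S(3) by (auto simp: commuting_set_def)
  then have "p \<^bold>< q \<or> q \<^bold>< p"
    using trichotomy[of p q] carr by auto
  then have "p \<in> F \<or> q \<in> F"
    using \<open>p \<in> S\<close> \<open>q \<in> S\<close> \<open>\<not> p \<bowtie> q\<close> commute_sym[of p q] by (auto simp: F_def)
  then have "F \<noteq> {}"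
    by blast
  moreover have "finite F" "F \<subseteq> carrier G"
    using S by (auto simp: F_def)
  ultimately obtain a where a: "greatest_in F a"
    using ex_greatest_in by blast
  obtain d where d: "a \<in> S" "d \<in> S" "a \<^bold>< d" "\<not> a \<bowtie> d"
    using a by (auto simp: greatest_in_def F_def)
  have U: "u \<bowtie> v" if "u \<in> S" "v \<in> S" "a \<^bold>< u" "a \<^bold>< v" for u v
  proof -
    have "u \<notin> F" "v \<notin> F"
      using a that by (auto simp: greatest_in_def dest: ord.leD)
    then show ?thesis
      using that trichotomy[of u v] carr commute_sym[of u v] by (auto simp: F_def)
  qed
  have "a \<noteq> m"
    using d m by (auto simp: greatest_in_def dest: ord.leD)
  then have aT: "a \<in> ?T" and am: "a \<^bold>< m"
    using d(1) m by (auto intro: greatest_in_lt)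
  obtain b where b: "greatest_in ?T b"
    using ex_greatest_in[of ?T] S aT by auto
  have bT: "b \<in> ?T" and bm: "b \<^bold>< m" and ab: "a \<^bold>\<le> b"
    using b aT m by (auto simp: greatest_in_def intro: greatest_in_lt)
  note new = new_products[OF S(1) m b]
  have inS: "u \<otimes> v \<in> S <#> S" if "u \<in> S" "v \<in> S" for u v
    using that by (auto simp: mem_set_mult)
  have third: "\<exists>z. ?new z \<and> z \<noteq> m \<otimes> m \<and> z \<noteq> m \<otimes> b"
  proof (cases "b = a")
    case True
    then have "d = m"
      using d b by (auto simp: greatest_in_def dest: ord.leD)
    then show ?thesis
      using new d True inS[of b m] mS bT by (intro exI[of _ "b \<otimes> m"]) (auto simp: commute_def)
  next
    case False
    then have ab: "a \<^bold>< b"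
      using ab by (simp add: le_def)
    \<comment> \<open>Both \<open>ma\<close> and \<open>am\<close> are covered; \<open>d > a\<close> is an element that does not commute with \<open>a\<close>.\<close>
    have no_old: "d \<bowtie> a" if "x = m \<and> x' = a \<or> x = a \<and> x' = m"
      "x \<otimes> x' = s \<otimes> t" "s \<in> S" "t \<in> S" "a \<^bold>< s" "a \<^bold>< t" for x x' s t
    proof -
      have "d \<bowtie> s \<otimes> t"
        using that U d carr by (intro commute_mult) auto
      moreover have "d \<bowtie> m"
        using U[of d m] d am mS by simp
      ultimately show ?thesis
        using that(1,2) commute_left_factor[of d a m] commute_right_factor[of d m a] carr d mS
        by auto
    qed
    have small: "s \<^bold>\<le> a" if "s \<in> S" "\<not> a \<^bold>< s" for s
      using that d(1) carr trichotomy[of s a] by (auto simp: le_def)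
    have sb: "s \<^bold>\<le> b" if "s \<in> ?T" for s
      using that b by (simp add: greatest_in_def)
    consider "a \<otimes> b \<^bold>\<le> b \<otimes> a" | "b \<otimes> a \<^bold>\<le> a \<otimes> b"
      using trichotomy[of "a \<otimes> b" "b \<otimes> a"] carr d bT by (auto simp: le_def)
    then show ?thesis
    proof cases
      case 1
      have lt: "b \<otimes> a \<^bold>< m \<otimes> a" "m \<otimes> a \<^bold>< m \<otimes> b" "m \<otimes> b \<^bold>< m \<otimes> m"
        using bm ab carr d mS by (auto intro: mult_left_mono mult_right_mono)
      have "m \<otimes> a \<notin> ?T <#> ?T"
      proof
        assume "m \<otimes> a \<in> ?T <#> ?T"
        then obtain s t where st: "s \<in> ?T" "t \<in> ?T" "m \<otimes> a = s \<otimes> t"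
          by (auto simp: mem_set_mult)
        have "a \<^bold>< s"
        proof (rule ccontr)
          assume "\<not> a \<^bold>< s"
          then have "s \<otimes> t \<^bold>\<le> a \<otimes> b"
            using small sb st carr bT by (intro mult_mono_le) auto
          then show False using 1 lt(1) st(3) by order
        qed
        moreover have "a \<^bold>< t"
        proof (rule ccontr)
          assume "\<not> a \<^bold>< t"
          then have "s \<otimes> t \<^bold>\<le> b \<otimes> a"
            using small sb st carr d by (intro mult_mono_le) auto
          then show False using lt(1) st(3) by order
        qed
        ultimately show False
          using no_old[of m a s t] st d by (auto simp: commute_sym)
      qed
      moreover have "m \<otimes> a \<noteq> m \<otimes> b" "m \<otimes> a \<noteq> m \<otimes> m"
        using lt by order+
      ultimately show ?thesis
        using inS[of m a] mS d by (intro exI[of _ "m \<otimes> a"]) auto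
    next
      case 2
      have lt: "a \<otimes> b \<^bold>< a \<otimes> m" "a \<otimes> m \<^bold>< b \<otimes> m" "b \<otimes> m \<^bold>< m \<otimes> m"
        using bm ab carr d mS by (auto intro: mult_left_mono mult_right_mono)
      have "a \<otimes> m \<notin> ?T <#> ?T"
      proof
        assume "a \<otimes> m \<in> ?T <#> ?T"
        then obtain s t where st: "s \<in> ?T" "t \<in> ?T" "a \<otimes> m = s \<otimes> t"
          by (auto simp: mem_set_mult)
        have "a \<^bold>< s"
        proof (rule ccontr)
          assume "\<not> a \<^bold>< s"
          then have "s \<otimes> t \<^bold>\<le> a \<otimes> b"
            using small sb st carr bT by (intro mult_mono_le) auto
          then show False using lt(1) st(3) by order
        qed
        moreover have "a \<^bold>< t"
        proof (rule ccontr)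
          assume "\<not> a \<^bold>< t"
          then have "s \<otimes> t \<^bold>\<le> b \<otimes> a"
            using small sb st carr d by (intro mult_mono_le) auto
          then show False using 2 lt(1) st(3) by order
        qed
        ultimately show False
          using no_old[of a m s t] st d by (auto simp: commute_sym)
      qed
      moreover have "a \<otimes> m \<noteq> m \<otimes> b" "a \<otimes> m \<noteq> m \<otimes> m"
      proof -
        have "m \<otimes> b = b \<otimes> m"
          using U[of m b] bT ab am mS by (auto simp: commute_def)
        then show "a \<otimes> m \<noteq> m \<otimes> b" "a \<otimes> m \<noteq> m \<otimes> m"
          using lt by (metis ord.less_trans ord.less_irrefl)+
      qed
      ultimately show ?thesis
        using inS[of a m] mS d by (intro exI[of _ "a \<otimes> m"]) auto
    qed
  qed
  then obtain z where z: "?new z" "z \<noteq> m \<otimes> m" "z \<noteq> m \<otimes> b"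
    by blast
  have "card ((?T <#> ?T) \<union> {m \<otimes> m, m \<otimes> b, z}) = card (?T <#> ?T) + 3"
    using new z S(2) by (subst card_Un_disjoint) (auto simp: finite_set_mult)
  moreover have "(?T <#> ?T) \<union> {m \<otimes> m, m \<otimes> b, z} \<subseteq> S <#> S"
    using z inS mS bT set_mult_mono[of ?T S ?T S] by auto
  ultimately show ?thesis
    using card_mono[OF finite_set_mult[OF S(2,2)]] by metis
qed

text \<open>
  Removing the maximum costs at least three products, until a commuting set \<open>T\<close> with \<open>|T\<^sup>2| \<ge> 2|T| - 1\<close>
  is left; the last step costs at least \<open>|T| + 2\<close> products.
\<close>

theorem card_square_noncommuting:
  assumes "S \<subseteq> carrier G" "finite S" "\<not> commuting_set S"
  shows "3 * card S \<le> card (S <#> S) + 2"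
  using assms
proof (induction "card S" arbitrary: S rule: less_induct)
  case less
  have "S \<noteq> {}"
    using less.prems(3) by (auto simp: commuting_set_def)
  then obtain m where m: "greatest_in S m"
    using ex_greatest_in less.prems by blast
  let ?T = "S - {m}"
  have mS: "m \<in> S" using m by (simp add: greatest_in_def)
  then have ins: "insert m ?T = S" by blast
  have c: "card S = Suc (card ?T)"
    using mS less.prems(2) by (rule card.remove[rotated])
  show ?case
  proof (cases "commuting_set ?T")
    case True
    obtain t0 where t0: "t0 \<in> ?T" "\<not> m \<bowtie> t0"
      using True less.prems(3) unfolding commuting_set_def
      by (metis commute_refl commute_sym Diff_iff insertE empty_iff)
    have "2 * card ?T \<le> card (?T <#> ?T) + 1"
      using t0(1) less.prems by (intro card_square_lower) auto
    moreover have "card ?T + 1 \<le> card (translates m ?T)"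
      using t0 mS less.prems by (intro card_translates_lower[of _ _ t0]) auto
    moreover have "card (S <#> S) = card (?T <#> ?T) + card (translates m ?T) + 1"
      using card_square_insert[of ?T m] ins True less.prems mS by auto
    ultimately show ?thesis using c by linarith
  next
    case False
    then have "3 * card ?T \<le> card (?T <#> ?T) + 2"
      using c less.prems by (intro less.hyps) auto
    then show ?thesis
      using card_square_remove_greatest[OF less.prems m] c by linarith
  qed
qed

definition tight :: "'a set \<Rightarrow> bool"
  where "tight S \<longleftrightarrow> S \<subseteq> carrier G \<and> finite S \<and> \<not> commuting_set S \<and> card (S <#> S) + 2 = 3 * card S"

lemma tightI:
  assumes "S \<subseteq> carrier G" "finite S" "\<not> commuting_set S" "card (S <#> S) + 2 \<le> 3 * card S"
  shows "tight S"
  using assms card_square_noncommuting[of S] by (auto simp: tight_def)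

lemma tight_remove_greatest:
  assumes "tight S" "greatest_in S m" "\<not> commuting_set (S - {m})"
  shows "tight (S - {m})" "card (S <#> S) = card ((S - {m}) <#> (S - {m})) + 3"
proof -
  have S: "S \<subseteq> carrier G" "finite S" "\<not> commuting_set S" "card (S <#> S) + 2 = 3 * card S"
    using assms(1) by (auto simp: tight_def)
  have c: "card S = Suc (card (S - {m}))"
    using assms(2) S(2) by (simp add: card_Suc_Diff1 greatest_in_def del: card_Diff_singleton card_Diff_insert)
  have 1: "card ((S - {m}) <#> (S - {m})) + 3 \<le> card (S <#> S)"
    by (rule card_square_remove_greatest[OF S(1-3) assms(2)])
  have 2: "3 * card (S - {m}) \<le> card ((S - {m}) <#> (S - {m})) + 2"
    using S assms(3) by (intro card_square_noncommuting) auto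
  show "tight (S - {m})"
    using S assms(3) 1 c by (intro tightI) auto
  show "card (S <#> S) = card ((S - {m}) <#> (S - {m})) + 3"
    using 1 2 c S(4) by linarith
qed

text \<open>
  When the two largest elements \<open>a < b\<close> of \<open>S - {m}\<close> commute, every product of elements of \<open>S - {m}\<close>
  except \<open>b\<^sup>2\<close> is at most \<open>ab = ba\<close>. So \<open>ma\<close> and \<open>am\<close>, which are larger, are new unless one of them equals \<open>b\<^sup>2\<close>, and then
  \<open>m\<close>, being a quotient of \<open>b\<^sup>2\<close> and \<open>a\<close>, commutes with \<open>a\<close> and \<open>b\<close>. If \<open>m\<close> does not commute with both, this
  produces four new products where tightness allows three.
\<close>

lemma commute_propagates_up:
  assumes S: "tight S" and m: "greatest_in S m" and T: "\<not> commuting_set (S - {m})"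
    and b: "greatest_in (S - {m}) b" and a: "greatest_in (S - {m} - {b}) a" and ab: "a \<bowtie> b"
  shows "m \<bowtie> a" "m \<bowtie> b"
proof -
  let ?T = "S - {m}"
  have carr: "s \<in> carrier G" if "s \<in> S" for s
    using that S by (auto simp: tight_def)
  have fin: "finite S" and sub: "S \<subseteq> carrier G"
    using S by (auto simp: tight_def)
  have mem: "m \<in> S" "b \<in> ?T" "a \<in> ?T - {b}"
    using m b a by (auto simp: greatest_in_def)
  have lt: "a \<^bold>< b" "b \<^bold>< m"
    using mem m b by (auto intro: greatest_in_lt)
  note new = new_products[OF sub m b]
  have bound: "z \<^bold>\<le> a \<otimes> b \<or> z = b \<otimes> b" if z: "z \<in> ?T <#> ?T" for z
  proof -
    obtain s t where st: "s \<in> ?T" "t \<in> ?T" "z = s \<otimes> t"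
      using z by (auto simp: mem_set_mult)
    have le: "u \<^bold>\<le> b" "u = b \<or> u \<^bold>\<le> a" if "u \<in> ?T" for u
      using that a b by (auto simp: greatest_in_def)
    have "s \<otimes> t \<^bold>\<le> a \<otimes> b" if "s \<noteq> b"
      using that le st mem carr by (intro mult_mono_le) auto
    moreover have "s \<otimes> t \<^bold>\<le> b \<otimes> a" if "t \<noteq> b"
      using that le st mem carr by (intro mult_mono_le) auto
    ultimately show ?thesis
      using st(3) ab by (auto simp: commute_def)
  qed
  have not_bb: "m \<bowtie> a \<and> m \<bowtie> b" if "m \<otimes> a = b \<otimes> b \<or> a \<otimes> m = b \<otimes> b"
  proof -
    have "a \<bowtie> b \<otimes> b" "b \<bowtie> b \<otimes> b" "b \<bowtie> a"
      using ab mem carr by (auto intro!: commute_mult simp: commute_sym)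
    then show ?thesis
      using that commute_left_factor[of a m a] commute_right_factor[of a a m]
        commute_left_factor[of b m a] commute_right_factor[of b a m] mem carr
      by (auto simp: commute_sym)
  qed
  have "m \<bowtie> a \<and> m \<bowtie> b"
  proof (rule ccontr)
    assume nc: "\<not> (m \<bowtie> a \<and> m \<bowtie> b)"
    have lts: "b \<otimes> a \<^bold>< m \<otimes> a" "a \<otimes> b \<^bold>< a \<otimes> m" "m \<otimes> a \<^bold>< m \<otimes> b" "a \<otimes> m \<^bold>< b \<otimes> m"
      "m \<otimes> b \<^bold>< m \<otimes> m" "b \<otimes> m \<^bold>< m \<otimes> m"
      using lt mem carr by (auto intro: mult_left_mono mult_right_mono)
    have "b \<otimes> a = a \<otimes> b"
      using ab by (simp add: commute_def)
    then have ma: "m \<otimes> a \<notin> ?T <#> ?T" "a \<otimes> m \<notin> ?T <#> ?T"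
      using bound[of "m \<otimes> a"] bound[of "a \<otimes> m"] lts(1,2) not_bb nc
      by (auto dest: ord.leD)
    \<comment> \<open>If \<open>mb \<noteq> bm\<close>, the fourth new product is \<open>ma\<close>, or \<open>am\<close> when \<open>ma\<close> coincides with \<open>bm\<close>.\<close>
    define D where "D = (if m \<bowtie> b then {m \<otimes> m, m \<otimes> b, m \<otimes> a, a \<otimes> m}
        else {m \<otimes> m, m \<otimes> b, b \<otimes> m, if m \<otimes> a = b \<otimes> m then a \<otimes> m else m \<otimes> a})"
    have "m \<otimes> b \<noteq> m \<otimes> m" "b \<otimes> m \<noteq> m \<otimes> m" "m \<otimes> a \<noteq> m \<otimes> m" "a \<otimes> m \<noteq> m \<otimes> m"
      "m \<otimes> a \<noteq> m \<otimes> b" "a \<otimes> m \<noteq> b \<otimes> m"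
      using lts by order+
    moreover have "a \<otimes> m \<noteq> m \<otimes> b" if "m \<otimes> a = b \<otimes> m"
      using lts that by order
    ultimately have "card D = 4"
      using nc by (auto simp: D_def commute_def)
    moreover have "D \<inter> (?T <#> ?T) = {}"
      using new ma by (auto simp: D_def)
    ultimately have "card ((?T <#> ?T) \<union> D) = card (?T <#> ?T) + 4"
      using fin by (subst card_Un_disjoint) (auto simp: finite_set_mult D_def)
    moreover have "D \<subseteq> S <#> S"
      using mem by (auto simp: D_def mem_set_mult)
    then have "(?T <#> ?T) \<union> D \<subseteq> S <#> S"
      using set_mult_mono[of ?T S ?T S] by auto
    ultimately have "card (?T <#> ?T) + 4 \<le> card (S <#> S)"
      using card_mono[OF finite_set_mult[OF fin fin]] by metis
    then show False
      using tight_remove_greatest(2)[OF S m T] by linarith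
  qed
  then show "m \<bowtie> a" "m \<bowtie> b"
    by simp_all
qed

definition least_in :: "'a set \<Rightarrow> 'a \<Rightarrow> bool"
  where "least_in S m \<longleftrightarrow> m \<in> S \<and> (\<forall>s\<in>S. m \<^bold>\<le> s)"

lemma greatest_in_converse: "ordered_group.greatest_in (R\<inverse>) S m \<longleftrightarrow> least_in S m"
  by (auto simp: ordered_group.greatest_in_def[OF ordered_group_converse] least_in_def
      ordered_group.le_def[OF ordered_group_converse] lt_converse le_def)

lemmas tight_remove_least =
  ordered_group.tight_remove_greatest[OF ordered_group_converse, unfolded greatest_in_converse]

lemmas commute_propagates_down =
  ordered_group.commute_propagates_up[OF ordered_group_converse, unfolded greatest_in_converse]

lemmas card_square_remove_least_general =
  ordered_group.card_square_remove_greatest_general[OF ordered_group_converse,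
    unfolded greatest_in_converse]

text \<open>The larger one of \<open>ym\<close> and \<open>my\<close> is lost.\<close>

lemma card_translates_remove_greatest:
  assumes T: "T \<subseteq> carrier G" "finite T" and y: "y \<in> carrier G" and m: "greatest_in T m"
  shows "card (translates y (T - {m})) + 1 \<le> card (translates y T)"
proof -
  have carr: "t \<in> carrier G" if "t \<in> T" for t
    using that T(1) by blast
  have mT: "m \<in> T"
    using m by (simp add: greatest_in_def)
  have lt: "y \<otimes> t \<^bold>< y \<otimes> m" "t \<otimes> y \<^bold>< m \<otimes> y" if "t \<in> T - {m}" for t
    using greatest_in_lt[OF m that] y by (auto intro: mult_left_mono mult_right_mono)
  obtain z where z: "z = y \<otimes> m \<or> z = m \<otimes> y" "y \<otimes> m \<^bold>\<le> z" "m \<otimes> y \<^bold>\<le> z"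
    using trichotomy[of "y \<otimes> m" "m \<otimes> y"] y mT carr by (auto simp: le_def)
  have "w \<^bold>< z" if w: "w \<in> translates y (T - {m})" for w
  proof -
    obtain t where t: "t \<in> T - {m}" "w = y \<otimes> t \<or> w = t \<otimes> y"
      using w by (auto simp: translates_def)
    then show ?thesis using lt[OF t(1)] z by (metis ord.less_le_trans)
  qed
  then have "z \<notin> translates y (T - {m})"
    by blast
  then have "card (insert z (translates y (T - {m}))) = card (translates y (T - {m})) + 1"
    using T(2) by (simp add: finite_translates)
  moreover have "insert z (translates y (T - {m})) \<subseteq> translates y T"
    using z(1) mT by (auto simp: translates_def)
  ultimately show ?thesis
    using card_mono[OF finite_translates[OF T(2), of y]] by metis
qed

lemmas card_translates_remove_least =
  ordered_group.card_translates_remove_greatest[OF ordered_group_converse,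
    unfolded greatest_in_converse]

definition chain :: "(nat \<Rightarrow> 'a) \<Rightarrow> nat \<Rightarrow> bool"
  where "chain x n \<longleftrightarrow> (\<forall>i<n. x i \<in> carrier G) \<and> (\<forall>i j. i < j \<longrightarrow> j < n \<longrightarrow> x i \<^bold>< x j)"

abbreviation seg :: "(nat \<Rightarrow> 'a) \<Rightarrow> nat \<Rightarrow> nat \<Rightarrow> 'a set"
  where "seg x i j \<equiv> x ` {i..<j}"

lemma chain_lt: "chain x n \<Longrightarrow> i < j \<Longrightarrow> j < n \<Longrightarrow> x i \<^bold>< x j"
  by (simp add: chain_def)

lemma chain_neq: "chain x n \<Longrightarrow> i < j \<Longrightarrow> j < n \<Longrightarrow> x i \<noteq> x j"
  using chain_lt[of x n i j] by auto

lemma chain_carrier: "chain x n \<Longrightarrow> i < n \<Longrightarrow> x i \<in> carrier G"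
  by (simp add: chain_def)

lemma chain_mono: "chain x n \<Longrightarrow> m \<le> n \<Longrightarrow> chain x m"
  by (simp add: chain_def)

lemma chain_inj: "chain x n \<Longrightarrow> inj_on x {..<n}"
  by (metis chain_lt inj_onI lessThan_iff linorder_neqE_nat ord.less_irrefl)

lemma seg_carrier: "chain x n \<Longrightarrow> j \<le> n \<Longrightarrow> seg x i j \<subseteq> carrier G"
  by (auto simp: chain_def)

lemma card_seg:
  assumes "chain x n" "j \<le> n"
  shows "card (seg x i j) = j - i"
proof -
  have "inj_on x {i..<j}"
    using chain_inj[OF assms(1)] by (rule inj_on_subset) (use assms(2) in auto)
  then show ?thesis by (simp add: card_image)
qed

lemma greatest_in_seg:
  assumes "chain x n" "i \<le> j" "j < n"
  shows "greatest_in (seg x i (Suc j)) (x j)"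
  using assms by (auto simp: greatest_in_def chain_def le_def less_Suc_eq)

lemma least_in_seg:
  assumes "chain x n" "i < j" "j \<le> n"
  shows "least_in (seg x i j) (x i)"
proof -
  have "x i \<^bold>\<le> x k" if "i \<le> k" "k < j" for k
    using that assms chain_lt[OF assms(1), of i k] by (cases "i = k") (auto simp: le_def)
  then show ?thesis using assms(2) by (auto simp: least_in_def)
qed

lemma seg_remove_last:
  assumes "chain x n" "i \<le> j" "j < n"
  shows "seg x i (Suc j) - {x j} = seg x i j"
  using assms chain_neq[of x n _ j] by (auto simp: less_Suc_eq)

lemma seg_remove_first:
  assumes "chain x n" "i < j" "j \<le> n"
  shows "seg x i j - {x i} = seg x (Suc i) j"
proof -
  have "x k \<noteq> x i" if "Suc i \<le> k" "k < j" for k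
    using that assms chain_neq[of x n i k] by auto
  moreover have "{i..<j} = insert i {Suc i..<j}"
    using assms(2) by auto
  ultimately show ?thesis by auto
qed

lemma seg_remove_last_general:
  assumes "chain x n" "i < j" "j \<le> n"
  shows "greatest_in (seg x i j) (x (j - 1))" "seg x i j - {x (j - 1)} = seg x i (j - 1)"
  using assms greatest_in_seg[of x n i "j - 1"] seg_remove_last[of x n i "j - 1"] by auto

text \<open>
  Any segment arises by removing maxima and then minima. The side condition \<open>Q\<close>, which passes to larger segments, is needed
  because tightness survives only while the set does not commute.
\<close>

lemma seg_induct:
  assumes x: "chain x n" and top: "P (seg x 0 n)"
    and last: "\<And>i j. i < j \<Longrightarrow> Suc j \<le> n \<Longrightarrow> P (seg x i (Suc j)) \<Longrightarrow> Q i j \<Longrightarrow> P (seg x i j)"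
    and first: "\<And>i j. Suc i < j \<Longrightarrow> j \<le> n \<Longrightarrow> P (seg x i j) \<Longrightarrow> Q (Suc i) j \<Longrightarrow> P (seg x (Suc i) j)"
    and Q: "\<And>i j i' j'. Q i j \<Longrightarrow> i' \<le> i \<Longrightarrow> j \<le> j' \<Longrightarrow> Q i' j'"
    and ij: "i < j" "j \<le> n" "Q i j"
  shows "P (seg x i j)"
proof -
  have 1: "P (seg x 0 j)" if "j \<le> n" "0 < j" "Q 0 j" for j
    using that
  proof (induction rule: inc_induct)
    case base
    then show ?case using top by simp
  next
    case (step k)
    then have "Q 0 (Suc k)" using Q by (meson le_SucI order_refl)
    then show ?case using step last[of 0 k] by simp
  qed
  have "P (seg x i j)" if "i < j" "Q i j" for i
    using that
  proof (induction i)
    case 0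
    then show ?case using 1 ij by simp
  next
    case (Suc k)
    then have "Q k j" using Q by (meson le_SucI order_refl)
    then show ?case using Suc first[of k j] ij by simp
  qed
  then show ?thesis using ij by simp
qed

lemma tight_seg:
  assumes x: "chain x n" and "tight (seg x 0 n)"
    and ij: "i < j" "j \<le> n" "\<not> commuting_set (seg x i j)"
  shows "tight (seg x i j)"
proof (rule seg_induct[where P = tight and Q = "\<lambda>i j. \<not> commuting_set (seg x i j)", OF x assms(2)])
  show "tight (seg x i j)"
    if "i < j" "Suc j \<le> n" "tight (seg x i (Suc j))" "\<not> commuting_set (seg x i j)" for i j
    using tight_remove_greatest(1)[OF that(3) greatest_in_seg[OF x]] seg_remove_last[OF x, of i j] that
    by simp
  show "tight (seg x (Suc i) j)"
    if "Suc i < j" "j \<le> n" "tight (seg x i j)" "\<not> commuting_set (seg x (Suc i) j)" for i j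
    using tight_remove_least(1)[OF that(3) least_in_seg[OF x]] seg_remove_first[OF x, of i j] that
    by simp
  show "\<not> commuting_set (seg x i' j')"
    if "\<not> commuting_set (seg x i j)" "i' \<le> i" "j \<le> j'" for i j i' j'
  proof -
    have "seg x i j \<subseteq> seg x i' j'"
      using that by (intro image_mono) auto
    then show ?thesis
      using that(1) commuting_set_subset by blast
  qed
qed (use ij in auto)

lemma commute_propagates_up_chain:
  assumes x: "chain x n" and tight: "tight (seg x 0 n)" and i: "i + 2 < n" "x i \<bowtie> x (i + 1)"
    and nc: "\<not> commuting_set (seg x 0 (i + 2))"
  shows "x (i + 2) \<bowtie> x i" "x (i + 2) \<bowtie> x (i + 1)"
proof -
  let ?S = "seg x 0 (i + 3)"
  have "\<not> commuting_set ?S"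
    using nc by (rule contrapos_nn) (auto elim!: commuting_set_subset)
  then have "tight ?S"
    using i by (intro tight_seg[OF x tight]) auto
  moreover have "greatest_in ?S (x (i + 2))" "?S - {x (i + 2)} = seg x 0 (i + 2)"
    using seg_remove_last_general[OF x, of 0 "i + 3"] i by auto
  moreover have "greatest_in (seg x 0 (i + 2)) (x (i + 1))" "seg x 0 (i + 2) - {x (i + 1)} = seg x 0 (i + 1)"
    using seg_remove_last_general[OF x, of 0 "i + 2"] i by auto
  moreover have "greatest_in (seg x 0 (i + 1)) (x i)"
    using seg_remove_last_general[OF x, of 0 "i + 1"] i by auto
  ultimately show "x (i + 2) \<bowtie> x i" "x (i + 2) \<bowtie> x (i + 1)"
    using commute_propagates_up[of ?S "x (i + 2)" "x (i + 1)" "x i"] nc i(2) by simp_all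
qed

lemma commute_propagates_down_chain:
  assumes x: "chain x n" and tight: "tight (seg x 0 n)" and i: "i + 2 < n" "x (i + 1) \<bowtie> x (i + 2)"
    and nc: "\<not> commuting_set (seg x (i + 1) n)"
  shows "x i \<bowtie> x (i + 2)" "x i \<bowtie> x (i + 1)"
proof -
  let ?S = "seg x i n"
  have "\<not> commuting_set ?S"
    using nc by (rule contrapos_nn) (auto elim!: commuting_set_subset)
  then have "tight ?S"
    using i by (intro tight_seg[OF x tight]) auto
  moreover have "least_in ?S (x i)" "?S - {x i} = seg x (i + 1) n"
    using least_in_seg[OF x, of i n] seg_remove_first[OF x, of i n] i by auto
  moreover have "least_in (seg x (i + 1) n) (x (i + 1))" "seg x (i + 1) n - {x (i + 1)} = seg x (i + 2) n"
    using least_in_seg[OF x, of "i + 1" n] seg_remove_first[OF x, of "i + 1" n] i by auto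
  moreover have "least_in (seg x (i + 2) n) (x (i + 2))"
    using least_in_seg[OF x, of "i + 2" n] i by auto
  ultimately show "x i \<bowtie> x (i + 2)" "x i \<bowtie> x (i + 1)"
    using commute_propagates_down[of ?S "x i" "x (i + 1)" "x (i + 2)"] nc i(2)
    by (simp_all add: commute_sym)
qed

section \<open>A commuting set and one more element\<close>

text \<open>If \<open>ac \<noteq> b\<^sup>2\<close>, there is a sixth product next to \<open>a\<^sup>2 < ab < b\<^sup>2 < bc < c\<^sup>2\<close>.\<close>

lemma three_term_progression:
  assumes lt: "a \<^bold>< b" "b \<^bold>< c" and comm: "commuting_set {a, b, c}"
    and card: "card ({a, b, c} <#> {a, b, c}) \<le> 5"
  shows "a \<otimes> c = b \<otimes> b"
proof (rule ccontr)
  assume ne: "a \<otimes> c \<noteq> b \<otimes> b"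
  have carr: "a \<in> carrier G" "b \<in> carrier G" "c \<in> carrier G"
    using lt lt_carrier by auto
  have lts: "a \<otimes> a \<^bold>< a \<otimes> b" "a \<otimes> b \<^bold>< b \<otimes> b" "b \<otimes> b \<^bold>< b \<otimes> c" "b \<otimes> c \<^bold>< c \<otimes> c"
     "a \<otimes> b \<^bold>< a \<otimes> c" "a \<otimes> c \<^bold>< b \<otimes> c"
    using lt carr by (auto intro: mult_left_mono mult_right_mono)
  have "a \<otimes> a \<noteq> a \<otimes> b" "a \<otimes> a \<noteq> b \<otimes> b" "a \<otimes> a \<noteq> b \<otimes> c" "a \<otimes> a \<noteq> c \<otimes> c" "a \<otimes> a \<noteq> a \<otimes> c"
     "a \<otimes> b \<noteq> b \<otimes> b" "a \<otimes> b \<noteq> b \<otimes> c" "a \<otimes> b \<noteq> c \<otimes> c" "a \<otimes> b \<noteq> a \<otimes> c"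
     "b \<otimes> b \<noteq> b \<otimes> c" "b \<otimes> b \<noteq> c \<otimes> c" "b \<otimes> c \<noteq> c \<otimes> c" "b \<otimes> c \<noteq> a \<otimes> c" "c \<otimes> c \<noteq> a \<otimes> c"
    using lts by order+
  then have "card {a \<otimes> a, a \<otimes> b, b \<otimes> b, b \<otimes> c, c \<otimes> c, a \<otimes> c} = 6"
    using ne by auto
  moreover have "{a \<otimes> a, a \<otimes> b, b \<otimes> b, b \<otimes> c, c \<otimes> c, a \<otimes> c} \<subseteq> {a, b, c} <#> {a, b, c}"
    by (auto simp: mem_set_mult)
  moreover have "finite ({a, b, c} <#> {a, b, c})"
    by (intro finite_set_mult) auto
  ultimately have "6 \<le> card ({a, b, c} <#> {a, b, c})"
    using card_mono by metis
  then show False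
    using card by linarith
qed

lemma minimal_square_progression:
  assumes x: "chain x n" and comm: "commuting_set (seg x 0 n)"
    and card: "card (seg x 0 n <#> seg x 0 n) + 1 \<le> 2 * n" and i: "i + 2 < n"
  shows "x i \<otimes> x (i + 2) = x (i + 1) \<otimes> x (i + 1)"
proof -
  have "card (seg x i (i + 3) <#> seg x i (i + 3)) + 1 \<le> 2 * card (seg x i (i + 3))"
  proof (rule seg_induct[OF x, where P = "\<lambda>T. card (T <#> T) + 1 \<le> 2 * card T" and Q = "\<lambda>_ _. True"])
    show "card (seg x 0 n <#> seg x 0 n) + 1 \<le> 2 * card (seg x 0 n)"
      using card card_seg[OF x, of n 0] by simp
    show "card (seg x i j <#> seg x i j) + 1 \<le> 2 * card (seg x i j)"
      if "i < j" "Suc j \<le> n"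
        "card (seg x i (Suc j) <#> seg x i (Suc j)) + 1 \<le> 2 * card (seg x i (Suc j))" for i j
      using card_square_remove_greatest_general[OF seg_carrier[OF x] _ greatest_in_seg[OF x], of j i]
        that seg_remove_last[OF x, of i j] card_seg[OF x, of j i] card_seg[OF x, of "Suc j" i]
      by (auto simp: Suc_diff_le)
    show "card (seg x (Suc i) j <#> seg x (Suc i) j) + 1 \<le> 2 * card (seg x (Suc i) j)"
      if "Suc i < j" "j \<le> n" "card (seg x i j <#> seg x i j) + 1 \<le> 2 * card (seg x i j)" for i j
      using card_square_remove_least_general[OF seg_carrier[OF x] _ least_in_seg[OF x], of j i]
        that seg_remove_first[OF x, of i j] card_seg[OF x, of j i] card_seg[OF x, of j "Suc i"]
      by (auto simp: Suc_diff_le)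
  qed (use i in auto)
  moreover have "seg x i (i + 3) = {x i, x (i + 1), x (i + 2)}"
  proof -
    have "{i..<i + 3} = {i, i + 1, i + 2}" by auto
    then show ?thesis by simp
  qed
  moreover have "card (seg x i (i + 3)) = 3"
    using card_seg[OF x, of "i + 3" i] i by simp
  moreover have "commuting_set {x i, x (i + 1), x (i + 2)}"
    using i by (intro commuting_set_subset[OF comm]) auto
  ultimately show ?thesis
    using i by (intro three_term_progression) (auto intro!: chain_lt[OF x])
qed

text \<open>
  Tightness forces both variable summands in \<open>card_square_insert\<close> to their minimum. The consequences
  are that \<open>T\<close> is a progression (\<open>progression_from_square\<close>) and that conjugation by \<open>y\<close> moves at most
  one element of \<open>T\<close> out of \<open>T\<close> (\<open>all_but_one_conjugate_in\<close>).
\<close>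

lemma tight_insert:
  assumes "tight (insert y T)" "commuting_set T" "T \<noteq> {}" "y \<notin> T"
  shows "card (T <#> T) + 1 = 2 * card T" "card (translates y T) = card T + 1"
proof -
  have S: "T \<subseteq> carrier G" "finite T" "y \<in> carrier G" "\<not> commuting_set (insert y T)"
    "card (insert y T <#> insert y T) + 2 = 3 * card (insert y T)"
    using assms(1) by (auto simp: tight_def)
  obtain t0 where t0: "t0 \<in> T" "\<not> y \<bowtie> t0"
    using S(4) assms(2) by (auto simp: commuting_set_def commute_sym)
  show "card (T <#> T) + 1 = 2 * card T" "card (translates y T) = card T + 1"
    using card_square_insert[OF S(1,2) assms(2) S(3,4)] card_square_lower[OF S(1,2) assms(3)]
      card_translates_lower[OF S(1-3) t0] S(2,5) assms(4) by auto
qed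

lemma all_but_one_conjugate_in:
  assumes "T \<subseteq> carrier G" "finite T" "T \<noteq> {}" "y \<in> carrier G" "card (translates y T) \<le> card T + 1"
  shows "\<exists>p\<in>T. \<forall>t\<in>T - {p}. \<exists>s\<in>T. t \<otimes> y = y \<otimes> s"
proof -
  let ?L = "(\<otimes>) y ` T" and ?R = "(\<lambda>t. t \<otimes> y) ` T"
  have "card (?L \<union> (?R - ?L)) = card ?L + card (?R - ?L)"
    using assms(2) by (intro card_Un_disjoint) auto
  moreover have "?L \<union> (?R - ?L) = translates y T"
    by (auto simp: translates_def)
  ultimately have "card (?R - ?L) \<le> 1"
    using assms(5) card_left_translate(1)[OF assms(4,1)] by simp
  moreover have "finite (?R - ?L)"
    using assms(2) by simp
  ultimately have one: "\<forall>u\<in>?R - ?L. \<forall>v\<in>?R - ?L. u = v"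
    using card_le_Suc0_iff_eq[of "?R - ?L"] unfolding One_nat_def by blast
  obtain p where p: "p \<in> T" "p \<otimes> y \<in> ?R - ?L \<or> ?R - ?L = {}"
    using assms(3) by blast
  have "t \<otimes> y \<in> ?L" if "t \<in> T - {p}" for t
  proof (rule ccontr)
    assume "t \<otimes> y \<notin> ?L"
    then have "t \<otimes> y \<in> ?R - ?L" using that by blast
    then have "t \<otimes> y = p \<otimes> y" using one p(2) by blast
    then have "t = p" using that p(1) assms(1,4) by (auto simp: subset_iff)
    then show False using that by blast
  qed
  then show ?thesis using p(1) by blast
qed

lemma increasing_pair_in_triple:
  assumes "p \<^bold>< q" "q \<^bold>< r" "s \<^bold>< t" "s \<in> {p, q, r}" "t \<in> {p, q, r}"
  shows "s = p \<and> t = q \<or> s = p \<and> t = r \<or> s = q \<and> t = r"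
proof -
  have "p \<^bold>< r" using assms(1,2) by order
  then show ?thesis
    using assms ord.less_asym by blast
qed

text \<open>
  With \<open>b = a\<^sup>y\<close> and \<open>u = d\<^sup>y\<close>, two of the three terms \<open>b < bu < bu\<^sup>2\<close> lie in \<open>{a, ad, ad\<^sup>2}\<close>; the
  alternatives record which two, and where.
\<close>

lemma conjugate_three_progression:
  assumes carr: "a \<in> carrier G" "d \<in> carrier G" "y \<in> carrier G"
    and d: "\<one> \<^bold>< d"
    and b: "b \<in> carrier G" "a \<otimes> y = y \<otimes> b" and u: "u \<in> carrier G" "d \<otimes> y = y \<otimes> u"
    and card: "card (translates y {a, a \<otimes> d, a \<otimes> (d \<otimes> d)}) \<le> 4"
    and moved: "\<not> (b = a \<and> u = d)"
  shows "u = d \<and> (b = a \<otimes> d \<or> b \<otimes> d = a) \<or>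
    u = d \<otimes> d \<and> (b = a \<or> b \<otimes> (d \<otimes> d) = a) \<or>
    u \<otimes> u = d \<and> (b = a \<or> b = a \<otimes> d)"
proof -
  let ?T = "{a, a \<otimes> d, a \<otimes> (d \<otimes> d)}"
  note [simp] = carr b(1) u(1)
  have inc: "v \<^bold>< v \<otimes> w" if "\<one> \<^bold>< w" "v \<in> carrier G" for v w
    using mult_left_mono[OF that] that by simp
  have u1: "\<one> \<^bold>< u"
  proof -
    have "y \<^bold>< y \<otimes> u"
      using mult_right_mono[OF d, of y] u by simp
    then show ?thesis
      using mult_left_mono_iff[of \<one> u y] by simp
  qed
  have ltT: "a \<^bold>< a \<otimes> d" "a \<otimes> d \<^bold>< a \<otimes> (d \<otimes> d)"
    using inc[OF d, of a] inc[OF d, of "a \<otimes> d"] by (simp_all add: m_assoc)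
  have ltu: "b \<^bold>< b \<otimes> u" "b \<otimes> u \<^bold>< b \<otimes> (u \<otimes> u)"
    using inc[OF u1, of b] inc[OF u1, of "b \<otimes> u"] by (simp_all add: m_assoc)
  have conj: "a \<otimes> d \<otimes> y = y \<otimes> (b \<otimes> u)" "a \<otimes> (d \<otimes> d) \<otimes> y = y \<otimes> (b \<otimes> (u \<otimes> u))"
  proof -
    have "a \<otimes> d \<otimes> y = a \<otimes> y \<otimes> u"
      using u(2) by (simp add: m_assoc)
    then show 1: "a \<otimes> d \<otimes> y = y \<otimes> (b \<otimes> u)"
      using b(2) by (simp add: m_assoc)
    have "a \<otimes> (d \<otimes> d) \<otimes> y = a \<otimes> d \<otimes> (d \<otimes> y)"
      by (simp add: m_assoc)
    also have "\<dots> = a \<otimes> d \<otimes> y \<otimes> u"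
      unfolding u(2) by (simp add: m_assoc)
    also have "\<dots> = y \<otimes> (b \<otimes> (u \<otimes> u))"
      unfolding 1 by (simp add: m_assoc)
    finally show "a \<otimes> (d \<otimes> d) \<otimes> y = y \<otimes> (b \<otimes> (u \<otimes> u))" .
  qed
  have dist: "a \<noteq> a \<otimes> d" "a \<noteq> a \<otimes> (d \<otimes> d)" "a \<otimes> d \<noteq> a \<otimes> (d \<otimes> d)"
    using ltT by order+
  then have "card ?T = 3"
    by auto
  then obtain p where p: "p \<in> ?T" "\<forall>t\<in>?T - {p}. \<exists>s\<in>?T. t \<otimes> y = y \<otimes> s"
    using all_but_one_conjugate_in[of ?T y] card by auto
  have other: "w \<in> ?T" if t: "t \<in> ?T" "t \<noteq> p" "t \<otimes> y = y \<otimes> w" "w \<in> carrier G" for t w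
  proof -
    obtain s where "s \<in> ?T" "t \<otimes> y = y \<otimes> s"
      using p(2) t by blast
    moreover have "s \<in> carrier G"
      using \<open>s \<in> ?T\<close> by auto
    ultimately show ?thesis
      using t by simp
  qed
  have in_T: "a \<noteq> p \<Longrightarrow> b \<in> ?T" "a \<otimes> d \<noteq> p \<Longrightarrow> b \<otimes> u \<in> ?T"
    "a \<otimes> (d \<otimes> d) \<noteq> p \<Longrightarrow> b \<otimes> (u \<otimes> u) \<in> ?T"
    using other[of a b] other[of "a \<otimes> d" "b \<otimes> u"] other[of "a \<otimes> (d \<otimes> d)" "b \<otimes> (u \<otimes> u)"] b conj
    by simp_all
  have "a \<noteq> p \<and> a \<otimes> d \<noteq> p \<or> a \<noteq> p \<and> a \<otimes> (d \<otimes> d) \<noteq> p \<or> a \<otimes> d \<noteq> p \<and> a \<otimes> (d \<otimes> d) \<noteq> p"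
    using dist by metis
  then consider "b \<in> ?T" "b \<otimes> u \<in> ?T" | "b \<in> ?T" "b \<otimes> (u \<otimes> u) \<in> ?T" | "b \<otimes> u \<in> ?T" "b \<otimes> (u \<otimes> u) \<in> ?T"
    using in_T by meson
  then show ?thesis
  proof cases
    case 1
    then consider "b = a" "b \<otimes> u = a \<otimes> d" | "b = a" "b \<otimes> u = a \<otimes> (d \<otimes> d)"
      | "b = a \<otimes> d" "b \<otimes> u = a \<otimes> (d \<otimes> d)"
      using increasing_pair_in_triple[OF ltT ltu(1)] by metis
    then show ?thesis
      using moved by cases (auto simp: m_assoc)
  next
    case 2
    have lt: "b \<^bold>< b \<otimes> (u \<otimes> u)"
      using ltu by order
    from 2 consider "b = a" "b \<otimes> (u \<otimes> u) = a \<otimes> d" | "b = a" "b \<otimes> (u \<otimes> u) = a \<otimes> (d \<otimes> d)"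
      | "b = a \<otimes> d" "b \<otimes> (u \<otimes> u) = a \<otimes> (d \<otimes> d)"
      using increasing_pair_in_triple[OF ltT lt] by metis
    then show ?thesis
    proof cases
      case 2
      then have "u \<otimes> u = d \<otimes> d"
        by simp
      then have "u = d"
        by (rule square_inject) simp_all
      then show ?thesis using moved 2 by simp
    qed (auto simp: m_assoc)
  next
    case 3
    then consider "b \<otimes> u = a" "b \<otimes> (u \<otimes> u) = a \<otimes> d" | "b \<otimes> u = a" "b \<otimes> (u \<otimes> u) = a \<otimes> (d \<otimes> d)"
      | "b \<otimes> u = a \<otimes> d" "b \<otimes> (u \<otimes> u) = a \<otimes> (d \<otimes> d)"
      using increasing_pair_in_triple[OF ltT ltu(2)] by metis
    then show ?thesis
    proof cases
      case 1
      then have "a \<otimes> u = a \<otimes> d"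
        by (simp flip: m_assoc)
      then show ?thesis using 1 by simp
    next
      case 2
      then have "a \<otimes> u = a \<otimes> (d \<otimes> d)"
        by (simp flip: m_assoc)
      then show ?thesis using 2 by simp
    next
      case 3
      then have "a \<otimes> d \<otimes> u = a \<otimes> d \<otimes> d"
        by (simp flip: m_assoc)
      then have "u = d" by simp
      then show ?thesis using moved 3 by simp
    qed
  qed
qed

definition progression :: "(nat \<Rightarrow> 'a) \<Rightarrow> 'a \<Rightarrow> nat \<Rightarrow> bool"
  where "progression x d n \<longleftrightarrow> d \<in> carrier G \<and> \<one> \<^bold>< d \<and>
    (\<forall>i<n. x i \<in> carrier G \<and> x i \<bowtie> d) \<and> (\<forall>i. Suc i < n \<longrightarrow> x (Suc i) = x i \<otimes> d)"

lemma progression_nth: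
  assumes "progression x d n" "i + j < n"
  shows "x (i + j) = x i \<otimes> d [^] j"
  using assms(2)
proof (induction j)
  case 0
  then show ?case using assms(1) by (simp add: progression_def)
next
  case (Suc j)
  then show ?case using assms(1) by (simp add: progression_def m_assoc)
qed

lemma progression_from_square:
  assumes x: "chain x n" and comm: "commuting_set (seg x 0 n)"
    and card: "card (seg x 0 n <#> seg x 0 n) + 1 \<le> 2 * n" and n: "2 \<le> n"
  shows "progression x (inv (x 0) \<otimes> x 1) n"
proof -
  define d where "d = inv (x 0) \<otimes> x 1"
  have carr: "x i \<in> carrier G" if "i < n" for i
    using x that by (rule chain_carrier)
  have d: "d \<in> carrier G"
    using n carr by (simp add: d_def)
  have xx: "x i \<bowtie> x j" if "i < n" "j < n" for i j
    using comm that by (auto simp: commuting_set_def)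
  have xd: "x i \<bowtie> d" if "i < n" for i
    unfolding d_def by (intro commute_mult commute_inv xx) (use carr n that in auto)
  have "inv (x 0) \<otimes> x 0 \<^bold>< inv (x 0) \<otimes> x 1"
    using chain_lt[OF x, of 0 1] n carr by (intro mult_left_mono) auto
  then have d1: "\<one> \<^bold>< d"
    using n carr by (simp add: d_def)
  have "x (Suc i) = x i \<otimes> d" if "Suc i < n" for i
    using that
  proof (induction i)
    case 0
    then show ?case using carr n by (simp add: d_def)
  next
    case (Suc i)
    then have IH: "x (Suc i) = x i \<otimes> d" and [simp]: "x i \<in> carrier G" "x (Suc i) \<in> carrier G"
      "x (Suc (Suc i)) \<in> carrier G" "d \<in> carrier G"
      using carr d by auto
    have "x i \<otimes> x (Suc (Suc i)) = x (Suc i) \<otimes> x (Suc i)"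
      using minimal_square_progression[OF x comm card, of i] Suc.prems by simp
    also have "\<dots> = x i \<otimes> (d \<otimes> x (Suc i))"
      by (subst (1) IH) (simp add: m_assoc)
    finally show ?case
      using xd[of "Suc i"] Suc.prems by (simp add: commute_def)
  qed
  then have "progression x d n"
    unfolding progression_def using d d1 carr xd by blast
  then show ?thesis
    by (simp only: d_def)
qed

lemma conjugate_eq: "x \<in> carrier G \<Longrightarrow> y \<in> carrier G \<Longrightarrow> x \<otimes> y = y \<otimes> conjugate G x y"
  by (simp add: conjugate_def m_assoc)

lemma conjugate_closed [simp]: "x \<in> carrier G \<Longrightarrow> y \<in> carrier G \<Longrightarrow> conjugate G x y \<in> carrier G"
  by (simp add: conjugate_def)

lemma conjugate_mult:
  "a \<in> carrier G \<Longrightarrow> b \<in> carrier G \<Longrightarrow> y \<in> carrier G \<Longrightarrow>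
    conjugate G (a \<otimes> b) y = conjugate G a y \<otimes> conjugate G b y"
  by (simp add: conjugate_def m_assoc)

lemma conjugate_eq_self: "a \<in> carrier G \<Longrightarrow> y \<in> carrier G \<Longrightarrow> conjugate G a y = a \<Longrightarrow> y \<bowtie> a"
  using conjugate_eq[of a y] by (simp add: commute_def)

text \<open>
  The analysis of three terms applies to every three consecutive terms of the progression. With four terms or
  more, two such triples with \<open>u \<noteq> d\<close> would place \<open>b\<close> in contradictory positions, which leaves the translation by
  one step.
\<close>

lemma tight_insert_progression:
  assumes x: "chain x n" and comm: "commuting_set (seg x 0 n)" and n: "3 \<le> n"
    and tight: "tight (insert y (seg x 0 n))"
  defines "d \<equiv> inv (x 0) \<otimes> x 1"
  defines "b \<equiv> conjugate G (x 0) y" and "u \<equiv> conjugate G d y"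
  shows "progression x d n"
    and "u = d \<and> (b = x 0 \<otimes> d \<or> b \<otimes> d = x 0) \<or>
      n = 3 \<and> (u = d \<otimes> d \<and> (b = x 0 \<or> b \<otimes> (d \<otimes> d) = x 0) \<or>
        u \<otimes> u = d \<and> (b = x 0 \<or> b = x 0 \<otimes> d))"
proof -
  let ?T = "seg x 0 n"
  have T: "?T \<subseteq> carrier G" "finite ?T" "?T \<noteq> {}" "card ?T = n"
    using seg_carrier[OF x] card_seg[OF x, of n 0] n by auto
  have y: "y \<in> carrier G" "\<not> commuting_set (insert y ?T)"
    using tight by (auto simp: tight_def)
  then have "y \<notin> ?T"
    using comm by (metis insert_absorb)
  note counts = tight_insert[OF tight comm T(3) this]
  show prog: "progression x d n"
    unfolding d_def using counts(1) T(4) n by (intro progression_from_square[OF x comm]) auto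
  have carr [simp]: "d \<in> carrier G" "y \<in> carrier G" "x 0 \<in> carrier G" "x 1 \<in> carrier G"
      "b \<in> carrier G" "u \<in> carrier G"
    using prog n y T(1) by (auto simp: progression_def b_def u_def)
  have d1: "\<one> \<^bold>< d"
    using prog by (simp add: progression_def)
  have by_eq: "x 0 \<otimes> y = y \<otimes> b" and uy_eq: "d \<otimes> y = y \<otimes> u"
    by (auto simp: b_def u_def intro: conjugate_eq)
  have window: "card (translates y {x i, x i \<otimes> d, x i \<otimes> (d \<otimes> d)}) \<le> 4" if "i + 3 \<le> n" for i
  proof -
    have "card (translates y (seg x i (i + 3))) \<le> card (seg x i (i + 3)) + 1"
    proof (rule seg_induct[OF x, where P = "\<lambda>T. card (translates y T) \<le> card T + 1" and Q = "\<lambda>_ _. True"])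
      show "card (translates y ?T) \<le> card ?T + 1"
        using counts(2) by simp
      show "card (translates y (seg x i j)) \<le> card (seg x i j) + 1"
        if "i < j" "Suc j \<le> n" "card (translates y (seg x i (Suc j))) \<le> card (seg x i (Suc j)) + 1" for i j
        using card_translates_remove_greatest[OF seg_carrier[OF x] _ y(1) greatest_in_seg[OF x], of j i]
          that seg_remove_last[OF x, of i j] card_seg[OF x, of j i] card_seg[OF x, of "Suc j" i]
        by (auto simp: Suc_diff_le)
      show "card (translates y (seg x (Suc i) j)) \<le> card (seg x (Suc i) j) + 1"
        if "Suc i < j" "j \<le> n" "card (translates y (seg x i j)) \<le> card (seg x i j) + 1" for i j
        using card_translates_remove_least[OF seg_carrier[OF x] _ y(1) least_in_seg[OF x], of j i]
          that seg_remove_first[OF x, of i j] card_seg[OF x, of j i] card_seg[OF x, of j "Suc i"]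
        by (auto simp: Suc_diff_le)
    qed (use that in auto)
    moreover have "card (seg x i (i + 3)) = 3"
      using card_seg[OF x, of "i + 3" i] that by simp
    moreover have "seg x i (i + 3) = {x i, x (Suc i), x (Suc (Suc i))}"
    proof -
      have "{i..<i + 3} = {i, Suc i, Suc (Suc i)}" by auto
      then show ?thesis by simp
    qed
    moreover have "x (Suc i) = x i \<otimes> d" "x (Suc (Suc i)) = x i \<otimes> (d \<otimes> d)"
      using prog that by (simp_all add: progression_def m_assoc)
    ultimately show ?thesis by simp
  qed
  have moved: "\<not> (b = x 0 \<and> u = d)"
  proof
    assume "b = x 0 \<and> u = d"
    then have yx: "y \<bowtie> x 0" and yd: "y \<bowtie> d"
      unfolding b_def u_def by (auto intro: conjugate_eq_self)
    have "y \<bowtie> x i" if "i < n" for i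
      using that
    proof (induction i)
      case 0
      then show ?case using yx by simp
    next
      case (Suc i)
      then show ?case
        using prog yd commute_mult[of y "x i" d] by (simp add: progression_def)
    qed
    then have "commuting_set (insert y ?T)"
      using comm by (auto simp: commuting_set_def commute_sym)
    then show False using y(2) by contradiction
  qed
  note first = conjugate_three_progression[OF carr(3,1,2) d1 carr(5) by_eq carr(6) uy_eq window[of 0]]
  show "u = d \<and> (b = x 0 \<otimes> d \<or> b \<otimes> d = x 0) \<or>
      n = 3 \<and> (u = d \<otimes> d \<and> (b = x 0 \<or> b \<otimes> (d \<otimes> d) = x 0) \<or>
        u \<otimes> u = d \<and> (b = x 0 \<or> b = x 0 \<otimes> d))"
  proof (cases "n = 3 \<or> u = d")
    case True
    have dd: "d \<noteq> d \<otimes> d"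
      using d1 mult_left_mono[OF d1, of d] by auto
    show ?thesis
      using first n moved True dd by auto
  next
    case False
    then have "4 \<le> n" "u \<noteq> d" using n by auto
    have x1: "x 1 = x 0 \<otimes> d"
      using prog n by (simp add: progression_def)
    have "x 1 \<otimes> y = y \<otimes> (b \<otimes> u)"
    proof -
      have "x 1 \<otimes> y = x 0 \<otimes> (d \<otimes> y)"
        unfolding x1 by (simp add: m_assoc)
      also have "\<dots> = x 0 \<otimes> y \<otimes> u"
        unfolding uy_eq by (simp add: m_assoc)
      finally show ?thesis by (simp add: by_eq m_assoc)
    qed
    then have second: "u = d \<otimes> d \<and> (b \<otimes> u = x 1 \<or> b \<otimes> u \<otimes> (d \<otimes> d) = x 1) \<or>
        u \<otimes> u = d \<and> (b \<otimes> u = x 1 \<or> b \<otimes> u = x 1 \<otimes> d)"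
      using conjugate_three_progression[OF carr(4,1,2) d1 _ _ carr(6) uy_eq window[of 1], of "b \<otimes> u"]
        \<open>4 \<le> n\<close> \<open>u \<noteq> d\<close> by auto
    have first': "u = d \<otimes> d \<and> (b = x 0 \<or> b \<otimes> (d \<otimes> d) = x 0) \<or>
      u \<otimes> u = d \<and> (b = x 0 \<or> b = x 0 \<otimes> d)"
      using first n moved \<open>u \<noteq> d\<close> by auto
    have "d \<^bold>< d \<otimes> d" "d \<otimes> d \<^bold>< d \<otimes> (d \<otimes> d)" "d \<otimes> (d \<otimes> d) \<^bold>< d \<otimes> (d \<otimes> (d \<otimes> d))"
      using mult_left_mono[OF d1, of d] mult_left_mono[OF d1, of "d \<otimes> d"]
        mult_left_mono[OF d1, of "d \<otimes> (d \<otimes> d)"] by (simp_all add: m_assoc)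
    then have powers: "\<one> \<noteq> d" "\<one> \<noteq> d \<otimes> d" "\<one> \<noteq> d \<otimes> (d \<otimes> d)" "d \<noteq> d \<otimes> d" "d \<noteq> d \<otimes> (d \<otimes> d)"
        "d \<noteq> d \<otimes> (d \<otimes> (d \<otimes> d))"
      using d1 by order+
    consider "u = d \<otimes> d" "b = x 0 \<or> b \<otimes> (d \<otimes> d) = x 0" | "u \<otimes> u = d" "b = x 0 \<or> b = x 0 \<otimes> d"
      using first' by blast
    then have False
    proof cases
      case 1
      then have "b \<otimes> (d \<otimes> d) = x 1 \<or> b \<otimes> (d \<otimes> d) \<otimes> (d \<otimes> d) = x 1"
        using second powers by (auto simp: m_assoc)
      then show False
        using 1(2) powers
        by (elim disjE) (simp_all add: x1[simplified] m_assoc powers[symmetric])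
    next
      case 2
      then have "b \<otimes> u = x 1 \<or> b \<otimes> u = x 1 \<otimes> d"
        using second powers by (auto simp: m_assoc)
      then have "u = d \<or> u = d \<otimes> d \<or> u = \<one>"
        using 2(2) by (auto simp: x1[simplified] m_assoc)
      then show False
        using 2(1) powers \<open>u \<noteq> d\<close> by (auto simp: m_assoc)
    qed
    then show ?thesis ..
  qed
qed

text \<open>
  Here the count says that \<open>s\<^sup>y\<close> or \<open>t\<^sup>y\<close> lies in \<open>{s, t}\<close>.
\<close>

lemma conjugate_two:
  assumes "tight {y, s, t}" "s \<bowtie> t" "s \<noteq> t"
  shows "s \<bowtie> y \<or> t \<bowtie> y \<or> s \<otimes> y = y \<otimes> t \<or> t \<otimes> y = y \<otimes> s"
proof (rule ccontr)
  assume neg: "\<not> ?thesis"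
  have carr: "y \<in> carrier G" "s \<in> carrier G" "t \<in> carrier G"
    using assms(1) by (auto simp: tight_def)
  have comm: "commuting_set {s, t}"
    using assms(2) by (auto simp: commuting_set_def commute_sym)
  have "y \<noteq> s" "y \<noteq> t"
    using neg by auto
  then have "card (translates y {s, t}) = card {s, t} + 1"
    using assms by (intro tight_insert(2) comm) auto
  then obtain p where "p \<in> {s, t}" "\<forall>r\<in>{s, t} - {p}. \<exists>q\<in>{s, t}. r \<otimes> y = y \<otimes> q"
    using all_but_one_conjugate_in[of "{s, t}" y] carr by auto
  then show False
    using neg assms(3) by (auto simp: commute_def)
qed

section \<open>Consecutive elements that never commute\<close>

text \<open>
  The three products that tightness allows are known in this case, so \<open>S\<^sup>2\<close> can be built up from the
  bottom of \<open>S\<close>.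
\<close>

lemma noncommuting_top_square:
  assumes S: "tight S" and m: "greatest_in S m" and T: "\<not> commuting_set (S - {m})"
    and b: "greatest_in (S - {m}) b" and mb: "\<not> m \<bowtie> b"
  shows "S <#> S = ((S - {m}) <#> (S - {m})) \<union> {m \<otimes> m, m \<otimes> b, b \<otimes> m}"
proof -
  let ?T = "S - {m}"
  have fin: "finite S" and sub: "S \<subseteq> carrier G"
    using S by (auto simp: tight_def)
  have mem: "m \<in> S" "b \<in> S"
    using m b by (auto simp: greatest_in_def)
  have "m \<otimes> b \<noteq> b \<otimes> m"
    using mb by (simp add: commute_def)
  then have "card ((?T <#> ?T) \<union> {m \<otimes> m, m \<otimes> b, b \<otimes> m}) = card (?T <#> ?T) + 3"
    using new_products[OF sub m b] fin by (subst card_Un_disjoint) (auto simp: finite_set_mult)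
  also have "\<dots> = card (S <#> S)"
    using tight_remove_greatest(2)[OF S m T] by simp
  finally show ?thesis
    using mem set_mult_mono[of ?T S ?T S] finite_set_mult[OF fin fin]
    by (intro card_subset_eq[symmetric]) (auto simp: mem_set_mult)
qed

lemma greatest_in_two: "A \<^bold>< B \<Longrightarrow> greatest_in {A, B} B"
  and greatest_in_three: "A \<^bold>< B \<Longrightarrow> B \<^bold>< C \<Longrightarrow> greatest_in {A, B, C} C"
  and greatest_in_four: "A \<^bold>< B \<Longrightarrow> B \<^bold>< C \<Longrightarrow> C \<^bold>< D \<Longrightarrow> greatest_in {A, B, C, D} D"
  unfolding greatest_in_def le_def by (auto dest: ord.less_trans)

lemma noncommuting_triple_square:
  assumes "tight {A, B, C}" "A \<^bold>< B" "B \<^bold>< C" "\<not> A \<bowtie> B" "\<not> B \<bowtie> C"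
  shows "{A, B, C} <#> {A, B, C} =
    {A \<otimes> A, A \<otimes> B, B \<otimes> A, B \<otimes> B, B \<otimes> C, C \<otimes> B, C \<otimes> C}"
proof -
  have "A \<noteq> C" "B \<noteq> C" using assms(2,3) by order+
  then have T: "{A, B, C} - {C} = {A, B}" by auto
  have "{A, B} <#> {A, B} = {A \<otimes> A, A \<otimes> B, B \<otimes> A, B \<otimes> B}"
    by (auto simp: set_mult_def)
  then show ?thesis
    using noncommuting_top_square[OF assms(1) greatest_in_three[OF assms(2,3)], of B]
      greatest_in_two[OF assms(2)] assms(4,5)
    by (auto simp: T commuting_set_def commute_sym)
qed

lemma tight_four_parts:
  assumes "tight {A, B, C, D}" "A \<^bold>< B" "B \<^bold>< C" "C \<^bold>< D" "\<not> B \<bowtie> C"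
  shows "tight {A, B, C}" "tight {B, C, D}" "\<not> commuting_set ({A, B, C, D} - {D})"
    "{A, B, C, D} - {D} = {A, B, C}" "greatest_in {A, B, C, D} D"
proof -
  have ne: "A \<noteq> D" "B \<noteq> D" "C \<noteq> D" "A \<noteq> B" "A \<noteq> C" using assms(2-4) by order+
  then show T: "{A, B, C, D} - {D} = {A, B, C}"
    by auto
  have T': "{A, B, C, D} - {A} = {B, C, D}"
    using ne by auto
  have "least_in {A, B, C, D} A"
    using assms(2-4) unfolding least_in_def le_def by (auto dest: ord.less_trans)
  then show "tight {B, C, D}"
    using tight_remove_least(1)[OF assms(1), of A] assms(5) by (auto simp: T' commuting_set_def)
  show top: "greatest_in {A, B, C, D} D"
    by (rule greatest_in_four[OF assms(2-4)])
  show nc: "\<not> commuting_set ({A, B, C, D} - {D})"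
    using assms(5) by (auto simp: T commuting_set_def)
  show "tight {A, B, C}"
    using tight_remove_greatest(1)[OF assms(1) top nc] by (simp add: T)
qed

lemma noncommuting_quadruple_square:
  assumes "tight {A, B, C, D}" "A \<^bold>< B" "B \<^bold>< C" "C \<^bold>< D" "\<not> A \<bowtie> B" "\<not> B \<bowtie> C" "\<not> C \<bowtie> D"
  shows "{A, B, C, D} <#> {A, B, C, D} =
    {A \<otimes> A, A \<otimes> B, B \<otimes> A, B \<otimes> B, B \<otimes> C, C \<otimes> B, C \<otimes> C, C \<otimes> D, D \<otimes> C, D \<otimes> D}"
proof -
  note parts = tight_four_parts[OF assms(1-4,6)]
  have "\<not> D \<bowtie> C" using assms(7) by (simp add: commute_sym)
  then show ?thesis
    using noncommuting_top_square[OF assms(1) parts(5,3), of C] greatest_in_three[OF assms(2,3)]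
      noncommuting_triple_square[OF parts(1) assms(2,3,5,6)]
    by (auto simp: parts(4))
qed

text \<open>
  Only seven products occur, and \<open>AC\<close>, \<open>CA\<close> are squeezed between \<open>AB < AC < BC\<close> and
  \<open>BA < CA < CB\<close>.
\<close>

lemma noncommuting_triple:
  assumes tight: "tight {A, B, C}" and lt: "A \<^bold>< B" "B \<^bold>< C"
    and nc: "\<not> B \<bowtie> C" and sign: "A \<otimes> B \<^bold>< B \<otimes> A"
  shows "B \<otimes> C \<^bold>< C \<otimes> B"
    and "A \<otimes> C = B \<otimes> A \<and> C \<otimes> A = B \<otimes> B \<or> A \<otimes> C = B \<otimes> A \<and> C \<otimes> A = B \<otimes> C \<or>
      A \<otimes> C = B \<otimes> B \<and> C \<otimes> A = B \<otimes> C"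
proof -
  have carr [simp]: "A \<in> carrier G" "B \<in> carrier G" "C \<in> carrier G"
    using lt lt_carrier by auto
  have ncAB: "\<not> A \<bowtie> B"
    using sign by (auto simp: commute_def)
  have lts: "A \<otimes> A \<^bold>< A \<otimes> B" "B \<otimes> A \<^bold>< B \<otimes> B" "B \<otimes> B \<^bold>< B \<otimes> C" "B \<otimes> B \<^bold>< C \<otimes> B"
    "B \<otimes> C \<^bold>< C \<otimes> C" "C \<otimes> B \<^bold>< C \<otimes> C" "A \<otimes> B \<^bold>< A \<otimes> C" "A \<otimes> C \<^bold>< B \<otimes> C"
    "B \<otimes> A \<^bold>< C \<otimes> A" "C \<otimes> A \<^bold>< C \<otimes> B"
    using lt by (auto intro: mult_left_mono mult_right_mono)
  have mem: "A \<otimes> C \<in> {A, B, C} <#> {A, B, C}" "C \<otimes> A \<in> {A, B, C} <#> {A, B, C}"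
    by (auto simp: mem_set_mult)
  have "A \<otimes> C \<noteq> A \<otimes> A" "A \<otimes> C \<noteq> A \<otimes> B" "A \<otimes> C \<noteq> B \<otimes> C" "A \<otimes> C \<noteq> C \<otimes> C"
    using lts sign by order+
  then have AC: "A \<otimes> C = B \<otimes> A \<or> A \<otimes> C = B \<otimes> B \<or> A \<otimes> C = C \<otimes> B"
    using mem(1) unfolding noncommuting_triple_square[OF tight lt ncAB nc] by blast
  have "C \<otimes> A \<noteq> A \<otimes> A" "C \<otimes> A \<noteq> A \<otimes> B" "C \<otimes> A \<noteq> B \<otimes> A" "C \<otimes> A \<noteq> C \<otimes> B" "C \<otimes> A \<noteq> C \<otimes> C"
    using lts sign by order+
  then have CA: "C \<otimes> A = B \<otimes> B \<or> C \<otimes> A = B \<otimes> C"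
    using mem(2) unfolding noncommuting_triple_square[OF tight lt ncAB nc] by blast
  show sign': "B \<otimes> C \<^bold>< C \<otimes> B"
    using CA
  proof
    assume eq: "C \<otimes> A = B \<otimes> B"
    \<comment> \<open>\<open>C(AB) = B\<^sup>3 = BCA\<close>, so that \<open>A\<close> cancels from \<open>C(AB) < C(BA)\<close>.\<close>
    have "C \<otimes> (A \<otimes> B) \<^bold>< C \<otimes> (B \<otimes> A)"
      using sign by (intro mult_left_mono) auto
    moreover have "C \<otimes> (A \<otimes> B) = B \<otimes> C \<otimes> (inv C \<otimes> B \<otimes> B)"
      using eq by (simp add: m_assoc flip: m_assoc[of C A B])
    moreover have "A = inv C \<otimes> B \<otimes> B"
      using eq by (simp add: inv_solve_left m_assoc)
    ultimately have "B \<otimes> C \<otimes> A \<^bold>< C \<otimes> B \<otimes> A"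
      by (simp add: m_assoc)
    then show ?thesis
      by (simp add: mult_right_mono_iff)
  next
    assume "C \<otimes> A = B \<otimes> C"
    then show ?thesis using lts by order
  qed
  have "A \<otimes> C \<noteq> C \<otimes> B"
    using lts sign' by order
  moreover have "\<not> (A \<otimes> C = B \<otimes> B \<and> C \<otimes> A = B \<otimes> B)"
  proof
    assume eq: "A \<otimes> C = B \<otimes> B \<and> C \<otimes> A = B \<otimes> B"
    then have "A \<bowtie> A \<otimes> C"
      using commute_mult[of A A C] by (simp add: commute_def)
    then have "A \<bowtie> B"
      using eq by (auto intro: commute_square)
    then show False using ncAB by contradiction
  qed
  ultimately show "A \<otimes> C = B \<otimes> A \<and> C \<otimes> A = B \<otimes> B \<or> A \<otimes> C = B \<otimes> A \<and> C \<otimes> A = B \<otimes> C \<or>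
      A \<otimes> C = B \<otimes> B \<and> C \<otimes> A = B \<otimes> C"
    using AC CA by blast
qed

text \<open>
  Write \<open>B = Au\<close>, \<open>v = u\<^sup>A\<close> and \<open>w = v\<^sup>A\<close>. Moving every factor \<open>A\<close> to the left brings the products to the form
  \<open>A\<^sup>2\<close> times a word in \<open>u\<close>, \<open>v\<close>, \<open>w\<close>. Of the nine combinations of types of the triples \<open>A, B, C\<close> and \<open>B, C, D\<close>,
  only two are compatible with \<open>1 < u < v\<close>. Where the equations of the types do
  not decide this, \<open>AD\<close> and \<open>DA\<close> are located among the ten products, between \<open>AC\<close> and \<open>BD\<close> and
  between \<open>CA\<close> and \<open>DB\<close>.
\<close>

lemma noncommuting_quadruple:
  assumes tight: "tight {A, B, C, D}" and lt: "A \<^bold>< B" "B \<^bold>< C" "C \<^bold>< D"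
    and nc: "\<not> B \<bowtie> C" "\<not> C \<bowtie> D" and sign: "A \<otimes> B \<^bold>< B \<otimes> A"
  shows "A \<otimes> C = B \<otimes> A \<and> C \<otimes> A = B \<otimes> C \<and> B \<otimes> D = C \<otimes> B \<and> D \<otimes> B = C \<otimes> D \<or>
    A \<otimes> C = B \<otimes> A \<and> C \<otimes> A = B \<otimes> B \<and> B \<otimes> D = C \<otimes> C \<and> A \<otimes> D = B \<otimes> B"
proof -
  have carr [simp]: "A \<in> carrier G" "B \<in> carrier G" "C \<in> carrier G" "D \<in> carrier G"
    using lt lt_carrier by auto
  have ncAB: "\<not> A \<bowtie> B"
    using sign by (auto simp: commute_def)
  note sq = noncommuting_quadruple_square[OF tight lt ncAB nc]
  note parts = tight_four_parts[OF tight lt nc(1)]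
  note low = noncommuting_triple[OF parts(1) lt(1,2) nc(1) sign]
  note high = noncommuting_triple[OF parts(2) lt(2,3) nc(2) low(1)]
  define u where "u = inv A \<otimes> B"
  define v where "v = conjugate G u A"
  define w where "w = conjugate G v A"
  have carr' [simp]: "u \<in> carrier G" "v \<in> carrier G" "w \<in> carrier G"
    by (simp_all add: u_def v_def w_def)
  have B: "B = A \<otimes> u"
    by (simp add: u_def)
  have uA: "u \<otimes> A = A \<otimes> v" and vA: "v \<otimes> A = A \<otimes> w"
    by (auto simp: v_def w_def intro!: conjugate_eq)
  have uA': "u \<otimes> (A \<otimes> z) = A \<otimes> (v \<otimes> z)" and vA': "v \<otimes> (A \<otimes> z) = A \<otimes> (w \<otimes> z)"
    if "z \<in> carrier G" for z
    using that uA vA by (simp_all flip: m_assoc)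
  note norm = m_assoc uA vA uA' vA'
  have "A \<otimes> \<one> \<^bold>< A \<otimes> u"
    using lt(1) B by simp
  then have u1: "\<one> \<^bold>< u"
    by (simp only: mult_left_mono_iff one_closed carr carr')
  have "A \<otimes> (A \<otimes> u) \<^bold>< A \<otimes> (A \<otimes> v)"
    using sign by (simp add: B norm)
  then have uv: "u \<^bold>< v"
    by (simp add: mult_left_mono_iff)
  have ne: "u \<noteq> v" "v \<noteq> u" "u \<noteq> \<one>" "v \<noteq> \<one>"
    using u1 uv by order+
  have lts: "A \<otimes> A \<^bold>< A \<otimes> B" "B \<otimes> A \<^bold>< B \<otimes> B" "B \<otimes> B \<^bold>< B \<otimes> C"
    "C \<otimes> B \<^bold>< C \<otimes> C" "C \<otimes> C \<^bold>< C \<otimes> D" "C \<otimes> C \<^bold>< D \<otimes> C" "C \<otimes> D \<^bold>< D \<otimes> D" "D \<otimes> C \<^bold>< D \<otimes> D"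
    "A \<otimes> C \<^bold>< A \<otimes> D" "A \<otimes> D \<^bold>< B \<otimes> D" "C \<otimes> A \<^bold>< D \<otimes> A" "D \<otimes> A \<^bold>< D \<otimes> B"
    using lt by (auto intro: mult_left_mono mult_right_mono)
  have mem: "A \<otimes> D \<in> {A, B, C, D} <#> {A, B, C, D}" "D \<otimes> A \<in> {A, B, C, D} <#> {A, B, C, D}"
    by (auto simp: mem_set_mult)
  have "B \<otimes> A \<^bold>\<le> A \<otimes> C" "B \<otimes> D \<^bold>\<le> C \<otimes> C"
    using low(2) high(2) lts by (auto simp: le_def)
  then have between: "B \<otimes> A \<^bold>< A \<otimes> D" "A \<otimes> D \<^bold>< C \<otimes> C"
    using lts by (auto intro: ord.le_less_trans ord.less_le_trans)
  then have "A \<otimes> D \<noteq> A \<otimes> A" "A \<otimes> D \<noteq> A \<otimes> B" "A \<otimes> D \<noteq> B \<otimes> A" "A \<otimes> D \<noteq> C \<otimes> C"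
    "A \<otimes> D \<noteq> C \<otimes> D" "A \<otimes> D \<noteq> D \<otimes> C" "A \<otimes> D \<noteq> D \<otimes> D"
    using lts sign by (metis ord.less_trans ord.less_irrefl)+
  then have AD: "A \<otimes> D = B \<otimes> B \<or> A \<otimes> D = B \<otimes> C \<or> A \<otimes> D = C \<otimes> B"
    using mem(1) unfolding sq by blast
  from low(2) high(2) consider
      (bs_bs) "A \<otimes> C = B \<otimes> A" "C \<otimes> A = B \<otimes> C" "B \<otimes> D = C \<otimes> B" "D \<otimes> B = C \<otimes> D"
    | (bs_f) "A \<otimes> C = B \<otimes> A" "C \<otimes> A = B \<otimes> C"
        "B \<otimes> D = C \<otimes> B \<and> D \<otimes> B = C \<otimes> C \<or> B \<otimes> D = C \<otimes> C \<and> D \<otimes> B = C \<otimes> D"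
    | (f1) "A \<otimes> C = B \<otimes> A" "C \<otimes> A = B \<otimes> B"
        "B \<otimes> D = C \<otimes> B \<and> D \<otimes> B = C \<otimes> C \<or> B \<otimes> D = C \<otimes> B \<and> D \<otimes> B = C \<otimes> D \<or>
         B \<otimes> D = C \<otimes> C \<and> D \<otimes> B = C \<otimes> D"
    | (f2) "A \<otimes> C = B \<otimes> B" "C \<otimes> A = B \<otimes> C"
        "B \<otimes> D = C \<otimes> B \<and> D \<otimes> B = C \<otimes> C \<or> B \<otimes> D = C \<otimes> B \<and> D \<otimes> B = C \<otimes> D \<or>
         B \<otimes> D = C \<otimes> C \<and> D \<otimes> B = C \<otimes> D"
    by blast
  then show ?thesis
  proof cases
    case bs_bs
    then show ?thesis by blast
  next
    case bs_f
    have C: "C = A \<otimes> v"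
      using bs_f(1) by (simp add: B norm)
    have w: "w = v \<otimes> v"
      using bs_f(2) by (simp add: B C norm)
    from bs_f(3) show ?thesis
    proof (elim disjE conjE)
      assume eq: "B \<otimes> D = C \<otimes> B" "D \<otimes> B = C \<otimes> C"
      have "A \<otimes> (u \<otimes> D) = A \<otimes> (u \<otimes> (A \<otimes> (v \<otimes> u)))"
        using eq(1) by (simp add: B C norm w)
      then have D: "D = A \<otimes> (v \<otimes> u)"
        by simp
      show ?thesis
        using eq(2) ne by (simp add: B C D norm w)
    next
      assume eq: "B \<otimes> D = C \<otimes> C" "D \<otimes> B = C \<otimes> D"
      have "A \<otimes> (u \<otimes> D) = A \<otimes> (u \<otimes> (A \<otimes> (v \<otimes> v)))"
        using eq(1) by (simp add: B C norm w)
      then have D: "D = A \<otimes> (v \<otimes> v)"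
        by simp
      show ?thesis
        using eq(2) ne by (simp add: B C D norm w)
    qed
  next
    case f1
    have C: "C = A \<otimes> v"
      using f1(1) by (simp add: B norm)
    have w: "w = v \<otimes> u"
      using f1(2) by (simp add: B C norm)
    from f1(3) show ?thesis
    proof (elim disjE conjE)
      assume eq: "B \<otimes> D = C \<otimes> B" "D \<otimes> B = C \<otimes> C"
      have "A \<otimes> D \<noteq> C \<otimes> B"
        using lts eq(1) by auto
      then consider "A \<otimes> D = B \<otimes> B" | "A \<otimes> D = B \<otimes> C"
        using AD by blast
      then show ?thesis
      proof cases
        case 1
        then have D: "D = A \<otimes> (v \<otimes> u)"
          by (simp add: B norm)
        show ?thesis
          using eq(1) ne by (simp add: B C D norm w)
      next
        case 2
        then have D: "D = A \<otimes> (v \<otimes> v)"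
          by (simp add: B C norm)
        have "v \<otimes> v = u \<otimes> u"
          using eq(1) by (simp add: B C D norm w)
        then have "v = u"
          by (rule square_inject) simp_all
        then show ?thesis using ne by simp
      qed
    next
      assume eq: "B \<otimes> D = C \<otimes> B" "D \<otimes> B = C \<otimes> D"
      have "A \<otimes> (u \<otimes> D) = A \<otimes> (u \<otimes> (A \<otimes> (u \<otimes> u)))"
        using eq(1) by (simp add: B C norm w)
      then have D: "D = A \<otimes> (u \<otimes> u)"
        by simp
      have "v \<otimes> u = u \<otimes> u \<otimes> u"
        using eq(2) by (simp add: B C D norm w)
      then have v: "v = u \<otimes> u"
        by simp
      have "A \<otimes> w = A \<otimes> (v \<otimes> v)"
        using vA by (simp add: norm v)
      then have "v \<otimes> u = v \<otimes> v"
        by (simp add: w)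
      then show ?thesis using ne by simp
    next
      assume eq: "B \<otimes> D = C \<otimes> C" "D \<otimes> B = C \<otimes> D"
      from AD consider "A \<otimes> D = B \<otimes> B" | "A \<otimes> D = B \<otimes> C" | "A \<otimes> D = C \<otimes> B"
        using AD by blast
      then show ?thesis
      proof cases
        case 1
        then show ?thesis using f1 eq by blast
      next
        case 2
        then have D: "D = A \<otimes> (v \<otimes> v)"
          by (simp add: B C norm)
        have "v \<otimes> v = u \<otimes> v"
          using eq(1) by (simp add: B C D norm w)
        then show ?thesis using ne by simp
      next
        case 3
        then have D: "D = A \<otimes> (v \<otimes> (u \<otimes> u))"
          by (simp add: B C norm w)
        show ?thesis
          using eq(2) ne by (simp add: B C D norm w)
      qed
    qed
  next
    case f2
    have C: "C = A \<otimes> (v \<otimes> u)"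
      using f2(1) by (simp add: B norm)
    have w: "w \<otimes> v = v \<otimes> (v \<otimes> u)"
      using f2(2) by (simp add: B C norm)
    have w': "w \<otimes> (v \<otimes> z) = v \<otimes> (v \<otimes> (u \<otimes> z))" if "z \<in> carrier G" for z
      using that w by (simp flip: m_assoc)
    from f2(3) show ?thesis
    proof (elim disjE conjE)
      assume eq: "B \<otimes> D = C \<otimes> B" "D \<otimes> B = C \<otimes> C"
      have "A \<otimes> D \<noteq> C \<otimes> B" "A \<otimes> D \<noteq> B \<otimes> B"
        using lts eq(1) f2(1) by auto
      then have "A \<otimes> D = B \<otimes> C"
        using AD by blast
      then have D: "D = A \<otimes> (v \<otimes> (v \<otimes> u))"
        by (simp add: B C norm)
      show ?thesis
        using eq(1) ne by (simp add: B C D norm w w')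
    next
      assume eq: "B \<otimes> D = C \<otimes> B" "D \<otimes> B = C \<otimes> D"
      have "A \<otimes> (u \<otimes> D) = A \<otimes> (u \<otimes> (A \<otimes> (v \<otimes> (u \<otimes> u))))"
        using eq(1) by (simp add: B C norm w w')
      then have D: "D = A \<otimes> (v \<otimes> (u \<otimes> u))"
        by simp
      show ?thesis
        using eq(2) ne by (simp add: B C D norm w w')
    next
      assume eq: "B \<otimes> D = C \<otimes> C" "D \<otimes> B = C \<otimes> D"
      have "A \<otimes> D \<noteq> B \<otimes> B"
        using lts f2(1) by auto
      then consider "A \<otimes> D = B \<otimes> C" | "A \<otimes> D = C \<otimes> B"
        using AD by blast
      then show ?thesis
      proof cases
        case 1
        then have D: "D = A \<otimes> (v \<otimes> (v \<otimes> u))"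
          by (simp add: B C norm)
        have "\<one> \<otimes> (v \<otimes> u) = u \<otimes> (v \<otimes> u)"
          using eq(1) by (simp add: B C D norm w w')
        then show ?thesis
          using ne r_cancel[of "v \<otimes> u" \<one> u] by simp
      next
        case 2
        then have D: "D = A \<otimes> (v \<otimes> (v \<otimes> (u \<otimes> u)))"
          by (simp add: B C norm w w')
        have "D \<otimes> A \<noteq> A \<otimes> A" "D \<otimes> A \<noteq> A \<otimes> B" "D \<otimes> A \<noteq> B \<otimes> A" "D \<otimes> A \<noteq> B \<otimes> B" "D \<otimes> A \<noteq> B \<otimes> C"
          "D \<otimes> A \<noteq> C \<otimes> D" "D \<otimes> A \<noteq> D \<otimes> C" "D \<otimes> A \<noteq> D \<otimes> D"
          using lts sign high(1) f2(2) eq(2) by (metis ord.less_trans ord.less_irrefl)+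
        then have "D \<otimes> A = C \<otimes> B \<or> D \<otimes> A = C \<otimes> C"
          using mem(2) unfolding sq by blast
        then have "v \<otimes> (u \<otimes> v) = u \<or> v = \<one>"
          by (simp add: B C D norm w w')
        moreover have "\<one> \<^bold>< v" "u \<^bold>< u \<otimes> v"
          using u1 uv mult_left_mono[of \<one> v u] by (auto intro: ord.less_trans)
        then have "u \<^bold>< v \<otimes> (u \<otimes> v)"
          using mult_right_mono[of \<one> v "u \<otimes> v"] by (auto intro: ord.less_trans)
        ultimately show ?thesis
          using ne by auto
      qed
    qed
  qed
qed

text \<open>
  In the notation above, \<open>C = Av\<close>, \<open>D = Avu\<close> and \<open>v\<^sup>A = vu\<close>; the relation \<open>BD = C\<^sup>2\<close> is what makes \<open>u\<close> and \<open>v\<close>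
  commute.
\<close>

lemma fibonacci_from_relations:
  assumes carr [simp]: "A \<in> carrier G" "B \<in> carrier G" "C \<in> carrier G" "D \<in> carrier G"
    and "A \<^bold>< B"
    and rel: "A \<otimes> C = B \<otimes> A" "C \<otimes> A = B \<otimes> B" "B \<otimes> D = C \<otimes> C" "A \<otimes> D = B \<otimes> B"
  shows "fibonacci_quadruple G R {A, B, C, D}"
proof -
  define u where "u = inv A \<otimes> B"
  define v where "v = conjugate G u A"
  have carr' [simp]: "u \<in> carrier G" "v \<in> carrier G"
    by (simp_all add: u_def v_def)
  have B: "B = A \<otimes> u"
    by (simp add: u_def)
  have uA: "u \<otimes> A = A \<otimes> v"
    by (auto simp: v_def intro!: conjugate_eq)
  have uA': "u \<otimes> (A \<otimes> z) = A \<otimes> (v \<otimes> z)" if "z \<in> carrier G" for z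
    using that uA by (simp flip: m_assoc)
  have C: "C = A \<otimes> v"
    using rel(1) by (simp add: B m_assoc uA)
  have D: "D = A \<otimes> (v \<otimes> u)"
    using rel(4) by (simp add: B m_assoc uA')
  have vA: "v \<otimes> A = A \<otimes> (v \<otimes> u)"
    using rel(2) by (simp add: B C m_assoc uA')
  have vA': "v \<otimes> (A \<otimes> z) = A \<otimes> (v \<otimes> (u \<otimes> z))" if "z \<in> carrier G" for z
    using that vA by (simp add: m_assoc flip: m_assoc[of v A z])
  have comm: "v \<otimes> u = u \<otimes> v"
    using rel(3) by (simp add: B C D m_assoc uA' vA')
  have "A \<otimes> \<one> \<^bold>< A \<otimes> u"
    using assms(5) B by simp
  then have "\<one> \<^bold>< u"
    using mult_left_mono_iff[of \<one> u A] by simp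
  moreover have "conjugate G u (A [^] (2::nat)) = v \<otimes> u"
  proof -
    have "u \<otimes> (A \<otimes> A) = A \<otimes> A \<otimes> (v \<otimes> u)"
      by (simp add: m_assoc uA' vA)
    then show ?thesis
      by (simp add: conjugate_def numeral_2_eq_2 m_assoc inv_mult_group)
  qed
  ultimately show ?thesis
    unfolding fibonacci_quadruple_def using comm
    by (intro bexI[of _ A] bexI[of _ u] conjI disjI1) (auto simp: B C D lt_def simp flip: v_def)
qed

text \<open>
  With \<open>c = x\<^sub>0\<inverse>x\<^sub>1\<close>, the triple \<open>x\<^sub>0, x\<^sub>1, x\<^sub>2\<close> gives \<open>cx\<^sub>0 = x\<^sub>0c\<^sup>2\<close>, and this relation passes from \<open>x\<^sub>i\<close> to \<open>x\<^sub>i\<^sub>+\<^sub>1 = x\<^sub>ic\<close>.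
\<close>

lemma one_progression_from_relations:
  assumes x: "chain x n" and n: "3 \<le> n"
    and rel: "\<And>i. i + 2 < n \<Longrightarrow> x i \<otimes> x (i + 2) = x (i + 1) \<otimes> x i"
      "x 2 \<otimes> x 0 = x 1 \<otimes> x 2"
  shows "one_progression G R (seg x 0 n)"
proof -
  define c where "c = inv (x 0) \<otimes> x 1"
  have carr [simp]: "x i \<in> carrier G" if "i < n" for i
    using x that by (rule chain_carrier)
  have [simp]: "x 0 \<in> carrier G" "x 1 \<in> carrier G" "x 2 \<in> carrier G" "c \<in> carrier G"
    using n by (auto simp: c_def)
  have "x 0 \<in> carrier G" "x 1 \<in> carrier G"
    using n by auto
  then have x1: "x 1 = x 0 \<otimes> c"
    by (simp add: c_def)
  have x2: "x 2 = c \<otimes> x 0"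
  proof -
    have "x 0 \<otimes> x 2 = x 0 \<otimes> (c \<otimes> x 0)"
      using rel(1)[of 0] n by (simp add: x1[simplified] m_assoc eval_nat_numeral)
    then show ?thesis by simp
  qed
  have cx: "c \<otimes> x 0 = x 0 \<otimes> (c \<otimes> c)"
  proof -
    have "c \<otimes> x 0 \<otimes> x 0 = x 0 \<otimes> (c \<otimes> c) \<otimes> x 0"
      using rel(2) unfolding x2 x1 by (simp add: m_assoc)
    then show ?thesis by simp
  qed
  have step: "x (Suc i) = x i \<otimes> c \<and> c \<otimes> x i = x i \<otimes> (c \<otimes> c)" if "Suc i < n" for i
    using that
  proof (induction i)
    case 0
    then show ?case using x1 cx by simp
  next
    case (Suc i)
    then have IH: "x (Suc i) = x i \<otimes> c" "c \<otimes> x i = x i \<otimes> (c \<otimes> c)"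
      and [simp]: "x i \<in> carrier G" "x (Suc (Suc i)) \<in> carrier G"
      by auto
    have "x i \<otimes> x (Suc (Suc i)) = x i \<otimes> (c \<otimes> x i)"
      using rel(1)[of i] Suc.prems IH(1) by (simp add: m_assoc)
    then have "x (Suc (Suc i)) = c \<otimes> x i"
      by simp
    then have "x (Suc (Suc i)) = x (Suc i) \<otimes> c"
      using IH by (simp add: m_assoc)
    moreover have "c \<otimes> x (Suc i) = x (Suc i) \<otimes> (c \<otimes> c)"
    proof -
      have "c \<otimes> x (Suc i) = c \<otimes> x i \<otimes> c"
        by (simp add: IH(1) m_assoc)
      also have "\<dots> = x (Suc i) \<otimes> (c \<otimes> c)"
        unfolding IH by (simp add: m_assoc)
      finally show ?thesis .
    qed
    ultimately show ?case by simp
  qed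
  have nth: "x i = x 0 \<otimes> c [^] i" if "i < n" for i
    using that
  proof (induction i)
    case (Suc i)
    then show ?case using step[of i] by (simp add: m_assoc)
  qed simp
  have "inv (x 0) \<otimes> x 0 \<^bold>< inv (x 0) \<otimes> x 1"
    using chain_lt[OF x, of 0 1] n by (intro mult_left_mono) auto
  then have "\<one> \<^bold>< c"
    by (simp add: c_def)
  moreover have "conjugate G c (x 0) = c [^] (2::nat)"
  proof -
    have "conjugate G c (x 0) = inv (x 0) \<otimes> (c \<otimes> x 0)"
      by (simp add: conjugate_def m_assoc)
    also have "\<dots> = c \<otimes> c"
      unfolding cx by simp
    finally show ?thesis by (simp add: numeral_2_eq_2)
  qed
  moreover have "seg x 0 n = {x 0 \<otimes> c [^] m | m. m < card (seg x 0 n)}"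
  proof -
    have "seg x 0 n = (\<lambda>m. x 0 \<otimes> c [^] m) ` {0..<n}"
      by (intro image_cong refl nth) simp
    moreover have "card (seg x 0 n) = n"
      using card_seg[OF x, of n 0] by simp
    ultimately show ?thesis by auto
  qed
  ultimately show ?thesis
    unfolding one_progression_def lt_def
    by (intro bexI[of _ "x 0"] bexI[of _ c] conjI) auto
qed

lemma seg_three: "seg x i (i + 3) = {x i, x (i + 1), x (i + 2)}"
  and seg_four: "seg x i (i + 4) = {x i, x (i + 1), x (i + 2), x (i + 3)}"
proof -
  have "{i..<i + 3} = {i, i + 1, i + 2}" "{i..<i + 4} = {i, i + 1, i + 2, i + 3}"
    by auto
  then show "seg x i (i + 3) = {x i, x (i + 1), x (i + 2)}"
    "seg x i (i + 4) = {x i, x (i + 1), x (i + 2), x (i + 3)}"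
    by simp_all
qed

text \<open>
  By \<open>noncommuting_triple\<close> the inequality \<open>x\<^sub>i x\<^sub>i\<^sub>+\<^sub>1 < x\<^sub>i\<^sub>+\<^sub>1 x\<^sub>i\<close> propagates along the chain. A Fibonacci
  quadruple cannot be continued in either direction: its two triples have different types, and neither type can
  occur at the place of the other in an adjacent quadruple.
\<close>

lemma noncommuting_chain_positive:
  assumes x: "chain x n" and n: "4 \<le> n" and tight: "tight (seg x 0 n)"
    and nc: "\<And>i. Suc i < n \<Longrightarrow> \<not> x i \<bowtie> x (Suc i)"
    and sign: "x 0 \<otimes> x 1 \<^bold>< x 1 \<otimes> x 0"
  shows "one_progression G R (seg x 0 n) \<or>
    n = 4 \<and> x 0 \<otimes> x 2 = x 1 \<otimes> x 0 \<and> x 2 \<otimes> x 0 = x 1 \<otimes> x 1 \<and>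
      x 1 \<otimes> x 3 = x 2 \<otimes> x 2 \<and> x 0 \<otimes> x 3 = x 1 \<otimes> x 1"
proof -
  have carr [simp]: "x i \<in> carrier G" if "i < n" for i
    using x that by (rule chain_carrier)
  have tight_win: "tight (seg x i j)" if "i + 2 \<le> j" "j \<le> n" for i j
  proof (rule tight_seg[OF x tight])
    have "x i \<in> seg x i j" "x (Suc i) \<in> seg x i j"
      using that by auto
    then show "\<not> commuting_set (seg x i j)"
      using nc[of i] that unfolding commuting_set_def by (metis Suc_le_lessD add_2_eq_Suc' le_trans)
  qed (use that in auto)
  have signs: "x i \<otimes> x (i + 1) \<^bold>< x (i + 1) \<otimes> x i" if "i + 1 < n" for i
    using that
  proof (induction i)
    case 0
    then show ?case using sign by simp
  next
    case (Suc i)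
    then have "tight {x i, x (i + 1), x (i + 2)}"
      using tight_win[of i "i + 3"] by (simp add: seg_three)
    then show ?case
      using noncommuting_triple(1)[of "x i" "x (i + 1)" "x (i + 2)"] Suc chain_lt[OF x] nc[of "i + 1"]
      by simp
  qed
  let ?bs = "\<lambda>i. x i \<otimes> x (i + 2) = x (i + 1) \<otimes> x i \<and> x (i + 2) \<otimes> x i = x (i + 1) \<otimes> x (i + 2)"
  let ?fib = "\<lambda>i. x i \<otimes> x (i + 2) = x (i + 1) \<otimes> x i \<and> x (i + 2) \<otimes> x i = x (i + 1) \<otimes> x (i + 1) \<and>
    x (i + 1) \<otimes> x (i + 3) = x (i + 2) \<otimes> x (i + 2) \<and> x i \<otimes> x (i + 3) = x (i + 1) \<otimes> x (i + 1)"
  have quad: "?bs i \<and> ?bs (i + 1) \<or> ?fib i" if "i + 3 < n" for i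
  proof -
    have "tight {x i, x (i + 1), x (i + 2), x (i + 3)}"
      using tight_win[of i "i + 4"] that by (simp add: seg_four)
    then show ?thesis
      using noncommuting_quadruple[of "x i" "x (i + 1)" "x (i + 2)" "x (i + 3)"] that chain_lt[OF x]
        nc[of "i + 1"] nc[of "i + 2"] signs[of i]
      by (simp add: numeral_3_eq_3)
  qed
  have ne: "x (i + 1) \<noteq> x i" if "i + 1 < n" for i
    using chain_neq[OF x, of i "i + 1"] that by simp
  have incompatible: "\<not> ?fib (i + 1)" "\<not> ?fib i" if "i + 4 < n" for i
  proof -
    have "x (i + 2) \<otimes> x (i + 2) \<noteq> x (i + 2) \<otimes> x (i + 1)" "x (i + 2) \<otimes> x (i + 3) \<noteq> x (i + 2) \<otimes> x (i + 2)"
      using ne[of "i + 1"] ne[of "i + 2"] that by (simp_all add: numeral_3_eq_3 numeral_2_eq_2)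
    then show "\<not> ?fib (i + 1)" "\<not> ?fib i"
      using quad[of i] quad[of "i + 1"] that by (auto simp: numeral_3_eq_3 numeral_2_eq_2)
  qed
  show ?thesis
  proof (cases "n = 4 \<and> ?fib 0")
    case True
    then show ?thesis
      by (simp add: eval_nat_numeral)
  next
    case False
    have all_bs: "?bs i \<and> ?bs (i + 1)" if "i + 3 < n" for i
    proof -
      have "\<not> ?fib i"
      proof (cases "i + 4 < n")
        case True
        then show ?thesis by (rule incompatible(2))
      next
        case last: False
        then show ?thesis
          using incompatible(1)[of "i - 1"] False that n by (cases "i = 0") auto
      qed
      then show ?thesis using quad[OF that] by blast
    qed
    have "one_progression G R (seg x 0 n)"
    proof (rule one_progression_from_relations[OF x])
      show "3 \<le> n" using n by simp
      show "x i \<otimes> x (i + 2) = x (i + 1) \<otimes> x i" if "i + 2 < n" for i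
        using all_bs[of i] all_bs[of "i - 1"] that n by (cases "i = 0") auto
      show "x 2 \<otimes> x 0 = x 1 \<otimes> x 2"
        using all_bs[of 0] n by (simp add: eval_nat_numeral)
    qed
    then show ?thesis by blast
  qed
qed

lemma conjugate_opposite:
  "a \<in> carrier G \<Longrightarrow> b \<in> carrier G \<Longrightarrow> conjugate (opposite G) a b = b \<otimes> a \<otimes> inv b"
  by (simp add: conjugate_def inv_opposite m_assoc)

lemma pow_opposite:
  assumes "a \<in> carrier G"
  shows "a [^]\<^bsub>opposite G\<^esub> (m::nat) = a [^] m"
proof (induction m)
  case 0
  then show ?case
    using group.is_monoid[OF group_opposite] by (simp add: monoid.nat_pow_0)
next
  case (Suc m)
  then show ?case
    using monoid.nat_pow_Suc[OF group.is_monoid[OF group_opposite], of a m] nat_pow_Suc2[OF assms, of m]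
    by (simp del: nat_pow_Suc)
qed

text \<open>
  A left progression \<open>{c\<^sup>m x}\<close> is the right progression \<open>{x e\<^sup>m}\<close> with \<open>e = c\<^sup>x\<close>, and
  \<open>xcx\<inverse> = c\<^sup>2\<close> becomes \<open>(e\<^sup>2)\<^sup>x = e\<close>.
\<close>

lemma one_progression_opposite:
  assumes "one_progression (opposite G) R S"
  shows "one_progression G R S"
proof -
  obtain x c where xc [simp]: "x \<in> carrier G" "c \<in> carrier G"
    and S: "S = {x \<otimes>\<^bsub>opposite G\<^esub> c [^]\<^bsub>opposite G\<^esub> m | m. m < card S}"
    and c1: "(\<one>, c) \<in> R - Id"
    and rel: "conjugate (opposite G) c x = c [^]\<^bsub>opposite G\<^esub> (2::nat) \<or>
      conjugate (opposite G) (c [^]\<^bsub>opposite G\<^esub> (2::nat)) x = c"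
    using assms unfolding one_progression_def by auto
  define e where "e = conjugate G c x"
  have e [simp]: "e \<in> carrier G"
    by (simp add: e_def)
  have cx: "c \<otimes> x = x \<otimes> e"
    unfolding e_def by (rule conjugate_eq) simp_all
  have "c [^] m \<otimes> x = x \<otimes> e [^] m" for m :: nat
  proof (induction m)
    case (Suc m)
    have "c [^] Suc m \<otimes> x = c [^] m \<otimes> x \<otimes> e"
      by (simp add: m_assoc cx)
    then show ?case by (simp add: Suc m_assoc)
  qed simp
  then have "S = {x \<otimes> e [^] m | m. m < card S}"
    using S by (simp add: pow_opposite)
  moreover have "(\<one>, e) \<in> R - Id"
  proof -
    have "inv x \<otimes> \<one> \<otimes> x \<^bold>< inv x \<otimes> c \<otimes> x"
      using c1 by (intro mult_left_mono mult_right_mono) (auto simp: lt_def)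
    then show ?thesis by (simp add: e_def conjugate_def lt_def)
  qed
  moreover have "conjugate G e x = e [^] (2::nat) \<or> conjugate G (e [^] (2::nat)) x = e"
    using rel
  proof
    assume "conjugate (opposite G) c x = c [^]\<^bsub>opposite G\<^esub> (2::nat)"
    then have "x \<otimes> c \<otimes> inv x \<otimes> x = c \<otimes> c \<otimes> x"
      by (simp add: conjugate_opposite pow_opposite numeral_2_eq_2)
    then have "x \<otimes> c = x \<otimes> (e \<otimes> e)"
      by (simp add: m_assoc cx) (simp add: cx flip: m_assoc)
    then have "c = e [^] (2::nat)"
      by (simp add: numeral_2_eq_2)
    then show ?thesis by (simp add: e_def)
  next
    assume "conjugate (opposite G) (c [^]\<^bsub>opposite G\<^esub> (2::nat)) x = c"
    then have "x \<otimes> (c \<otimes> c) \<otimes> inv x \<otimes> x = c \<otimes> x"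
      by (simp add: conjugate_opposite pow_opposite numeral_2_eq_2)
    then have "x \<otimes> (c \<otimes> c) = x \<otimes> e"
      by (simp add: m_assoc cx)
    then have "e = c \<otimes> c"
      by simp
    then have "conjugate G e x = e [^] (2::nat)"
      by (simp add: conjugate_mult e_def numeral_2_eq_2)
    then show ?thesis by simp
  qed
  ultimately show ?thesis
    unfolding one_progression_def using xc(1) e by blast
qed

lemma tight_opposite: "ordered_group.tight (opposite G) S \<longleftrightarrow> tight S"
  unfolding ordered_group.tight_def[OF ordered_group_opposite] tight_def commuting_set_opposite
    set_mult_opposite opposite_simps ..

lemma chain_opposite: "ordered_group.chain (opposite G) R x n \<longleftrightarrow> chain x n"
  unfolding ordered_group.chain_def[OF ordered_group_opposite] chain_def opposite_simps ..

text \<open>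
  The mirror images of the relations of a Fibonacci quadruple give its second form: with \<open>c = A\<inverse>B\<close> and
  \<open>x = A\<inverse>\<close>, the elements are \<open>x\<inverse>\<close>, \<open>x\<inverse>c\<close>, \<open>x\<inverse>u\<close>, \<open>x\<inverse>t\<close>, where \<open>u = c\<^sup>x\<close> and \<open>t = u\<^sup>x\<close>.
\<close>

lemma fibonacci_from_relations_opposite:
  assumes carr [simp]: "A \<in> carrier G" "B \<in> carrier G" "C \<in> carrier G" "D \<in> carrier G"
    and "A \<^bold>< B"
    and rel: "C \<otimes> A = A \<otimes> B" "A \<otimes> C = B \<otimes> B" "D \<otimes> B = C \<otimes> C" "D \<otimes> A = B \<otimes> B"
  shows "fibonacci_quadruple G R {A, B, C, D}"
proof -
  define c where "c = inv A \<otimes> B"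
  define u where "u = conjugate G c (inv A)"
  define t where "t = conjugate G u (inv A)"
  have carr' [simp]: "c \<in> carrier G" "u \<in> carrier G" "t \<in> carrier G"
    by (simp_all add: c_def u_def t_def)
  have Ac: "A \<otimes> c = u \<otimes> A" and Au: "A \<otimes> u = t \<otimes> A"
    by (simp_all add: u_def t_def conjugate_def m_assoc)
  have Ac': "A \<otimes> (c \<otimes> z) = u \<otimes> (A \<otimes> z)" and Au': "A \<otimes> (u \<otimes> z) = t \<otimes> (A \<otimes> z)"
    if "z \<in> carrier G" for z
    using that Ac Au by (simp_all flip: m_assoc)
  note norm = m_assoc Ac Au Ac' Au'
  have B: "B = u \<otimes> A"
    by (simp add: c_def flip: Ac)
  have "C \<otimes> A = t \<otimes> A \<otimes> A"
    using rel(1) by (simp add: B norm)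
  then have C: "C = t \<otimes> A"
    by simp
  have "D \<otimes> A = u \<otimes> t \<otimes> A \<otimes> A"
    using rel(4) by (simp add: B norm)
  then have D: "D = u \<otimes> t \<otimes> A"
    by simp
  have "A \<otimes> t \<otimes> A = u \<otimes> t \<otimes> A \<otimes> A"
    using rel(2) by (simp add: B C norm)
  then have "A \<otimes> t = u \<otimes> t \<otimes> A"
    by simp
  then have At: "A \<otimes> t = u \<otimes> (t \<otimes> A)"
    by (simp add: m_assoc)
  have At': "A \<otimes> (t \<otimes> z) = u \<otimes> (t \<otimes> (A \<otimes> z))" if "z \<in> carrier G" for z
    using that At by (simp add: m_assoc flip: m_assoc[of A t z])
  have "u \<otimes> t \<otimes> (t \<otimes> (A \<otimes> A)) = t \<otimes> u \<otimes> (t \<otimes> (A \<otimes> A))"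
    using rel(3) by (simp add: B C D norm At')
  then have comm: "u \<otimes> t = t \<otimes> u"
    by simp
  have "A \<otimes> t = A \<otimes> (c \<otimes> u)"
    by (simp add: norm At)
  then have t: "t = c \<otimes> u"
    by simp
  have "A \<otimes> (c \<otimes> u) = A \<otimes> (u \<otimes> c)"
    by (simp add: norm) (simp add: comm flip: m_assoc)
  then have cu: "c \<otimes> u = u \<otimes> c"
    by simp
  have "A \<otimes> \<one> \<^bold>< A \<otimes> c"
    using assms(5) by (simp add: c_def)
  then have "\<one> \<^bold>< c"
    using mult_left_mono_iff[of \<one> c A] by simp
  then have c1: "(\<one>, c) \<in> R - Id"
    by (simp add: lt_def)
  have conj: "conjugate G c (inv A) = u" "conjugate G c (inv A [^] (2::nat)) = t"
    by (simp_all add: conjugate_def numeral_2_eq_2 inv_mult_group m_assoc t_def u_def)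
  have set: "{A, B, C, D} = {inv (inv A), inv (inv A) \<otimes> c, inv (inv A) \<otimes> u, inv (inv A) \<otimes> t}"
    unfolding B C D by (simp add: Ac Au At m_assoc)
  show ?thesis
    unfolding fibonacci_quadruple_def
  proof (rule bexI[of _ "inv A"], rule bexI[of _ c], intro conjI disjI2)
    show "{A, B, C, D} = {inv (inv A), inv (inv A) \<otimes> c, inv (inv A) \<otimes> conjugate G c (inv A),
        inv (inv A) \<otimes> conjugate G c (inv A [^] (2::nat))}"
      unfolding conj by (rule set)
    show "conjugate G c (inv A [^] (2::nat)) = c \<otimes> conjugate G c (inv A)"
      "c \<otimes> conjugate G c (inv A) = conjugate G c (inv A) \<otimes> c"
      unfolding conj by (rule t, rule cu)
  qed (use c1 in auto)
qed

theorem noncommuting_chain: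
  assumes x: "chain x n" and n: "4 \<le> n" and tight: "tight (seg x 0 n)"
    and nc: "\<And>i. Suc i < n \<Longrightarrow> \<not> x i \<bowtie> x (Suc i)"
  shows "one_progression G R (seg x 0 n) \<or> n = 4 \<and> fibonacci_quadruple G R (seg x 0 n)"
proof -
  have carr: "x i \<in> carrier G" if "i < n" for i
    using x that by (rule chain_carrier)
  have four: "seg x 0 4 = {x 0, x 1, x 2, x 3}"
    using seg_four[of x 0] by (simp add: numeral_2_eq_2)
  have lt: "x 0 \<^bold>< x 1"
    using chain_lt[OF x, of 0 1] n by simp
  have "x 0 \<otimes> x 1 \<noteq> x 1 \<otimes> x 0"
    using nc[of 0] n by (simp add: commute_def)
  then consider "x 0 \<otimes> x 1 \<^bold>< x 1 \<otimes> x 0" | "x 1 \<otimes> x 0 \<^bold>< x 0 \<otimes> x 1"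
    using trichotomy[of "x 0 \<otimes> x 1" "x 1 \<otimes> x 0"] carr[of 0] carr[of 1] n by auto
  then show ?thesis
  proof cases
    case 1
    then have "one_progression G R (seg x 0 n) \<or>
      n = 4 \<and> x 0 \<otimes> x 2 = x 1 \<otimes> x 0 \<and> x 2 \<otimes> x 0 = x 1 \<otimes> x 1 \<and>
      x 1 \<otimes> x 3 = x 2 \<otimes> x 2 \<and> x 0 \<otimes> x 3 = x 1 \<otimes> x 1"
      by (intro noncommuting_chain_positive x n tight nc)
    then show ?thesis
    proof (elim disjE conjE)
      assume "n = 4" "x 0 \<otimes> x 2 = x 1 \<otimes> x 0" "x 2 \<otimes> x 0 = x 1 \<otimes> x 1"
        "x 1 \<otimes> x 3 = x 2 \<otimes> x 2" "x 0 \<otimes> x 3 = x 1 \<otimes> x 1"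
      then have "fibonacci_quadruple G R {x 0, x 1, x 2, x 3}"
        by (intro fibonacci_from_relations lt carr) auto
      then show ?thesis by (simp only: \<open>n = 4\<close> four simp_thms)
    qed (rule disjI1)
  next
    case 2
    then have "one_progression (opposite G) R (seg x 0 n) \<or>
      n = 4 \<and> x 2 \<otimes> x 0 = x 0 \<otimes> x 1 \<and> x 0 \<otimes> x 2 = x 1 \<otimes> x 1 \<and>
      x 3 \<otimes> x 1 = x 2 \<otimes> x 2 \<and> x 3 \<otimes> x 0 = x 1 \<otimes> x 1"
      by (intro ordered_group.noncommuting_chain_positive[OF ordered_group_opposite,
            unfolded chain_opposite tight_opposite commute_opposite opposite_simps] x n tight nc)
    then show ?thesis
    proof (elim disjE conjE)
      assume "n = 4" "x 2 \<otimes> x 0 = x 0 \<otimes> x 1" "x 0 \<otimes> x 2 = x 1 \<otimes> x 1"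
        "x 3 \<otimes> x 1 = x 2 \<otimes> x 2" "x 3 \<otimes> x 0 = x 1 \<otimes> x 1"
      then have "fibonacci_quadruple G R {x 0, x 1, x 2, x 3}"
        by (intro fibonacci_from_relations_opposite lt carr) auto
      then show ?thesis by (simp only: \<open>n = 4\<close> four simp_thms)
    qed (rule disjI1, rule one_progression_opposite)
  qed
qed

section \<open>A commuting step followed by two non-commuting steps\<close>

text \<open>
  By \<open>conjugate_two\<close>, either \<open>A\<close> commutes with \<open>C\<close> or \<open>B\<^sup>C = A\<close>. In the normal form with base \<open>B\<close>, where
  \<open>C = Bu\<close>, \<open>v = u\<^sup>B\<close> and \<open>w = v\<^sup>B\<close>, each of the three types of the triple \<open>B, C, D\<close> contradicts \<open>1 < u < v < w\<close>.
\<close>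

lemma no_commuting_then_noncommuting_positive:
  assumes tight: "tight {A, B, C, D}" and lt: "A \<^bold>< B" "B \<^bold>< C" "C \<^bold>< D"
    and comm: "A \<bowtie> B" and nc: "\<not> B \<bowtie> C" "\<not> C \<bowtie> D" and sign: "B \<otimes> C \<^bold>< C \<otimes> B"
  shows False
proof -
  have carr [simp]: "A \<in> carrier G" "B \<in> carrier G" "C \<in> carrier G" "D \<in> carrier G"
    using lt lt_carrier by auto
  note parts = tight_four_parts[OF tight lt nc(1)]
  note high = noncommuting_triple[OF parts(2) lt(2,3) nc(2) sign]
  have lts: "A \<otimes> A \<^bold>< A \<otimes> B" "A \<otimes> B \<^bold>< B \<otimes> B" "B \<otimes> B \<^bold>< B \<otimes> C" "A \<otimes> C \<^bold>< B \<otimes> C"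
    "C \<otimes> A \<^bold>< C \<otimes> B" "C \<otimes> B \<^bold>< C \<otimes> C" "C \<otimes> C \<^bold>< C \<otimes> D" "C \<otimes> C \<^bold>< D \<otimes> C"
    "A \<otimes> C \<^bold>< A \<otimes> D" "A \<otimes> D \<^bold>< B \<otimes> D" "C \<otimes> A \<^bold>< D \<otimes> A" "D \<otimes> A \<^bold>< D \<otimes> B"
    "A \<otimes> B \<^bold>< A \<otimes> C" "B \<otimes> A \<^bold>< C \<otimes> A" "C \<otimes> D \<^bold>< D \<otimes> D" "D \<otimes> C \<^bold>< D \<otimes> D"
    using lt by (auto intro: mult_left_mono mult_right_mono)
  have AB: "A \<otimes> B = B \<otimes> A"
    using comm by (simp add: commute_def)
  define u where "u = inv B \<otimes> C"
  define v where "v = conjugate G u B"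
  define w where "w = conjugate G v B"
  have carr' [simp]: "u \<in> carrier G" "v \<in> carrier G" "w \<in> carrier G"
    by (simp_all add: u_def v_def w_def)
  have C: "C = B \<otimes> u"
    by (simp add: u_def)
  have uB: "u \<otimes> B = B \<otimes> v" and vB: "v \<otimes> B = B \<otimes> w"
    by (auto simp: v_def w_def intro!: conjugate_eq)
  have uB': "u \<otimes> (B \<otimes> z) = B \<otimes> (v \<otimes> z)" and vB': "v \<otimes> (B \<otimes> z) = B \<otimes> (w \<otimes> z)"
    if "z \<in> carrier G" for z
    using that uB vB by (simp_all flip: m_assoc)
  note norm = m_assoc uB vB uB' vB'
  have "B \<otimes> \<one> \<^bold>< B \<otimes> u"
    using lt(2) C by simp
  then have u1: "\<one> \<^bold>< u"
    using mult_left_mono_iff[of \<one> u B] by simp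
  have "B \<otimes> (B \<otimes> u) \<^bold>< B \<otimes> (B \<otimes> v)"
    using sign by (simp add: C norm)
  then have uv: "u \<^bold>< v"
    by (simp add: mult_left_mono_iff)
  have "u \<otimes> B \<^bold>< v \<otimes> B"
    using uv by (intro mult_right_mono) auto
  then have vw: "v \<^bold>< w"
    using mult_left_mono_iff[of v w B] by (simp add: uB vB)
  have ne: "u \<noteq> v" "v \<noteq> u" "u \<noteq> \<one>" "v \<noteq> \<one>" "v \<noteq> w" "w \<noteq> v"
    using u1 uv vw by order+
  have "B \<otimes> D \<^bold>\<le> C \<otimes> C"
    using high(2) lts by (auto simp: le_def)
  have S: "{A, B, C, D} <#> {A, B, C, D} = ({A, B, C} <#> {A, B, C}) \<union> {D \<otimes> D, D \<otimes> C, C \<otimes> D}"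
    using noncommuting_top_square[OF tight parts(5,3), of C] greatest_in_three[OF lt(1,2)] nc(2)
    by (simp add: parts(4) commute_sym)
  have T: "{A, B, C} <#> {A, B, C} =
    {A \<otimes> A, A \<otimes> B, B \<otimes> B, A \<otimes> C, C \<otimes> A, B \<otimes> C, C \<otimes> B, C \<otimes> C}"
    using AB by (auto simp: set_mult_def)
  have types: "B \<otimes> D = C \<otimes> B \<and> D \<otimes> B = C \<otimes> C \<or> B \<otimes> D = C \<otimes> B \<and> D \<otimes> B = C \<otimes> D \<or>
      B \<otimes> D = C \<otimes> C \<and> D \<otimes> B = C \<otimes> D"
    by (rule high(2))
  have F1: "D = B \<otimes> v \<and> w = v \<otimes> u" if "B \<otimes> D = C \<otimes> B" "D \<otimes> B = C \<otimes> C"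
  proof -
    have D: "D = B \<otimes> v"
      using that(1) by (simp add: C norm)
    then show ?thesis
      using that(2) by (simp add: C norm)
  qed
  have BS: "D = B \<otimes> v \<and> w = v \<otimes> v \<and> v = u \<otimes> u" if "B \<otimes> D = C \<otimes> B" "D \<otimes> B = C \<otimes> D"
  proof -
    have D: "D = B \<otimes> v"
      using that(1) by (simp add: C norm)
    then have w: "w = v \<otimes> v"
      using that(2) by (simp add: C norm)
    then have "v \<otimes> B = u \<otimes> u \<otimes> B"
      by (simp add: norm)
    then show ?thesis using D w by simp
  qed
  have F2: "D = B \<otimes> (v \<otimes> u) \<and> w \<otimes> v = v \<otimes> (v \<otimes> u)" if "B \<otimes> D = C \<otimes> C" "D \<otimes> B = C \<otimes> D"
  proof -
    have D: "D = B \<otimes> (v \<otimes> u)"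
      using that(1) by (simp add: C norm)
    then show ?thesis
      using that(2) by (simp add: C norm)
  qed
  have "A \<bowtie> C \<or> B \<bowtie> C \<or> A \<otimes> C = C \<otimes> B \<or> B \<otimes> C = C \<otimes> A"
    using parts(1) comm lt(1) by (intro conjugate_two) (auto simp: insert_commute)
  moreover have "A \<otimes> C \<noteq> C \<otimes> B"
    using lts sign by (metis ord.less_trans ord.less_irrefl)
  ultimately consider (central) "A \<bowtie> C" | (conj) "B \<otimes> C = C \<otimes> A"
    using nc(1) by blast
  then show False
  proof cases
    case conj
    have A: "u \<otimes> A = B \<otimes> u"
      using conj by (simp add: C norm)
    have "B \<otimes> (v \<otimes> A) = B \<otimes> (B \<otimes> v)"
    proof -
      have "B \<otimes> (v \<otimes> A) = u \<otimes> (A \<otimes> B)"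
        by (simp add: AB uB')
      also have "\<dots> = B \<otimes> u \<otimes> B"
        by (simp add: A flip: m_assoc)
      finally show ?thesis by (simp add: norm)
    qed
    then have vA: "v \<otimes> A = B \<otimes> v"
      by simp
    have "B \<otimes> (w \<otimes> A) = B \<otimes> (B \<otimes> w)"
    proof -
      have "B \<otimes> (w \<otimes> A) = v \<otimes> (A \<otimes> B)"
        by (simp add: AB vB')
      also have "\<dots> = B \<otimes> v \<otimes> B"
        by (simp add: vA flip: m_assoc)
      finally show ?thesis by (simp add: norm)
    qed
    then have wA: "w \<otimes> A = B \<otimes> w"
      by simp
    \<comment> \<open>As \<open>A\<close> commutes with \<open>B\<close>, conjugation by \<open>B\<close> has turned \<open>uA = Bu\<close> into \<open>vA = Bv\<close> and \<open>wA = Bw\<close>.\<close>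
    from types show False
    proof (elim disjE conjE)
      assume "B \<otimes> D = C \<otimes> B" "D \<otimes> B = C \<otimes> C"
      then have w: "w = v \<otimes> u"
        using F1 by blast
      have "B \<otimes> (v \<otimes> u \<otimes> u) = B \<otimes> (v \<otimes> u)"
        using wA by (simp add: w norm A)
      then show False using ne by (simp add: m_assoc)
    next
      assume "B \<otimes> D = C \<otimes> B" "D \<otimes> B = C \<otimes> D"
      then have v: "v = u \<otimes> u"
        using BS by blast
      have "u \<otimes> (u \<otimes> A) = B \<otimes> v"
        using vA by (simp add: v m_assoc)
      then have "B \<otimes> (v \<otimes> u) = B \<otimes> v"
        by (simp add: A uB')
      then show False using ne by simp
    next
      assume eq: "B \<otimes> D = C \<otimes> C" "D \<otimes> B = C \<otimes> D"
      have D: "D = B \<otimes> (v \<otimes> u)"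
        using F2[OF eq] by blast
      have DA: "D \<otimes> A = B \<otimes> (B \<otimes> (w \<otimes> u))"
        by (simp add: D norm A)
      have "D \<otimes> A \<noteq> A \<otimes> A" "D \<otimes> A \<noteq> A \<otimes> B" "D \<otimes> A \<noteq> C \<otimes> A" "D \<otimes> A \<noteq> A \<otimes> C" "D \<otimes> A \<noteq> B \<otimes> C"
        "D \<otimes> A \<noteq> C \<otimes> D" "D \<otimes> A \<noteq> D \<otimes> C" "D \<otimes> A \<noteq> D \<otimes> D"
        using lts conj AB eq(2) lt(2,3) mult_left_mono[OF lt(2), of D] by (metis carr(4) ord.less_trans ord.less_irrefl)+
      moreover have "D \<otimes> A \<in> {A, B, C, D} <#> {A, B, C, D}"
        by (auto simp: mem_set_mult)
      ultimately consider "D \<otimes> A = B \<otimes> B" | "D \<otimes> A = C \<otimes> B" | "D \<otimes> A = C \<otimes> C"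
        unfolding S T by blast
      then show False
      proof cases
        case 1
        then have "w \<otimes> u = \<one>"
          unfolding DA by simp
        moreover have "\<one> \<^bold>< w \<otimes> u"
          using mult_strict_mono[of \<one> w \<one> u] u1 uv vw by (auto intro: ord.less_trans)
        ultimately show False by simp
      next
        case 2
        then have "w \<otimes> u = v"
          unfolding DA by (simp add: C norm)
        moreover have "v \<otimes> \<one> \<^bold>< w \<otimes> u"
          by (intro mult_strict_mono vw u1)
        ultimately show False by simp
      next
        case 3
        then have "w = v"
          unfolding DA by (simp add: C norm)
        then show False using ne by simp
      qed
    qed
  next
    case central
    have AC: "A \<otimes> C = C \<otimes> A"
      using central by (simp add: commute_def)
    have "A \<bowtie> u"
      using commute_right_factor[of A B u] central comm by (simp add: C)
    have "A \<bowtie> C \<otimes> B" "A \<bowtie> C \<otimes> C"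
      using central comm by (auto intro: commute_mult)
    then have "A \<bowtie> B \<otimes> D"
      using high(2) by auto
    then have "A \<bowtie> D"
      using commute_right_factor[of A B D] comm by simp
    have "A \<bowtie> B \<otimes> v"
      unfolding uB[symmetric] using \<open>A \<bowtie> u\<close> comm by (intro commute_mult) auto
    then have "A \<bowtie> v"
      using commute_right_factor[of A B v] comm by simp
    then have "A \<bowtie> B \<otimes> w"
      unfolding vB[symmetric] using comm by (intro commute_mult) auto
    then have "A \<bowtie> w"
      using commute_right_factor[of A B w] comm by simp
    have Av: "v \<otimes> A = A \<otimes> v" and Aw: "w \<otimes> A = A \<otimes> w" and Au: "u \<otimes> A = A \<otimes> u"
      using \<open>A \<bowtie> u\<close> \<open>A \<bowtie> v\<close> \<open>A \<bowtie> w\<close> by (simp_all add: commute_def)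
    have A_left: "B \<otimes> (A \<otimes> z) = A \<otimes> (B \<otimes> z)" "u \<otimes> (A \<otimes> z) = A \<otimes> (u \<otimes> z)" "v \<otimes> (A \<otimes> z) = A \<otimes> (v \<otimes> z)"
      "w \<otimes> (A \<otimes> z) = A \<otimes> (w \<otimes> z)" if "z \<in> carrier G" for z
      using that AB Au Av Aw by (simp_all flip: m_assoc)
    have "A \<otimes> D \<^bold>< C \<otimes> C"
      using lts \<open>B \<otimes> D \<^bold>\<le> C \<otimes> C\<close> by (auto intro: ord.less_le_trans)
    then have "A \<otimes> D \<noteq> A \<otimes> A" "A \<otimes> D \<noteq> A \<otimes> B" "A \<otimes> D \<noteq> A \<otimes> C" "A \<otimes> D \<noteq> C \<otimes> A" "A \<otimes> D \<noteq> C \<otimes> C"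
      "A \<otimes> D \<noteq> C \<otimes> D" "A \<otimes> D \<noteq> D \<otimes> C" "A \<otimes> D \<noteq> D \<otimes> D"
      using lts AC by (metis ord.less_trans ord.less_irrefl)+
    moreover have "A \<otimes> D \<in> {A, B, C, D} <#> {A, B, C, D}"
      by (auto simp: mem_set_mult)
    ultimately consider "A \<otimes> D = B \<otimes> B" | "A \<otimes> D = B \<otimes> C" | "A \<otimes> D = C \<otimes> B"
      unfolding S T by blast
    then show False
    proof cases
      case 1
      then have "B \<bowtie> A \<otimes> D"
        by (auto intro: commute_mult)
      then have "B \<bowtie> D"
        using commute_right_factor[of B A D] comm by (simp add: commute_sym)
      then have "B \<bowtie> C \<otimes> B \<or> B \<bowtie> C \<otimes> C"
        using high(2) commute_mult[of B B D] by auto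
      then show False
        using commute_square[of B C] commute_left_factor[of B C B] nc(1) by auto
    next
      case 2
      from types show False
      proof (elim disjE conjE)
        assume "B \<otimes> D = C \<otimes> B" "D \<otimes> B = C \<otimes> C"
        then have D: "D = B \<otimes> v" and w: "w = v \<otimes> u"
          using F1 by blast+
        have "B \<otimes> (A \<otimes> v) = B \<otimes> (B \<otimes> u)"
          using 2 by (simp add: D C A_left)
        then have Av_eq: "A \<otimes> v = B \<otimes> u"
          by simp
        then have "A \<otimes> v \<otimes> B = B \<otimes> u \<otimes> B"
          by simp
        then have "B \<otimes> (A \<otimes> w) = B \<otimes> (B \<otimes> v)"
          by (simp add: norm A_left)
        then have "A \<otimes> v \<otimes> u = B \<otimes> v"
          by (simp add: w m_assoc)
        then have v: "v = u \<otimes> u"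
          by (simp add: Av_eq m_assoc)
        then have "v \<otimes> B = u \<otimes> u \<otimes> B"
          by simp
        then have "w = v \<otimes> v"
          by (simp add: norm)
        then show False using w ne by simp
      next
        assume "B \<otimes> D = C \<otimes> B" "D \<otimes> B = C \<otimes> D"
        then have D: "D = B \<otimes> v" and v: "v = u \<otimes> u"
          using BS by blast+
        have "B \<otimes> (A \<otimes> v) = B \<otimes> (B \<otimes> u)"
          using 2 by (simp add: D C A_left)
        then have "A \<otimes> u \<otimes> u = B \<otimes> u"
          by (simp add: v m_assoc)
        then have "A \<otimes> u = B"
          by simp
        then have "B \<bowtie> A \<otimes> u"
          by simp
        then have "B \<bowtie> u"
          using commute_right_factor[of B A u] comm by (simp add: commute_sym)
        then show False
          using commute_mult[of B B u] nc(1) by (simp add: C)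
      next
        assume "B \<otimes> D = C \<otimes> C" "D \<otimes> B = C \<otimes> D"
        then have D: "D = B \<otimes> (v \<otimes> u)"
          using F2 by blast
        have "B \<otimes> (A \<otimes> v \<otimes> u) = B \<otimes> (B \<otimes> u)"
          using 2 by (simp add: D C A_left m_assoc)
        then have "A \<otimes> v \<otimes> u = B \<otimes> u"
          by simp
        then have "A \<otimes> v = B"
          by simp
        then have "B \<bowtie> A \<otimes> v"
          by simp
        then have "B \<bowtie> v"
          using commute_right_factor[of B A v] comm by (simp add: commute_sym)
        then have "B \<otimes> v = B \<otimes> w"
          using vB by (simp add: commute_def)
        then show False
          using ne by simp
      qed
    next
      case 3
      from types show False
      proof (elim disjE conjE)
        assume "B \<otimes> D = C \<otimes> B"
        then have "A \<otimes> D = B \<otimes> D"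
          using 3 by simp
        then show False using lt(1) by auto
      next
        assume "B \<otimes> D = C \<otimes> B"
        then have "A \<otimes> D = B \<otimes> D"
          using 3 by simp
        then show False using lt(1) by auto
      next
        assume "B \<otimes> D = C \<otimes> C" "D \<otimes> B = C \<otimes> D"
        then have D: "D = B \<otimes> (v \<otimes> u)" and w: "w \<otimes> v = v \<otimes> (v \<otimes> u)"
          using F2 by blast+
        have "B \<otimes> (A \<otimes> (v \<otimes> u)) = B \<otimes> (B \<otimes> v)"
          using 3 by (simp add: D C A_left norm)
        then have e: "A \<otimes> (v \<otimes> u) = B \<otimes> v"
          by simp
        then have "A \<otimes> (v \<otimes> u) \<otimes> B = B \<otimes> v \<otimes> B"
          by simp
        then have "B \<otimes> (A \<otimes> (w \<otimes> v)) = B \<otimes> (B \<otimes> w)"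
          by (simp add: norm A_left)
        then have "A \<otimes> (w \<otimes> v) = B \<otimes> w"
          by simp
        moreover have "A \<otimes> (v \<otimes> (v \<otimes> u)) = B \<otimes> (w \<otimes> v)"
        proof -
          have "A \<otimes> (v \<otimes> (v \<otimes> u)) = v \<otimes> (A \<otimes> (v \<otimes> u))"
            by (simp add: A_left)
          also have "\<dots> = B \<otimes> (w \<otimes> v)"
            unfolding e by (simp add: vB')
          finally show ?thesis .
        qed
        ultimately have "B \<otimes> (w \<otimes> v) = B \<otimes> w"
          by (simp add: w)
        then show False using ne by simp
      qed
    qed
  qed
qed

lemma no_commuting_then_noncommuting:
  assumes tight: "tight {A, B, C, D}" and lt: "A \<^bold>< B" "B \<^bold>< C" "C \<^bold>< D"
    and comm: "A \<bowtie> B" and nc: "\<not> B \<bowtie> C" "\<not> C \<bowtie> D"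
  shows False
proof -
  have "B \<in> carrier G" "C \<in> carrier G" "B \<otimes> C \<noteq> C \<otimes> B"
    using lt lt_carrier nc(1) by (auto simp: commute_def)
  then consider "B \<otimes> C \<^bold>< C \<otimes> B" | "C \<otimes> B \<^bold>< B \<otimes> C"
    using trichotomy[of "B \<otimes> C" "C \<otimes> B"] by auto
  then show False
  proof cases
    case 1
    then show False
      using no_commuting_then_noncommuting_positive assms by blast
  next
    case 2
    then show False
      by (rule ordered_group.no_commuting_then_noncommuting_positive[OF ordered_group_opposite,
            unfolded tight_opposite commute_opposite opposite_simps, OF assms])
  qed
qed

lemma no_noncommuting_then_commuting:
  assumes tight: "tight {A, B, C, D}" and lt: "A \<^bold>< B" "B \<^bold>< C" "C \<^bold>< D"
    and nc: "\<not> A \<bowtie> B" "\<not> B \<bowtie> C" and comm: "C \<bowtie> D"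
  shows False
proof -
  have "{D, C, B, A} = {A, B, C, D}" by auto
  then show False
    using ordered_group.no_commuting_then_noncommuting[OF ordered_group_converse, of D C B A] assms
    by (simp add: lt_converse commute_sym)
qed

section \<open>Two commuting blocks\<close>

text \<open>
  The new products are \<open>D\<^sup>2\<close>, \<open>DC\<close> and \<open>DB\<close>, so \<open>DA < DB\<close> is an old one, and \<open>C\<close> commutes with it. Most old products
  above \<open>CA\<close> do not commute with \<open>C\<close>; the exception \<open>DA = C\<^sup>2\<close> is excluded by the commutation with \<open>B\<close> or by an
  inequality.
\<close>

lemma no_central_mixture:
  assumes tight: "tight {A, B, C, D}" and lt: "A \<^bold>< B" "B \<^bold>< C" "C \<^bold>< D"
    and comm: "A \<bowtie> B" "C \<bowtie> D" and nc: "\<not> B \<bowtie> C" and sign: "B \<otimes> C \<^bold>< C \<otimes> B"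
    and AC: "A \<bowtie> C" and D: "D \<bowtie> B \<or> C \<otimes> B = B \<otimes> D"
  shows False
proof -
  have carr [simp]: "A \<in> carrier G" "B \<in> carrier G" "C \<in> carrier G" "D \<in> carrier G"
    using lt lt_carrier by auto
  note parts = tight_four_parts[OF tight lt nc]
  let ?S = "{A, B, C, D}" and ?T = "{A, B, C}"
  have eqs: "A \<otimes> B = B \<otimes> A" "C \<otimes> D = D \<otimes> C" "A \<otimes> C = C \<otimes> A"
    using comm AC by (simp_all add: commute_def)
  have lts: "A \<otimes> A \<^bold>< A \<otimes> B" "A \<otimes> B \<^bold>< B \<otimes> B" "B \<otimes> B \<^bold>< B \<otimes> C" "A \<otimes> C \<^bold>< B \<otimes> C"
    "C \<otimes> B \<^bold>< C \<otimes> C" "A \<otimes> B \<^bold>< A \<otimes> C" "C \<otimes> A \<^bold>< D \<otimes> A" "C \<otimes> B \<^bold>< D \<otimes> B"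
    "D \<otimes> A \<^bold>< D \<otimes> B" "D \<otimes> B \<^bold>< D \<otimes> C" "D \<otimes> C \<^bold>< D \<otimes> D"
    using lt by (auto intro: mult_left_mono mult_right_mono)
  have CCnc: "\<not> B \<bowtie> C \<otimes> C"
    using commute_square[of B C] nc by auto
  have T: "?T <#> ?T = {A \<otimes> A, A \<otimes> B, B \<otimes> B, A \<otimes> C, B \<otimes> C, C \<otimes> B, C \<otimes> C}"
    using eqs by (auto simp: set_mult_def)
  have "D \<otimes> B \<noteq> C \<otimes> C"
  proof
    assume "D \<otimes> B = C \<otimes> C"
    then have "C \<bowtie> D \<otimes> B"
      using commute_mult[of C C C] by simp
    then show False
      using commute_right_factor[of C D B] comm nc by (auto simp: commute_sym)
  qed
  then have new: "D \<otimes> B \<notin> ?T <#> ?T"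
    using lts sign unfolding T by (auto dest: ord.less_trans)
  have C: "greatest_in (?S - {D}) C"
    using greatest_in_three[OF lt(1,2)] parts(4) by simp
  have sub: "?S \<subseteq> carrier G" by simp
  note new' = new_products[OF sub parts(5) C, unfolded parts(4)]
  have S: "?S <#> ?S = (?T <#> ?T) \<union> {D \<otimes> D, D \<otimes> C, D \<otimes> B}"
  proof (rule card_subset_eq[symmetric])
    have "D \<otimes> B \<noteq> D \<otimes> C" "D \<otimes> B \<noteq> D \<otimes> D"
      using lts by order+
    then have "card ((?T <#> ?T) \<union> {D \<otimes> D, D \<otimes> C, D \<otimes> B}) = card (?T <#> ?T) + 3"
      using new new' by (subst card_Un_disjoint) (auto simp: finite_set_mult)
    then show "card ((?T <#> ?T) \<union> {D \<otimes> D, D \<otimes> C, D \<otimes> B}) = card (?S <#> ?S)"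
      using tight_remove_greatest(2)[OF tight parts(5,3)] parts(4) by simp
    show "(?T <#> ?T) \<union> {D \<otimes> D, D \<otimes> C, D \<otimes> B} \<subseteq> ?S <#> ?S"
      by (intro Un_least set_mult_mono) (auto simp: mem_set_mult)
  qed (simp add: finite_set_mult)
  have "D \<otimes> A \<noteq> A \<otimes> A" "D \<otimes> A \<noteq> A \<otimes> B" "D \<otimes> A \<noteq> A \<otimes> C" "D \<otimes> A \<noteq> D \<otimes> D"
    "D \<otimes> A \<noteq> D \<otimes> C" "D \<otimes> A \<noteq> D \<otimes> B"
    using lts eqs(3) by (metis ord.less_trans ord.less_irrefl)+
  moreover have "D \<otimes> A \<in> ?S <#> ?S"
    by (auto simp: mem_set_mult)
  ultimately consider "D \<otimes> A = B \<otimes> B" | "D \<otimes> A = B \<otimes> C" | "D \<otimes> A = C \<otimes> B" | "D \<otimes> A = C \<otimes> C"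
    unfolding S T by blast
  moreover have CDA: "C \<bowtie> D \<otimes> A"
    using comm AC by (intro commute_mult) (auto simp: commute_sym)
  ultimately show False
  proof cases
    case 1
    then have "C \<bowtie> B"
      using CDA by (auto intro: commute_square)
    then show False using nc by (simp add: commute_sym)
  next
    case 2
    then have "C \<bowtie> B"
      using CDA commute_left_factor[of C B C] by simp
    then show False using nc by (simp add: commute_sym)
  next
    case 3
    then have "C \<bowtie> B"
      using CDA commute_right_factor[of C C B] by simp
    then show False using nc by (simp add: commute_sym)
  next
    case 4
    from D show False
    proof
      assume "D \<bowtie> B"
      then have "B \<bowtie> D \<otimes> A"
        using comm by (intro commute_mult) (auto simp: commute_sym)
      then show False using 4 CCnc by simp
    next
      assume BD: "C \<otimes> B = B \<otimes> D"
      have "A \<otimes> (C \<otimes> C) \<^bold>< B \<otimes> (C \<otimes> C)"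
        using lt(1) by (intro mult_right_mono) auto
      moreover have "B \<otimes> (C \<otimes> C) = C \<otimes> (A \<otimes> B)"
      proof -
        have "B \<otimes> (C \<otimes> C) = C \<otimes> B \<otimes> A"
          unfolding BD using 4 by (simp add: m_assoc)
        then show ?thesis by (simp add: eqs(1) m_assoc)
      qed
      moreover have "C \<otimes> (A \<otimes> B) \<^bold>< C \<otimes> (A \<otimes> C)"
        using lt(2) by (intro mult_left_mono) auto
      moreover have "C \<otimes> (A \<otimes> C) = A \<otimes> (C \<otimes> C)"
        by (simp add: eqs(3)[symmetric] flip: m_assoc)
      ultimately show False
        by (metis ord.less_trans ord.less_irrefl)
    qed
  qed
qed

lemma two_pairs_positive:
  assumes tight: "tight {A, B, C, D}" and lt: "A \<^bold>< B" "B \<^bold>< C" "C \<^bold>< D"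
    and comm: "A \<bowtie> B" "C \<bowtie> D" and nc: "\<not> B \<bowtie> C" and sign: "B \<otimes> C \<^bold>< C \<otimes> B"
  shows "B \<otimes> C = C \<otimes> A" "C \<otimes> B = B \<otimes> D"
proof -
  have carr [simp]: "A \<in> carrier G" "B \<in> carrier G" "C \<in> carrier G" "D \<in> carrier G"
    using lt lt_carrier by auto
  note parts = tight_four_parts[OF tight lt nc]
  have "A \<otimes> C \<^bold>< B \<otimes> C" "C \<otimes> B \<^bold>< D \<otimes> B"
    using lt by (auto intro: mult_right_mono)
  then have ne: "A \<otimes> C \<noteq> C \<otimes> B" "D \<otimes> B \<noteq> B \<otimes> C"
    using sign by (metis ord.less_trans ord.less_irrefl)+
  have "A \<bowtie> C \<or> B \<bowtie> C \<or> A \<otimes> C = C \<otimes> B \<or> B \<otimes> C = C \<otimes> A"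
    using parts(1) comm lt(1) by (intro conjugate_two) (auto simp: insert_commute)
  then have low: "A \<bowtie> C \<or> B \<otimes> C = C \<otimes> A"
    using ne nc by blast
  have "C \<bowtie> B \<or> D \<bowtie> B \<or> C \<otimes> B = B \<otimes> D \<or> D \<otimes> B = B \<otimes> C"
    using parts(2) comm lt(3) by (intro conjugate_two) (auto simp: insert_commute)
  then have high: "D \<bowtie> B \<or> C \<otimes> B = B \<otimes> D"
    using ne nc by (auto simp: commute_sym)
  have "\<not> A \<bowtie> C"
    using no_central_mixture[OF assms _ high] by blast
  moreover have "\<not> D \<bowtie> B"
  proof
    assume "D \<bowtie> B"
    moreover have "{D, C, B, A} = {A, B, C, D}" by auto
    ultimately show False
      using ordered_group.no_central_mixture[OF ordered_group_converse, unfolded lt_converse, of D C B A]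
        assms low by (simp add: commute_sym)
  qed
  ultimately show "B \<otimes> C = C \<otimes> A" "C \<otimes> B = B \<otimes> D"
    using low high by blast+
qed

lemma two_pairs:
  assumes tight: "tight {A, B, C, D}" and lt: "A \<^bold>< B" "B \<^bold>< C" "C \<^bold>< D"
    and comm: "A \<bowtie> B" "C \<bowtie> D" and nc: "\<not> B \<bowtie> C"
  shows "B \<otimes> C = C \<otimes> A \<and> C \<otimes> B = B \<otimes> D \<or> C \<otimes> B = A \<otimes> C \<and> B \<otimes> C = D \<otimes> B"
proof -
  have "B \<in> carrier G" "C \<in> carrier G" "B \<otimes> C \<noteq> C \<otimes> B"
    using lt lt_carrier nc(1) by (auto simp: commute_def)
  then consider "B \<otimes> C \<^bold>< C \<otimes> B" | "C \<otimes> B \<^bold>< B \<otimes> C"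
    using trichotomy[of "B \<otimes> C" "C \<otimes> B"] by auto
  then show ?thesis
  proof cases
    case 1
    then show ?thesis using two_pairs_positive assms by blast
  next
    case 2
    then show ?thesis
      using ordered_group.two_pairs_positive[OF ordered_group_opposite,
          unfolded tight_opposite commute_opposite opposite_simps, OF assms 2] by blast
  qed
qed

lemma seg_shift: "seg (\<lambda>k. x (i + k)) a b = seg x (i + a) (i + b)"
proof -
  have "{i + a..<i + b} = (+) i ` {a..<b}"
    by (simp add: add.commute)
  then show ?thesis by (simp only: image_image)
qed

lemma chain_shift: "chain x n \<Longrightarrow> i + m \<le> n \<Longrightarrow> chain (\<lambda>k. x (i + k)) m"
  by (simp add: chain_def)

lemma seg_insert_last: "i \<le> j \<Longrightarrow> seg x i (Suc j) = insert (x j) (seg x i j)"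
  by (simp add: atLeastLessThanSuc)

lemma seg_insert_first: "i < j \<Longrightarrow> seg x i j = insert (x i) (seg x (Suc i) j)"
proof -
  assume "i < j"
  then have "{i..<j} = insert i {Suc i..<j}" by auto
  then show ?thesis by simp
qed

lemma progression_from_tight:
  assumes x: "chain x n" and comm: "commuting_set (seg x 0 n)" and n: "2 \<le> n"
    and tight: "tight (insert y (seg x 0 n))"
  shows "progression x (inv (x 0) \<otimes> x 1) n"
proof -
  have y: "\<not> commuting_set (insert y (seg x 0 n))"
    using tight by (auto simp: tight_def)
  then have "y \<notin> seg x 0 n"
    using comm by (metis insert_absorb)
  then have "card (seg x 0 n <#> seg x 0 n) + 1 = 2 * card (seg x 0 n)"
    using n by (intro tight_insert(1)[OF tight comm]) auto
  then show ?thesis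
    using card_seg[OF x, of n 0] n by (intro progression_from_square[OF x comm]) auto
qed

lemma commutator_eq_one:
  assumes [simp]: "a \<in> carrier G" "b \<in> carrier G" and "a \<bowtie> b"
  shows "commutator G a b = \<one>"
proof -
  have "commutator G a b = inv a \<otimes> (inv b \<otimes> (a \<otimes> b))"
    by (simp add: commutator_def m_assoc)
  also have "\<dots> = \<one>"
    unfolding assms(3)[unfolded commute_def] by simp
  finally show ?thesis .
qed

lemma progression_seg:
  assumes "progression x d n" "0 < n"
  shows "seg x 0 n = {x 0 \<otimes> d [^] m | m. m \<le> n - 1}"
proof -
  have "seg x 0 n = (\<lambda>m. x 0 \<otimes> d [^] m) ` {0..<n}"
  proof (rule image_cong[OF refl])
    fix m assume "m \<in> {0..<n}"
    then show "x m = x 0 \<otimes> d [^] m"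
      using progression_nth[OF assms(1), of 0 m] by simp
  qed
  then show ?thesis
    using assms(2) by auto
qed

text \<open>
  The two blocks are progressions with ratios \<open>d\<close> and \<open>e\<close>. The four elements around the boundary
  give \<open>BC = CBd\<inverse>\<close> and \<open>CB = BCe\<close>, or the mirror image, whence \<open>d = e\<close> is central.
\<close>

lemma two_commuting_blocks:
  assumes x: "chain x n" and tight: "tight (seg x 0 n)" and j: "2 \<le> j" "j + 2 \<le> n"
    and low: "commuting_set (seg x 0 j)" and high: "commuting_set (seg x j n)"
    and nc: "\<not> x (j - 1) \<bowtie> x j"
  shows "two_progressions G R (seg x 0 n)"
proof -
  have carr [simp]: "x i \<in> carrier G" if "i < n" for i
    using x that by (rule chain_carrier)
  define d where "d = inv (x 0) \<otimes> x 1"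
  define e where "e = inv (x j) \<otimes> x (j + 1)"
  define z where "z = (\<lambda>k. x (j + k))"
  have z_seg: "seg z 0 (n - j) = seg x j n"
    unfolding z_def using seg_shift[of x j 0 "n - j"] j by simp
  have nonc: "\<not> commuting_set (seg x i k)" if "i < j" "j < k" for i k
  proof -
    have "j - 1 \<in> {i..<k}" "j \<in> {i..<k}"
      unfolding atLeastLessThan_iff using that by linarith+
    then have "x (j - 1) \<in> seg x i k" "x j \<in> seg x i k"
      by blast+
    then show ?thesis
      using nc unfolding commuting_set_def by blast
  qed
  have "tight (insert (x j) (seg x 0 j))"
    using tight_seg[OF x tight, of 0 "Suc j"] nonc[of 0 "Suc j"] j by (simp add: seg_insert_last)
  then have d: "progression x d j"
    unfolding d_def using chain_mono[OF x, of j] low j by (intro progression_from_tight) auto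
  have "tight (insert (x (j - 1)) (seg x j n))"
    using tight_seg[OF x tight, of "j - 1" n] nonc[of "j - 1" n] j seg_insert_first[of "j - 1" n x] by simp
  then have "progression z (inv (z 0) \<otimes> z 1) (n - j)"
    using chain_shift[OF x, of j "n - j"] high j
    by (intro progression_from_tight[where y = "x (j - 1)"]) (auto simp: z_seg simp flip: z_def)
  then have e: "progression z e (n - j)"
    by (simp add: z_def e_def)
  define A where "A = x (j - 2)"
  define B where "B = x (j - 1)"
  define C where "C = x j"
  define D where "D = x (j + 1)"
  note ABCD = A_def B_def C_def D_def
  have [simp]: "A \<in> carrier G" "B \<in> carrier G" "C \<in> carrier G" "D \<in> carrier G"
    "d \<in> carrier G" "e \<in> carrier G"
    using j d e by (auto simp: progression_def ABCD)
  have AB: "B = A \<otimes> d" "A \<bowtie> d" "B \<bowtie> d" "x 0 \<bowtie> d" and d1: "\<one> \<^bold>< d"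
  proof -
    have step: "x (Suc i) = x i \<otimes> d" if "Suc i < j" for i
      using d that by (simp add: progression_def)
    have central: "x i \<bowtie> d" if "i < j" for i
      using d that by (simp add: progression_def)
    have "Suc (j - 2) = j - 1" using j by simp
    then show "B = A \<otimes> d"
      using step[of "j - 2"] j by (simp add: ABCD)
    show "A \<bowtie> d" "B \<bowtie> d" "x 0 \<bowtie> d"
      using j by (simp_all add: central ABCD)
    show "\<one> \<^bold>< d"
      using d by (simp add: progression_def)
  qed
  have CD: "D = C \<otimes> e" "C \<bowtie> e"
  proof -
    have "Suc 0 < n - j"
      using j by simp
    then have "z (Suc 0) = z 0 \<otimes> e" "z 0 \<bowtie> e"
      using e by (auto simp: progression_def)
    then show "D = C \<otimes> e" "C \<bowtie> e"
      by (simp_all add: z_def ABCD)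
  qed
  have sub4: "{A, B, C, D} = seg x (j - 2) (j + 2)"
  proof -
    have "j - 2 + 1 = j - 1" "j - 2 + 2 = j" "j - 2 + 3 = j + 1" "j - 2 + 4 = j + 2"
      using j by auto
    then show ?thesis using seg_four[of x "j - 2"] by (simp add: ABCD)
  qed
  have "tight {A, B, C, D}"
    unfolding sub4 using j by (intro tight_seg[OF x tight] nonc) auto
  moreover have "A \<bowtie> B" "C \<bowtie> D"
    using low high j by (auto simp: commuting_set_def ABCD)
  ultimately have rel: "B \<otimes> C = C \<otimes> A \<and> C \<otimes> B = B \<otimes> D \<or>
      C \<otimes> B = A \<otimes> C \<and> B \<otimes> C = D \<otimes> B"
    using chain_lt[OF x] j nc by (intro two_pairs) (auto simp: ABCD)
  then have "C \<bowtie> d \<and> e = d \<and> (C \<otimes> B = B \<otimes> C \<otimes> d \<or> B \<otimes> C = C \<otimes> B \<otimes> d)"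
  proof (elim disjE conjE)
    assume 1: "B \<otimes> C = C \<otimes> A" and 2: "C \<otimes> B = B \<otimes> D"
    have 3: "C \<otimes> B = B \<otimes> C \<otimes> d"
      using 1 by (simp add: AB(1) m_assoc)
    then have "B \<otimes> C \<otimes> d = B \<otimes> C \<otimes> e"
      using 2 by (simp add: CD(1) m_assoc)
    then have "d = e" by simp
    then show ?thesis using 3 CD(2) by simp
  next
    assume 1: "C \<otimes> B = A \<otimes> C" and 2: "B \<otimes> C = D \<otimes> B"
    have 3: "B \<otimes> C = d \<otimes> (C \<otimes> B)"
    proof -
      have "B \<otimes> C = d \<otimes> A \<otimes> C"
        using AB(1,2) by (simp add: commute_def)
      then show ?thesis using 1 by (simp add: m_assoc)
    qed
    moreover have "D \<otimes> B = e \<otimes> (C \<otimes> B)"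
      using CD by (simp add: commute_def m_assoc)
    ultimately have "d \<otimes> (C \<otimes> B) = e \<otimes> (C \<otimes> B)"
      using 2 by simp
    then have de: "d = e" by simp
    have "d \<bowtie> C \<otimes> B"
      using AB(3) CD(2) de by (intro commute_mult) (auto simp: commute_sym)
    then show ?thesis using 3 de CD(2) by (simp add: commute_def)
  qed
  then have Cd: "C \<bowtie> d" and ed: "e = d" and
    rel': "C \<otimes> B = B \<otimes> C \<otimes> d \<or> B \<otimes> C = C \<otimes> B \<otimes> d"
    by auto
  define p where "p = d [^] (j - 1)"
  have [simp]: "p \<in> carrier G" "x 0 \<in> carrier G"
    using j by (simp_all add: p_def)
  have Bp: "B = x 0 \<otimes> p"
    unfolding p_def using progression_nth[OF d, of 0 "j - 1"] j by (simp add: ABCD)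
  have Cp: "C \<otimes> p = p \<otimes> C" and dp: "d \<otimes> p = p \<otimes> d"
    using Cd group_commutes_pow[of d C "j - 1"] group_commutes_pow[of d d "j - 1"]
    by (simp_all add: p_def commute_def)
  have twist: "x 0 \<otimes> C = C \<otimes> x 0 \<otimes> d \<or> C \<otimes> x 0 = x 0 \<otimes> C \<otimes> d"
    using rel'
  proof
    assume "C \<otimes> B = B \<otimes> C \<otimes> d"
    then have "C \<otimes> x 0 \<otimes> p = x 0 \<otimes> C \<otimes> d \<otimes> p"
      by (simp add: Bp m_assoc dp) (simp add: Cp flip: m_assoc)
    then show ?thesis by simp
  next
    assume "B \<otimes> C = C \<otimes> B \<otimes> d"
    then have "x 0 \<otimes> C \<otimes> p = C \<otimes> x 0 \<otimes> d \<otimes> p"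
      by (simp add: Bp m_assoc dp Cp)
    then show ?thesis by simp
  qed
  have blocks: "seg x 0 n = {x 0 \<otimes> d [^] m | m. m \<le> j - 1} \<union> {C \<otimes> d [^] m | m. m \<le> n - j - 1}"
  proof -
    have "seg x 0 n = seg x 0 j \<union> seg z 0 (n - j)"
      using j by (simp add: z_seg ivl_disj_un_two(3) flip: image_Un)
    moreover have "seg z 0 (n - j) = {C \<otimes> d [^] m | m. m \<le> n - j - 1}"
      using progression_seg[OF e] j by (simp add: ed z_def ABCD)
    ultimately show ?thesis
      using progression_seg[OF d] j by simp
  qed
  have central: "commutator G (x 0) d = \<one>" "commutator G C d = \<one>"
    using AB(4) Cd by (simp_all add: commutator_eq_one)
  have pos: "(\<one>, d) \<in> R - Id"
    using d1 by (simp add: lt_def)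
  show ?thesis
    unfolding two_progressions_def
    by (rule bexI[of _ "x 0"], rule bexI[of _ C], rule bexI[of _ d],
        rule exI[of _ "j - 1"], rule exI[of _ "n - j - 1"], intro conjI blocks central pos twist) simp_all
qed

section \<open>One block and one further element\<close>

lemma commuting_plus_one:
  assumes x: "chain x n" and comm: "commuting_set (seg x 0 n)" and n: "3 \<le> n"
    and tight: "tight (insert y (seg x 0 n))"
  shows "two_progressions G R (insert y (seg x 0 n)) \<or>
    n = 3 \<and> (noncommuting_quadruple G (insert y (seg x 0 n)) \<or>
      commuting_quadruple G (insert y (seg x 0 n)))"
proof -
  define a where "a = x 0"
  define d where "d = inv (x 0) \<otimes> x 1"
  define b where "b = conjugate G a y"
  define u where "u = conjugate G d y"
  have prog: "progression x d n"
    unfolding d_def by (rule tight_insert_progression(1)[OF assms])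
  have cases: "u = d \<and> (b = a \<otimes> d \<or> b \<otimes> d = a) \<or>
      n = 3 \<and> (u = d \<otimes> d \<and> (b = a \<or> b \<otimes> (d \<otimes> d) = a) \<or>
        u \<otimes> u = d \<and> (b = a \<or> b = a \<otimes> d))"
    unfolding a_def b_def u_def d_def by (rule tight_insert_progression(2)[OF assms])
  have y [simp]: "y \<in> carrier G"
    using tight by (simp add: tight_def)
  have [simp]: "a \<in> carrier G" "d \<in> carrier G" "b \<in> carrier G" "u \<in> carrier G"
    and ad: "a \<bowtie> d" and d1: "(\<one>, d) \<in> R - Id"
    using prog n by (auto simp: progression_def a_def b_def u_def lt_def)
  have S: "insert y (seg x 0 n) = {a \<otimes> d [^] m | m. m \<le> n - 1} \<union> {y \<otimes> d [^] m | m. m \<le> (0::nat)}"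
    using progression_seg[OF prog] n by (auto simp: a_def)
  have three: "insert y (seg x 0 n) = {a, a \<otimes> d, a \<otimes> d [^] (2::nat), y}" if "n = 3"
  proof -
    have "{..n - 1} = {0, 1, 2}"
      using that by auto
    moreover have "{a \<otimes> d [^] m | m. m \<le> n - 1} = (\<lambda>m. a \<otimes> d [^] m) ` {..n - 1}"
      by auto
    ultimately have "{a \<otimes> d [^] m | m. m \<le> n - 1} = (\<lambda>m::nat. a \<otimes> d [^] m) ` {0, 1, 2}"
      by simp
    then show ?thesis
      unfolding S by (auto simp: numeral_2_eq_2)
  qed
  have yb: "a \<otimes> y = y \<otimes> b" and yu: "d \<otimes> y = y \<otimes> u"
    by (auto simp: b_def u_def intro!: conjugate_eq)
  have da: "commutator G d a = \<one>"
    using ad by (intro commutator_eq_one) (auto simp: commute_sym)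
  have ay: "commutator G a y = inv a \<otimes> b"
    by (simp add: commutator_def b_def conjugate_def m_assoc)
  have ya: "commutator G y a = inv b \<otimes> a"
    by (simp add: commutator_def b_def conjugate_def m_assoc inv_mult_group)
  have uu: "conjugate G (d [^] (2::nat)) y = u \<otimes> u"
    by (simp add: numeral_2_eq_2 conjugate_mult u_def)
  have d2: "d [^] (2::nat) = d \<otimes> d"
    by (simp add: numeral_2_eq_2)
  from cases show ?thesis
  proof (elim disjE conjE)
    assume "u = d" "b = a \<otimes> d"
    then have "a \<otimes> y = y \<otimes> a \<otimes> d" "y \<bowtie> d"
      using yb yu by (simp_all add: m_assoc commute_def)
    then have "two_progressions G R (insert y (seg x 0 n))"
      unfolding two_progressions_def
      by (intro bexI[of _ a] bexI[of _ y] bexI[of _ d] exI[of _ "n - 1"] exI[of _ 0] conjI S d1 disjI1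
          commutator_eq_one ad) simp_all
    then show ?thesis ..
  next
    assume "u = d" "b \<otimes> d = a"
    then have "y \<otimes> a = a \<otimes> y \<otimes> d" "y \<bowtie> d"
      using yb yu by (simp_all add: m_assoc commute_def)
    then have "two_progressions G R (insert y (seg x 0 n))"
      unfolding two_progressions_def
      by (intro bexI[of _ a] bexI[of _ y] bexI[of _ d] exI[of _ "n - 1"] exI[of _ 0] conjI S d1 disjI2
          commutator_eq_one ad) simp_all
    then show ?thesis ..
  next
    assume 1: "n = 3" "u = d \<otimes> d" "b = a"
    then have "commuting_quadruple G (insert y (seg x 0 n))"
      unfolding three[OF 1(1)] commuting_quadruple_def
      by (intro bexI[of _ a] bexI[of _ d] bexI[of _ y] conjI refl da disjI1)
        (simp_all add: ay d2 flip: u_def)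
    then show ?thesis using 1 by blast
  next
    assume 1: "n = 3" "u = d \<otimes> d" "b \<otimes> (d \<otimes> d) = a"
    then have "inv b \<otimes> a = d \<otimes> d"
      by (simp flip: 1(3))
    then have "noncommuting_quadruple G (insert y (seg x 0 n))"
      unfolding three[OF 1(1)] noncommuting_quadruple_def
      by (intro bexI[of _ a] bexI[of _ d] bexI[of _ y] conjI refl da disjI2)
        (simp_all add: ya d2 1(2) flip: u_def)
    then show ?thesis using 1 by blast
  next
    assume 1: "n = 3" "u \<otimes> u = d" "b = a"
    then have "commuting_quadruple G (insert y (seg x 0 n))"
      unfolding three[OF 1(1)] commuting_quadruple_def
      by (intro bexI[of _ a] bexI[of _ d] bexI[of _ y] conjI refl da disjI2)
        (simp_all add: ay uu)
    then show ?thesis using 1 by blast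
  next
    assume 1: "n = 3" "u \<otimes> u = d" "b = a \<otimes> d"
    then have "noncommuting_quadruple G (insert y (seg x 0 n))"
      unfolding three[OF 1(1)] noncommuting_quadruple_def
      by (intro bexI[of _ a] bexI[of _ d] bexI[of _ y] conjI refl da disjI1)
        (simp_all add: ay uu)
    then show ?thesis using 1 by blast
  qed
qed

section \<open>Consecutive elements that always commute\<close>

text \<open>
  The hypotheses say that \<open>s\<close> is the conjugate of \<open>d\<close> by \<open>q\<inverse>\<close>, and \<open>t\<close> that of \<open>q\<close> by \<open>d\<close>. Each of
  these conjugations is a squaring or a square root.
\<close>

lemma double_distortion_impossible:
  assumes carr [simp]: "d \<in> carrier G" "q \<in> carrier G" "s \<in> carrier G" "t \<in> carrier G"
    and pos: "\<one> \<^bold>< d" "\<one> \<^bold>< q"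
    and eq: "s \<otimes> q = q \<otimes> d" "q \<otimes> d = d \<otimes> t"
    and s: "s = d \<otimes> d \<or> s \<otimes> s = d" and t: "t = q \<otimes> q \<or> t \<otimes> t = q"
  shows False
proof -
  have big: "\<one> \<^bold>< d \<otimes> q \<otimes> d" "\<one> \<^bold>< q \<otimes> d \<otimes> q"
    using mult_strict_mono[OF pos] mult_strict_mono[OF pos(2,1)]
      mult_strict_mono[of \<one> "d \<otimes> q" \<one> d] mult_strict_mono[of \<one> "q \<otimes> d" \<one> q] pos by simp_all
  from s t show False
  proof (elim disjE)
    assume "s = d \<otimes> d" "t = q \<otimes> q"
    then have "d \<otimes> (d \<otimes> q) = d \<otimes> (q \<otimes> q)"
      using eq by (simp add: m_assoc)
    then have "d = q" by simp
    then show False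
      using eq(1) \<open>s = d \<otimes> d\<close> pos by (auto simp: m_assoc)
  next
    assume "s = d \<otimes> d" and tt: "t \<otimes> t = q"
    then have "d \<otimes> (d \<otimes> q) = d \<otimes> t"
      using eq by (simp add: m_assoc)
    then have "t = d \<otimes> q" by simp
    then have "d \<otimes> q \<otimes> d \<otimes> q = \<one> \<otimes> q"
      using tt by (simp add: m_assoc)
    then have "d \<otimes> q \<otimes> d = \<one>"
      by (simp only: r_cancel m_closed one_closed carr)
    then show False using big by simp
  next
    assume ss: "s \<otimes> s = d" and "t = q \<otimes> q"
    then have "s \<otimes> q = d \<otimes> q \<otimes> q"
      using eq by (simp add: m_assoc)
    then have "s = d \<otimes> q" by simp
    then have "d \<otimes> (q \<otimes> d \<otimes> q) = d \<otimes> \<one>"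
      using ss by (simp add: m_assoc)
    then have "q \<otimes> d \<otimes> q = \<one>"
      by (simp only: l_cancel m_closed one_closed carr)
    then show False using big by simp
  next
    assume ss: "s \<otimes> s = d" and tt: "t \<otimes> t = q"
    have "s \<otimes> q = s \<otimes> (s \<otimes> t)"
      using eq ss by (simp flip: m_assoc)
    then have "s \<otimes> t = t \<otimes> t"
      using tt by simp
    then have "s = t" by simp
    then have "d = q" using ss tt by simp
    then have "s = d"
      using eq(1) by simp
    then show False
      using ss pos by auto
  qed
qed

text \<open>
  Two non-commuting elements at the smallest distance \<open>g\<close> have \<open>g = 2\<close>: for \<open>g \<ge> 3\<close> the upper one would commute with
  two consecutive terms of the progression that starts at the lower one, hence with all its terms. So \<open>x\<^sub>i\<close> and \<open>x\<^sub>i\<^sub>+\<^sub>2\<close> do not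
  commute for some \<open>i\<close>. Since commutation does not propagate, the elements up to \<open>e = x\<^sub>i\<^sub>+\<^sub>1\<close> commute, and
  so do those from \<open>e\<close> on. The ratios \<open>q\<close> below \<open>e\<close> and \<open>d\<close> above \<open>e\<close> then distort each other.
\<close>

lemma all_consecutive_commuting:
  assumes x: "chain x n" and tight: "tight (seg x 0 n)" and n: "4 \<le> n"
    and comm: "\<And>i. Suc i < n \<Longrightarrow> x i \<bowtie> x (Suc i)"
    and low: "\<not> commuting_set (seg x 0 (n - 1))" and high: "\<not> commuting_set (seg x 1 n)"
  shows False
proof -
  have carr [simp]: "x i \<in> carrier G" if "i < n" for i
    using x that by (rule chain_carrier)
  define P where "P = (\<lambda>g. \<exists>i. i + g < n \<and> \<not> x i \<bowtie> x (i + g))"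
  have "\<exists>g. P g"
  proof -
    obtain i k where ik: "i < n" "k < n" "\<not> x i \<bowtie> x k"
      using tight by (auto simp: tight_def commuting_set_def)
    then have "i \<noteq> k" by auto
    then have "P (k - i) \<or> P (i - k)"
      using ik unfolding P_def
      by (cases "i < k") (auto intro: exI[of _ i] exI[of _ k] simp: commute_sym)
    then show ?thesis by blast
  qed
  then obtain g where g: "P g" "\<And>g'. g' < g \<Longrightarrow> \<not> P g'"
    by (metis LeastI not_less_Least)
  then obtain i where i: "i + g < n" "\<not> x i \<bowtie> x (i + g)"
    by (auto simp: P_def)
  have ordered: "x k \<bowtie> x l" if "l < n" "k \<le> l" "l < k + g" for k l
  proof -
    have "\<not> P (l - k)"
      using that by (intro g(2)) simp
    then have "\<not> (k + (l - k) < n \<and> \<not> x k \<bowtie> x (k + (l - k)))"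
      unfolding P_def by blast
    then show ?thesis
      using that by simp
  qed
  have close: "x k \<bowtie> x l" if "k < n" "l < n" "k < l + g" "l < k + g" for k l
    using that ordered[of l k] ordered[of k l] by (cases "k \<le> l") (auto simp: commute_sym)
  have "g \<noteq> 0" "g \<noteq> 1"
    using i comm[of i] by (metis add_0_right commute_refl, metis Suc_eq_plus1)
  have "g = 2"
  proof (rule ccontr)
    assume "g \<noteq> 2"
    with \<open>g \<noteq> 0\<close> \<open>g \<noteq> 1\<close> have g3: "3 \<le> g" by simp
    define z where "z = (\<lambda>k. x (i + k))"
    have z_seg: "seg z 0 g = seg x i (i + g)"
      unfolding z_def using seg_shift[of x i 0 g] by simp
    have cz: "commuting_set (seg z 0 g)"
      unfolding z_seg commuting_set_def using i close by auto
    have tz: "tight (insert (x (i + g)) (seg z 0 g))"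
    proof -
      have "\<not> commuting_set (seg x i (Suc (i + g)))"
      proof -
        have "i \<in> {i..<Suc (i + g)}" "i + g \<in> {i..<Suc (i + g)}" by auto
        then show ?thesis using i(2) unfolding commuting_set_def by blast
      qed
      then have "tight (seg x i (Suc (i + g)))"
        using i by (intro tight_seg[OF x tight]) auto
      then show ?thesis by (simp add: z_seg seg_insert_last)
    qed
    have "chain z g"
      unfolding z_def using i by (intro chain_shift[OF x]) simp
    then have prog: "progression z (inv (z 0) \<otimes> z 1) g"
      using g3 by (intro progression_from_tight[OF _ cz _ tz]) auto
    define d where "d = inv (z 0) \<otimes> z 1"
    have [simp]: "d \<in> carrier G"
      using prog unfolding progression_def d_def[symmetric] by blast
    have step: "z (Suc k) = z k \<otimes> d" if "Suc k < g" for k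
      using prog that unfolding progression_def d_def[symmetric] by blast
    have z1: "z 1 = z 0 \<otimes> d" and z2: "z 2 = z 1 \<otimes> d"
      using step[of 0] step[of 1] g3 by (simp_all add: numeral_2_eq_2)
    have "x (i + g) \<bowtie> z 1" "x (i + g) \<bowtie> z 2"
      using i g3 by (auto simp: z_def intro!: close)
    moreover have [simp]: "z 0 \<in> carrier G" "z 1 \<in> carrier G"
      using i g3 by (auto simp: z_def)
    ultimately have "x (i + g) \<bowtie> d"
      using commute_right_factor[of "x (i + g)" "z 1" d] i by (simp add: z2)
    then have "x (i + g) \<bowtie> z 0"
      using commute_left_factor[of "x (i + g)" "z 0" d] \<open>x (i + g) \<bowtie> z 1\<close> i by (simp flip: z1)
    then show False
      using i by (simp add: z_def commute_sym)
  qed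
  then have i2: "i + 2 < n" "\<not> x i \<bowtie> x (i + 2)"
    using i by auto
  have c01: "x i \<bowtie> x (i + 1)" and c12: "x (i + 1) \<bowtie> x (i + 2)"
    using comm[of i] comm[of "i + 1"] i2 by auto
  have nonc: "\<not> commuting_set (seg x k l)" if "k \<le> i" "i + 2 < l" for k l
  proof -
    have "i \<in> {k..<l}" "i + 2 \<in> {k..<l}" using that by auto
    then show ?thesis using i2(2) unfolding commuting_set_def by blast
  qed
  have below: "commuting_set (seg x 0 (i + 2))"
    using commute_propagates_up_chain(1)[OF x tight i2(1) c01] i2(2) by (auto simp: commute_sym)
  have above: "commuting_set (seg x (i + 1) n)"
    using commute_propagates_down_chain(1)[OF x tight i2(1) c12] i2(2) by auto
  have "i + 3 < n"
  proof (rule ccontr)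
    assume "\<not> i + 3 < n"
    then have "n - 1 = i + 2" using i2 by simp
    then show False using below low by simp
  qed
  moreover have "1 \<le> i"
  proof (rule ccontr)
    assume "\<not> 1 \<le> i"
    then have "i = 0" by simp
    then show False using above high by simp
  qed
  ultimately have bounds: "1 \<le> i" "i + 3 < n" by auto
  define w y e z where "w = x (i - 1)" and "y = x i" and "e = x (i + 1)" and "z = x (i + 2)"
  have [simp]: "w \<in> carrier G" "y \<in> carrier G" "e \<in> carrier G" "z \<in> carrier G"
    using bounds by (auto simp: w_def y_def e_def z_def)
  have ye: "y \<bowtie> e" and ez: "e \<bowtie> z" and yz: "\<not> y \<bowtie> z"
    using c01 c12 i2 by (auto simp: y_def e_def z_def)
  \<comment> \<open>The three elements from \<open>e\<close> on, acted on by \<open>y\<close>, which fixes \<open>e\<close>.\<close>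
  define hi where "hi = (\<lambda>k. x (i + 1 + k))"
  have hi_seg: "seg hi 0 3 = seg x (i + 1) (i + 4)"
  proof -
    have "i + 1 + 0 = i + 1" "i + 1 + 3 = i + 4" by simp_all
    then show ?thesis unfolding hi_def seg_shift by (simp only:)
  qed
  have t_hi: "tight (insert y (seg hi 0 3))"
  proof -
    have "tight (seg x i (i + 4))"
      using bounds by (intro tight_seg[OF x tight] nonc) auto
    then show ?thesis
      using seg_insert_first[of i "i + 4" x] by (simp add: hi_seg y_def)
  qed
  have c_hi: "commuting_set (seg hi 0 3)"
    unfolding hi_seg by (rule commuting_set_subset[OF above]) (use bounds in \<open>auto intro: image_mono\<close>)
  have ch_hi: "chain hi 3"
    unfolding hi_def using bounds by (intro chain_shift[OF x]) auto
  define d where "d = inv e \<otimes> z"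
  have "hi 0 = e" "hi 1 = z"
    by (simp_all add: hi_def e_def z_def)
  note up = tight_insert_progression[OF ch_hi c_hi _ t_hi, unfolded this, folded d_def]
  have d [simp]: "d \<in> carrier G" and d1: "\<one> \<^bold>< d"
    using up(1) by (auto simp: progression_def)
  have z: "z = e \<otimes> d" by (simp add: d_def)
  define s where "s = conjugate G d y"
  have [simp]: "s \<in> carrier G" by (simp add: s_def)
  have "conjugate G e y = e"
    using ye by (simp add: conjugate_def commute_def m_assoc flip: ye[unfolded commute_def])
  then have s: "s = d \<otimes> d \<or> s \<otimes> s = d"
    using up(2) d1 by (auto simp: s_def)
  have dy: "d \<otimes> y = y \<otimes> s"
    unfolding s_def by (rule conjugate_eq) simp_all
  \<comment> \<open>The three elements up to \<open>e\<close>, acted on by \<open>z\<close>, which fixes \<open>e\<close>.\<close>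
  define lo where "lo = (\<lambda>k. x (i - 1 + k))"
  have lo_seg: "seg lo 0 3 = seg x (i - 1) (i + 2)"
  proof -
    have "i - 1 + 0 = i - 1" "i - 1 + 3 = i + 2" using bounds by simp_all
    then show ?thesis unfolding lo_def seg_shift by (simp only:)
  qed
  have t_lo: "tight (insert z (seg lo 0 3))"
  proof -
    have "tight (seg x (i - 1) (Suc (i + 2)))"
      using bounds by (intro tight_seg[OF x tight] nonc) auto
    then show ?thesis
      using seg_insert_last[of "i - 1" "i + 2" x] by (simp add: lo_seg z_def)
  qed
  have c_lo: "commuting_set (seg lo 0 3)"
    unfolding lo_seg by (rule commuting_set_subset[OF below]) (use bounds in \<open>auto intro: image_mono\<close>)
  have ch_lo: "chain lo 3"
    unfolding lo_def using bounds by (intro chain_shift[OF x]) auto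
  define q where "q = inv w \<otimes> y"
  have lo: "lo 0 = w" "lo 1 = y" "lo 2 = e"
    using bounds by (simp_all add: lo_def w_def y_def e_def)
  note down = tight_insert_progression[OF ch_lo c_lo _ t_lo, unfolded lo(1,2), folded q_def]
  have q [simp]: "q \<in> carrier G" and q1: "\<one> \<^bold>< q"
    using down(1) by (auto simp: progression_def)
  have y: "y = w \<otimes> q" by (simp add: q_def)
  have e: "e = y \<otimes> q"
    using down(1) lo by (auto simp: progression_def numeral_2_eq_2)
  define t where "t = conjugate G q z"
  define b where "b = conjugate G w z"
  have [simp]: "t \<in> carrier G" "b \<in> carrier G" by (simp_all add: t_def b_def)
  have "conjugate G e z = e"
    using ez by (simp add: conjugate_def commute_def m_assoc)
  moreover have "conjugate G e z = b \<otimes> (t \<otimes> t)"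
    unfolding e y by (simp add: conjugate_mult t_def b_def m_assoc)
  ultimately have bt: "b \<otimes> (t \<otimes> t) = w \<otimes> (q \<otimes> q)"
    by (simp add: e y m_assoc)
  have qq: "q \<noteq> \<one>" "q \<otimes> q \<noteq> \<one>"
    using q1 mult_strict_mono[OF q1 q1] by auto
  have t: "t = q \<otimes> q \<or> t \<otimes> t = q"
    using down(2) bt qq by (auto simp flip: t_def b_def)
  have qz: "q \<otimes> z = z \<otimes> t"
    unfolding t_def by (rule conjugate_eq) simp_all
  have eq: "e \<bowtie> q" and ed: "e \<bowtie> d"
    using ye ez commute_right_factor[of e y q] commute_right_factor[of e e d]
    by (auto simp: commute_sym simp flip: e z)
  have "y \<otimes> (s \<otimes> q) = d \<otimes> e"
    using dy by (simp add: e flip: m_assoc)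
  also have "\<dots> = y \<otimes> (q \<otimes> d)"
    using ed by (simp add: commute_def e m_assoc)
  finally have 1: "s \<otimes> q = q \<otimes> d" by simp
  have "e \<otimes> (q \<otimes> d) = q \<otimes> z"
    using eq by (simp add: z commute_def flip: m_assoc)
  also have "\<dots> = e \<otimes> (d \<otimes> t)"
    unfolding qz by (simp add: z m_assoc)
  finally have 2: "q \<otimes> d = d \<otimes> t" by simp
  show False
    using double_distortion_impossible[OF _ _ _ _ d1 q1 1 2 s t] by simp
qed

section \<open>The classification\<close>

lemma ex_chain:
  assumes "finite S" "S \<subseteq> carrier G"
  shows "\<exists>x. chain x (card S) \<and> seg x 0 (card S) = S"
  using assms
proof (induction "card S" arbitrary: S)
  case 0
  then show ?case by (auto simp: chain_def)
next
  case (Suc n)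
  then have "S \<noteq> {}" by auto
  then obtain m where m: "greatest_in S m"
    using ex_greatest_in Suc.prems by blast
  have mS: "m \<in> S" using m by (simp add: greatest_in_def)
  have n: "n = card (S - {m})"
    using Suc.hyps(2) mS Suc.prems(1) by simp
  then obtain x where x: "chain x n" "seg x 0 n = S - {m}"
    using Suc.hyps(1)[of "S - {m}"] Suc.prems by auto
  let ?y = "x(n := m)"
  have "seg ?y 0 (Suc n) = insert m (seg x 0 n)"
    by (auto simp: less_Suc_eq image_iff)
  then have "seg ?y 0 (Suc n) = S"
    using x(2) mS by auto
  moreover have "chain ?y (Suc n)"
  proof -
    have "x i \<^bold>< m" if "i < n" for i
    proof -
      have "x i \<in> S - {m}"
        unfolding x(2)[symmetric] using that by simp
      then show ?thesis by (rule greatest_in_lt[OF m])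
    qed
    then show ?thesis
      using x(1) mS Suc.prems(2) by (auto simp: chain_def less_Suc_eq)
  qed
  ultimately show ?case
    unfolding Suc.hyps(2)[symmetric] by blast
qed

text \<open>
  If neither the maximum nor the minimum can be removed to leave a commuting set, the word formed by
  the answers to \<open>x\<^sub>i \<bowtie> x\<^sub>i\<^sub>+\<^sub>1\<close> decides the shape. A non-commuting step between two commuting ones
  gives two blocks. Otherwise, unless the word is constant, a change from commuting to non-commuting is followed by a further
  non-commuting step, and a change in the other direction is preceded by one; both are impossible.
\<close>

theorem tight_chain_classification:
  assumes x: "chain x n" and tight: "tight (seg x 0 n)" and n: "4 \<le> n"
    and low: "\<not> commuting_set (seg x 0 (n - 1))" and high: "\<not> commuting_set (seg x 1 n)"
  shows "two_progressions G R (seg x 0 n) \<or> one_progression G R (seg x 0 n) \<or>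
    n = 4 \<and> fibonacci_quadruple G R (seg x 0 n)"
proof -
  define c where "c i \<longleftrightarrow> x i \<bowtie> x (Suc i)" for i
  have nonc: "\<not> commuting_set (seg x k l)" if "\<not> c i" "k \<le> i" "Suc i < l" for i k l
  proof -
    have "i \<in> {k..<l}" "Suc i \<in> {k..<l}" using that by auto
    then show ?thesis using that(1) unfolding c_def commuting_set_def by blast
  qed
  have down: "commuting_set (seg x 0 (i + 2))" if "c i" "\<not> c (Suc i)" "i + 2 < n" for i
    using commute_propagates_up_chain(2)[OF x tight that(3)] that(1,2) by (auto simp: c_def commute_sym)
  have up: "commuting_set (seg x (i + 1) n)" if "\<not> c i" "c (Suc i)" "i + 2 < n" for i
    using commute_propagates_down_chain(2)[OF x tight that(3)] that(1,2) by (auto simp: c_def)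
  have window: "tight {x i, x (i + 1), x (i + 2), x (i + 3)}" if "\<not> c (i + 1)" "i + 3 < n" for i
    unfolding seg_four[symmetric] using that nonc[OF that(1), of i "i + 4"]
    by (intro tight_seg[OF x tight]) auto
  consider (blocks) i where "c i" "\<not> c (Suc i)" "c (Suc (Suc i))" "i + 3 < n"
    | (all) "\<And>i. Suc i < n \<Longrightarrow> c i"
    | (none) "\<And>i. Suc i < n \<Longrightarrow> \<not> c i"
    | (fall) i where "c i" "\<not> c (Suc i)" "i + 2 < n" "\<not> (c (Suc (Suc i)) \<and> i + 3 < n)"
    | (rise) i where "\<not> c i" "c (Suc i)" "i + 2 < n" "i = 0 \<or> \<not> c (i - 1)"
  proof (cases "\<forall>i. i + 2 < n \<longrightarrow> c i = c (Suc i)")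
    case True
    have "c i = c 0" if "Suc i < n" for i
      using that
    proof (induction i)
      case (Suc i)
      then show ?case using True by auto
    qed simp
    then show thesis using all none by blast
  next
    case False
    then obtain i where i: "i + 2 < n" "c i \<noteq> c (Suc i)"
      by blast
    show thesis
    proof (cases "c i")
      case True
      then show thesis using i blocks[of i] fall[of i] by blast
    next
      case False
      show thesis
      proof (cases "i = 0 \<or> \<not> c (i - 1)")
        case True
        then show thesis using False i rise[of i] by blast
      next
        case before: False
        then obtain k where "i = Suc k" by (cases i) auto
        then show thesis
          using False before i blocks[of k] by auto
      qed
    qed
  qed
  then show ?thesis
  proof cases
    case (blocks i)
    have "two_progressions G R (seg x 0 n)"
      using down[of i] up[of "Suc i"] blocks
      by (intro two_commuting_blocks[OF x tight, of "i + 2"]) (auto simp: c_def)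
    then show ?thesis ..
  next
    case all
    then have False
      using all_consecutive_commuting[OF x tight n _ low high] by (auto simp: c_def)
    then show ?thesis ..
  next
    case none
    then show ?thesis
      using noncommuting_chain[OF x n tight] by (auto simp: c_def)
  next
    case (fall i)
    have "commuting_set (seg x 0 (i + 2))"
      using fall by (intro down)
    then have "i + 2 \<noteq> n - 1"
      using low by auto
    then have "i + 3 < n"
      using fall by simp
    then have False
      using no_commuting_then_noncommuting[OF window[of i]] chain_lt[OF x] fall
      by (auto simp: c_def numeral_3_eq_3)
    then show ?thesis ..
  next
    case (rise i)
    have "commuting_set (seg x (i + 1) n)"
      using rise by (intro up)
    then have "i \<noteq> 0"
      by (rule contrapos_pn) (use high in simp)
    then obtain k where k: "i = Suc k" by (cases i) auto
    then have False
      using no_noncommuting_then_commuting[OF window[of k]] chain_lt[OF x] rise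
      by (auto simp: c_def numeral_3_eq_3)
    then show ?thesis ..
  qed
qed

theorem tight_classification:
  assumes tight: "tight S" and card: "4 \<le> card S"
  shows "two_progressions G R S \<or> one_progression G R S \<or> card S = 4 \<and>
    (fibonacci_quadruple G R S \<or> noncommuting_quadruple G S \<or> commuting_quadruple G S)"
proof -
  obtain x where x: "chain x (card S)" and S: "seg x 0 (card S) = S"
    using ex_chain[of S] tight by (auto simp: tight_def)
  define n where "n = card S"
  note x = x[folded n_def] and S = S[folded n_def] and n = card[folded n_def]
  have n3: "3 \<le> n - 1" "n - 1 = 3 \<longleftrightarrow> n = 4"
    using n by auto
  consider (low) "commuting_set (seg x 0 (n - 1))" | (high) "commuting_set (seg x 1 n)"
    | (neither) "\<not> commuting_set (seg x 0 (n - 1))" "\<not> commuting_set (seg x 1 n)"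
    by blast
  then show ?thesis
  proof cases
    case low
    have ins: "insert (x (n - 1)) (seg x 0 (n - 1)) = S"
      using seg_insert_last[of 0 "n - 1" x] n S by simp
    show ?thesis
      using commuting_plus_one[OF chain_mono[OF x diff_le_self] low n3(1), of "x (n - 1)",
          unfolded ins n3(2)] tight
      unfolding n_def[symmetric] by blast
  next
    case high
    define z where "z = (\<lambda>k. x (1 + k))"
    have z: "seg z 0 (n - 1) = seg x 1 n"
      unfolding z_def seg_shift using n by simp
    have ins: "insert (x 0) (seg x 1 n) = S"
      using seg_insert_first[of 0 n x] n S by simp
    have "chain z (n - 1)"
      unfolding z_def using n by (intro chain_shift[OF x]) simp
    then show ?thesis
      using commuting_plus_one[of z "n - 1" "x 0", unfolded z ins n3(2)] high tight n3(1)
      unfolding n_def[symmetric] by blast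
  next
    case neither
    then show ?thesis
      using tight_chain_classification[OF x _ n neither, unfolded S] tight
      unfolding n_def[symmetric] by blast
  qed
qed

section \<open>Upper bounds for the three families\<close>

lemma pow_strict_mono:
  assumes "\<one> \<^bold>< c" "m < (k::nat)"
  shows "c [^] m \<^bold>< c [^] k"
  using assms(2)
proof (induction k)
  case (Suc k)
  have [simp]: "c \<in> carrier G" using lt_carrier[OF assms(1)] by simp
  have "c [^] k \<^bold>< c [^] Suc k"
    using mult_left_mono[OF assms(1), of "c [^] k"] by simp
  then show ?case
    using Suc by (cases "m = k") (auto intro: ord.less_trans)
qed simp

lemma pow_commutes: "a \<bowtie> c \<Longrightarrow> a \<in> carrier G \<Longrightarrow> c \<in> carrier G \<Longrightarrow> c [^] (m::nat) \<otimes> a = a \<otimes> c [^] m"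
  using group_commutes_pow[of c a m] by (simp add: commute_def)

lemma commutator_one_commute:
  assumes [simp]: "a \<in> carrier G" "b \<in> carrier G" and "commutator G a b = \<one>"
  shows "a \<bowtie> b"
proof -
  have "b \<otimes> a \<otimes> commutator G a b = a \<otimes> b"
    by (simp add: commutator_def m_assoc)
  then show ?thesis using assms(3) by (simp add: commute_def)
qed

text \<open>
  Since \<open>c\<close> is central, \<open>S\<^sup>2\<close> lies in three progressions with ratio \<open>c\<close>, starting at \<open>a\<^sup>2\<close>, at \<open>b\<^sup>2\<close> and at the smaller one of
  \<open>ab\<close> and \<open>ba\<close>, of lengths \<open>2i + 1\<close>, \<open>2j + 1\<close> and \<open>i + j + 2\<close>. The two progressions that form \<open>S\<close> are disjoint,
  as \<open>a\<close> and \<open>b\<close> would commute otherwise.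
\<close>

lemma card_two_progressions:
  assumes "two_progressions G R S" "finite S" "S \<subseteq> carrier G"
  shows "card (S <#> S) + 2 \<le> 3 * card S"
proof -
  obtain a b c and i j :: nat where carr [simp]: "a \<in> carrier G" "b \<in> carrier G" "c \<in> carrier G"
    and S: "S = {a \<otimes> c [^] m | m. m \<le> i} \<union> {b \<otimes> c [^] m | m. m \<le> j}"
    and "commutator G a c = \<one>" "commutator G b c = \<one>" and "(\<one>, c) \<in> R - Id"
    and ab: "a \<otimes> b = b \<otimes> a \<otimes> c \<or> b \<otimes> a = a \<otimes> b \<otimes> c"
    using assms(1) unfolding two_progressions_def by blast
  then have ac: "a \<bowtie> c" and bc: "b \<bowtie> c" and c1: "\<one> \<^bold>< c"
    by (auto simp: lt_def intro: commutator_one_commute)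
  define P where "P g k = (\<lambda>m::nat. g \<otimes> c [^] m) ` {..k}" for g and k :: nat
  have cardP: "card (P g k) = k + 1" if "g \<in> carrier G" for g k
  proof -
    have "inj_on (\<lambda>m::nat. g \<otimes> c [^] m) {..k}"
    proof (rule inj_onI)
      fix m m' :: nat
      assume "g \<otimes> c [^] m = g \<otimes> c [^] m'"
      then have "c [^] m = c [^] m'" using that by simp
      then show "m = m'"
        using pow_strict_mono[OF c1, of m m'] pow_strict_mono[OF c1, of m' m]
        by (metis ord.less_irrefl linorder_neqE_nat)
    qed
    then show ?thesis by (simp add: P_def card_image)
  qed
  have S': "S = P a i \<union> P b j"
    unfolding S P_def by auto
  have "\<not> a \<bowtie> b"
  proof
    assume "a \<bowtie> b"
    then have "a \<otimes> b \<otimes> c = a \<otimes> b"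
      using ab by (auto simp: commute_def)
    then show False using c1 by simp
  qed
  have "P a i \<inter> P b j = {}"
  proof (rule ccontr)
    assume "P a i \<inter> P b j \<noteq> {}"
    then obtain m m' :: nat where eq: "a \<otimes> c [^] m = b \<otimes> c [^] m'"
      by (auto simp: P_def)
    have bp: "b \<bowtie> c [^] k" for k :: nat
      using pow_commutes[OF bc] by (simp add: commute_def)
    have "b \<bowtie> a \<otimes> c [^] m"
      unfolding eq using bp by (intro commute_mult) auto
    then have "b \<bowtie> a"
      using commute_left_factor[of b a "c [^] m"] bp by simp
    then show False
      using \<open>\<not> a \<bowtie> b\<close> by (simp add: commute_sym)
  qed
  then have card: "card S = i + j + 2"
    unfolding S' using cardP by (simp add: card_Un_disjoint P_def)
  have prod: "(g \<otimes> c [^] m) \<otimes> (h \<otimes> c [^] k) = g \<otimes> h \<otimes> c [^] (m + k)"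
    if "h \<bowtie> c" and [simp]: "g \<in> carrier G" "h \<in> carrier G" for g h and m k :: nat
  proof -
    have "(g \<otimes> c [^] m) \<otimes> (h \<otimes> c [^] k) = g \<otimes> (c [^] m \<otimes> h) \<otimes> c [^] k"
      by (simp add: m_assoc)
    also have "\<dots> = g \<otimes> h \<otimes> c [^] (m + k)"
      by (simp add: pow_commutes[OF that(1)] m_assoc flip: nat_pow_mult)
    finally show ?thesis .
  qed
  define g where "g = (if a \<otimes> b = b \<otimes> a \<otimes> c then b \<otimes> a else a \<otimes> b)"
  have [simp]: "g \<in> carrier G" by (simp add: g_def)
  have mixed: "a \<otimes> b \<otimes> c [^] m \<in> P g (i + j + 1)" "b \<otimes> a \<otimes> c [^] m \<in> P g (i + j + 1)"
    if "m \<le> i + j" for m :: nat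
  proof -
    have "a \<otimes> b = g \<and> b \<otimes> a = g \<otimes> c \<or> b \<otimes> a = g \<and> a \<otimes> b = g \<otimes> c"
      using ab by (auto simp: g_def)
    moreover have "g \<otimes> c [^] m \<in> P g (i + j + 1)"
      using that by (auto simp: P_def)
    moreover have "g \<otimes> c \<otimes> c [^] m \<in> P g (i + j + 1)"
    proof -
      have "g \<otimes> c \<otimes> c [^] m = g \<otimes> c [^] Suc m"
        using nat_pow_Suc2[of c m] by (simp add: m_assoc)
      then show ?thesis
        using that unfolding P_def by (intro image_eqI[of _ _ "Suc m"]) auto
    qed
    ultimately show "a \<otimes> b \<otimes> c [^] m \<in> P g (i + j + 1)" "b \<otimes> a \<otimes> c [^] m \<in> P g (i + j + 1)"
      by auto
  qed
  have "S <#> S \<subseteq> P (a \<otimes> a) (2 * i) \<union> P (b \<otimes> b) (2 * j) \<union> P g (i + j + 1)"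
  proof
    fix z assume "z \<in> S <#> S"
    then obtain p q where pq: "p \<in> S" "q \<in> S" "z = p \<otimes> q"
      by (auto simp: mem_set_mult)
    obtain h m where hm: "p = h \<otimes> c [^] m" "h = a \<and> m \<le> i \<or> h = b \<and> m \<le> j"
      using pq(1) unfolding S by blast
    obtain h' m' where hm': "q = h' \<otimes> c [^] m'" "h' = a \<and> m' \<le> i \<or> h' = b \<and> m' \<le> j"
      using pq(2) unfolding S by blast
    have "z = h \<otimes> h' \<otimes> c [^] (m + m')"
      unfolding pq(3) hm(1) hm'(1) by (rule prod) (use hm(2) hm'(2) ac bc in auto)
    moreover have "a \<otimes> a \<otimes> c [^] k \<in> P (a \<otimes> a) (2 * i)" if "k \<le> 2 * i" for k :: nat
      using that by (auto simp: P_def)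
    moreover have "b \<otimes> b \<otimes> c [^] k \<in> P (b \<otimes> b) (2 * j)" if "k \<le> 2 * j" for k :: nat
      using that by (auto simp: P_def)
    ultimately show "z \<in> P (a \<otimes> a) (2 * i) \<union> P (b \<otimes> b) (2 * j) \<union> P g (i + j + 1)"
      using hm(2) hm'(2) mixed[of "m + m'"] by auto
  qed
  then have "card (S <#> S) \<le> card (P (a \<otimes> a) (2 * i) \<union> P (b \<otimes> b) (2 * j) \<union> P g (i + j + 1))"
    by (intro card_mono) (auto simp: P_def)
  also have "\<dots> \<le> card (P (a \<otimes> a) (2 * i)) + card (P (b \<otimes> b) (2 * j)) + card (P g (i + j + 1))"
    using card_Un_le[of "P (a \<otimes> a) (2 * i) \<union> P (b \<otimes> b) (2 * j)" "P g (i + j + 1)"]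
      card_Un_le[of "P (a \<otimes> a) (2 * i)" "P (b \<otimes> b) (2 * j)"] by linarith
  also have "\<dots> = (2 * i + 1) + (2 * j + 1) + (i + j + 2)"
    by (simp add: cardP)
  finally show ?thesis using card by simp
qed

lemma pow_through:
  assumes [simp]: "c \<in> carrier G" "e \<in> carrier G" "x \<in> carrier G" and "c \<otimes> x = x \<otimes> e"
  shows "c [^] (m::nat) \<otimes> x = x \<otimes> e [^] m"
proof (induction m)
  case (Suc m)
  have "c [^] Suc m \<otimes> x = c [^] m \<otimes> x \<otimes> e"
    by (simp add: m_assoc assms(4))
  then show ?case by (simp add: Suc m_assoc)
qed simp

lemma conjugate_power_relation:
  assumes [simp]: "c \<in> carrier G" "x \<in> carrier G"
    and "conjugate G c x = c [^] (2::nat) \<or> conjugate G (c [^] (2::nat)) x = c"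
  obtains e where "e \<in> carrier G" "c \<otimes> x = x \<otimes> e" "e = c \<otimes> c \<or> c = e \<otimes> e"
proof -
  have "c \<otimes> x = x \<otimes> conjugate G c x"
    by (rule conjugate_eq) simp_all
  moreover have "conjugate G c x = c \<otimes> c \<or> c = conjugate G c x \<otimes> conjugate G c x"
    using assms(3) by (auto simp: numeral_2_eq_2 conjugate_mult)
  ultimately show thesis
    using that[of "conjugate G c x"] by simp
qed

text \<open>
  With \<open>e = c\<^sup>x\<close>, the product of \<open>xc\<^sup>m\<close> and \<open>xc\<^sup>k\<close> is \<open>x\<^sup>2e\<^sup>mc\<^sup>k\<close>, and one of \<open>e\<close>, \<open>c\<close> is the square of the other:
  only the exponents \<open>0, \<dots>, 3(|S| - 1)\<close> of the root occur.
\<close>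

lemma card_one_progression:
  assumes "one_progression G R S" "finite S" "S \<noteq> {}"
  shows "card (S <#> S) + 2 \<le> 3 * card S"
proof -
  obtain x c where carr [simp]: "x \<in> carrier G" "c \<in> carrier G"
    and S: "S = {x \<otimes> c [^] m | m. m < card S}"
    and rel: "conjugate G c x = c [^] (2::nat) \<or> conjugate G (c [^] (2::nat)) x = c"
    using assms(1) unfolding one_progression_def by blast
  obtain e where e [simp]: "e \<in> carrier G" and cx: "c \<otimes> x = x \<otimes> e" and ec: "e = c \<otimes> c \<or> c = e \<otimes> e"
    by (rule conjugate_power_relation[OF carr(2,1) rel])
  define r where "r = (if e = c \<otimes> c then c else e)"
  have [simp]: "r \<in> carrier G" by (simp add: r_def)
  have r: "\<exists>k\<le>3 * (card S - 1). e [^] m \<otimes> c [^] m' = r [^] k" if "m < card S" "m' < card S" for m m' :: nat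
  proof (cases "e = c \<otimes> c")
    case True
    then have "e [^] m = c [^] (m + m)"
      by (simp add: pow_mult_distrib nat_pow_mult)
    then show ?thesis
      using that True by (intro exI[of _ "m + m + m'"]) (auto simp: r_def nat_pow_mult)
  next
    case False
    then have "c [^] m' = e [^] (m' + m')"
      using ec by (simp add: pow_mult_distrib nat_pow_mult)
    then show ?thesis
      using that False by (intro exI[of _ "m + (m' + m')"]) (auto simp: r_def nat_pow_mult)
  qed
  have "S <#> S \<subseteq> (\<lambda>k::nat. x \<otimes> x \<otimes> r [^] k) ` {..3 * (card S - 1)}"
  proof
    fix z assume "z \<in> S <#> S"
    then obtain p q where pq: "p \<in> S" "q \<in> S" "z = p \<otimes> q"
      by (auto simp: mem_set_mult)
    obtain m where m: "p = x \<otimes> c [^] m" "m < card S"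
      using pq(1) S by blast
    obtain m' where m': "q = x \<otimes> c [^] m'" "m' < card S"
      using pq(2) S by blast
    obtain k where k: "k \<le> 3 * (card S - 1)" "e [^] m \<otimes> c [^] m' = r [^] k"
      using r[OF m(2) m'(2)] by blast
    have "z = x \<otimes> (c [^] m \<otimes> x) \<otimes> c [^] m'"
      by (simp add: pq(3) m(1) m'(1) m_assoc)
    also have "\<dots> = x \<otimes> x \<otimes> (e [^] m \<otimes> c [^] m')"
      unfolding pow_through[OF carr(2) e carr(1) cx] by (simp add: m_assoc)
    finally show "z \<in> (\<lambda>k::nat. x \<otimes> x \<otimes> r [^] k) ` {..3 * (card S - 1)}"
      using k by auto
  qed
  then have "card (S <#> S) \<le> card {..3 * (card S - 1)}"
    by (meson card_image_le card_mono finite_atMost finite_imageI le_trans)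
  moreover have "card S \<noteq> 0"
    using assms(2,3) by simp
  ultimately show ?thesis by simp
qed

lemma card_unit_quadruple:
  assumes "unit_quadruple G S"
  shows "card (S <#> S) \<le> 10"
proof -
  obtain x c where carr [simp]: "x \<in> carrier G" "c \<in> carrier G"
    and S: "S = {\<one>, c, c [^] (2::nat), x}"
    and rel: "conjugate G c x = c [^] (2::nat) \<or> conjugate G (c [^] (2::nat)) x = c"
    using assms unfolding unit_quadruple_def by blast
  obtain e where e [simp]: "e \<in> carrier G" and cx: "c \<otimes> x = x \<otimes> e" and ec: "e = c \<otimes> c \<or> c = e \<otimes> e"
    by (rule conjugate_power_relation[OF carr(2,1) rel])
  have cx': "c \<otimes> (x \<otimes> z) = x \<otimes> (e \<otimes> z)" if "z \<in> carrier G" for z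
    using that cx by (simp add: m_assoc flip: m_assoc[of c x z])
  let ?L = "[\<one>, c, c \<otimes> c, c \<otimes> (c \<otimes> c), c \<otimes> (c \<otimes> (c \<otimes> c)), x, x \<otimes> c, x \<otimes> (c \<otimes> c), x \<otimes> x,
    if e = c \<otimes> c then x \<otimes> (e \<otimes> e) else x \<otimes> e]"
  have "S <#> S \<subseteq> set ?L"
    using ec
  proof
    assume "e = c \<otimes> c"
    then show ?thesis
      unfolding S set_mult_def by (auto simp: numeral_2_eq_2 m_assoc cx cx')
  next
    assume "c = e \<otimes> e"
    note ee = this[symmetric]
    show ?thesis
      unfolding S set_mult_def by (auto simp: numeral_2_eq_2 m_assoc cx cx' ee)
  qed
  then have "card (S <#> S) \<le> card (set ?L)"
    by (intro card_mono) auto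
  also have "\<dots> \<le> length ?L"
    by (rule card_length)
  finally show ?thesis by simp
qed

end

theorem theorem1:
  fixes G (structure) and R :: "'a rel" and S :: "'a set"
  assumes "ordered_group G R"
    and "S \<subseteq> carrier G" and "finite S" and "card S \<ge> 4"
    and "\<not> comm_group (subgroup_generated G S)"
  shows "(card (S <#> S) = 3 * card S - 2 \<longrightarrow>
           two_progressions G R S \<or>
           one_progression G R S \<or>
           card S = 4 \<and>
             (fibonacci_quadruple G R S \<or> unit_quadruple G S \<or>
              noncommuting_quadruple G S \<or> commuting_quadruple G S)) \<and>
         (two_progressions G R S \<or> one_progression G R S \<or> card S = 4 \<and> unit_quadruple G S \<longrightarrow>
           card (S <#> S) = 3 * card S - 2)"
proof -
  interpret ordered_group G R by (rule assms(1))
  have nc: "\<not> commuting_set S"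
    using comm_group_generated_by_commuting_set assms(2,5) by blast
  have lower: "3 * card S \<le> card (S <#> S) + 2"
    using card_square_noncommuting assms(2,3) nc by blast
  show ?thesis
  proof (intro conjI impI)
    assume "card (S <#> S) = 3 * card S - 2"
    then have "tight S"
      using assms(2-4) nc by (intro tightI) auto
    then show "two_progressions G R S \<or> one_progression G R S \<or> card S = 4 \<and>
        (fibonacci_quadruple G R S \<or> unit_quadruple G S \<or>
          noncommuting_quadruple G S \<or> commuting_quadruple G S)"
      using tight_classification assms(4) by blast
  next
    assume "two_progressions G R S \<or> one_progression G R S \<or> card S = 4 \<and> unit_quadruple G S"
    then have "card (S <#> S) + 2 \<le> 3 * card S"
    proof (elim disjE conjE)
      assume "two_progressions G R S"
      then show ?thesis using card_two_progressions assms(2,3) by blast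
    next
      assume "one_progression G R S"
      then show ?thesis using card_one_progression assms(3,4) by fastforce
    next
      assume "card S = 4" "unit_quadruple G S"
      then show ?thesis using card_unit_quadruple by fastforce
    qed
    then show "card (S <#> S) = 3 * card S - 2"
      using lower by simp
  qed
qed

end
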